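(* Let $n\ge 0$, let $W_{-n}$ be the Weyl module for $\mathfrak{osp}(1,2)\otimes\mathbb{C}[t]$ and let $E_{-n}^{A_2^{(2)\dagger}}(x,q,t)$ be the nonsymmetric Macdonald polynomial of type $A_2^{(2)\dagger}$. Then the character of $W_{-n}$ is given by the $t=0$ specialization, $$\mathrm{ch}\,W_{-n}(x,q^2)=E_{-n}^{A_2^{(2)\dagger}}(x,q,0),$$ and the $t=\infty$ specialization coincides with the PBW twisted character of $W_{-n}$, $$E_{-n}^{A_2^{(2)\dagger}}(x,q^{-1},\infty)=\mathrm{ch}(\mathrm{gr}\,W_{-n})(x,q^2,q^2).$$
   Context: Everything is over $\mathbb{C}$. $\mathfrak{osp}(1,2)$ is the Lie superalgebra with even part $\mathfrak{sl}_2$ (standard basis $e,h,f$) and odd part with basis $g^+,g^-$; the nontrivial brackets are $[e,f]=h$, $[h,e]=2e$, $[h,f]=-2f$, $[h,g^\pm]=\pm g^\pm$, $[g^+,g^-]_+=h$, $[g^+,g^+]_+=2e$, $[g^-,g^-]_+=-2f$, $[f,g^+]=-g^-$, $[e,g^-]=-g^+$. Put $\mathfrak n^-=\mathrm{span}(f,g^-)$, $\mathfrak n^+=\mathrm{span}(e,g^+)$, $\mathfrak h=\mathbb{C}h$, and $y_i=y\otimes t^i$ for $y\in\mathfrak{osp}(1,2)$. The Weyl module $W_{-n}$ is the cyclic $\mathfrak{osp}(1,2)[t]$-module with generator $w_{-n}$ and defining relations $(\mathfrak n^-\oplus\mathfrak h)\otimes t\mathbb{C}[t].w_{-n}=0$,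 $(\mathfrak n^-\otimes 1).w_{-n}=0$, $h_0w_{-n}=-nw_{-n}$, $e_0^{n+1}w_{-n}=0$; it is graded by $t$-degree with $\deg w_{-n}=0$. For a graded space $M=\bigoplus_{s\ge0}M_s$ with an action of $h$, $\mathrm{ch}\,M(x,q)=\sum_s q^s\,\mathrm{tr}(x^h|_{M_s})$. PBW filtration: $F_0=\mathbb{C}w_{-n}$, $F_{s+1}=F_s+\mathfrak n^+[t].F_s$. The associated graded $\mathrm{gr}\,W_{-n}$ is a cyclic module over $\mathbb{C}[e_0,e_1,\dots]\otimes\bigwedge(g_0^+,g_1^+,\dots)$; $\mathrm{ch}(\mathrm{gr}W_{-n})(x,q,u)$ is its character, where $x$ records the $h$-weight, $q$ the $t$-degree and $u$ the PBW degree (each $e_i$ and each $g_i^+$ has PBW degree $1$). Macdonald polynomials (rank one specialization of nonsymmetric Koornwinder polynomials), given explicitly by the Ram–Yip alcove walk formula, which may be taken as the definition. Alcoves are the intervals $(i,i+1)$, $i\in\mathbb{Z}$; the wall $i$ is labelled $s_1$ if $i$ is even, $s_0$ if $i$ is odd. For an alcove $a$, $2\,\mathrm{wt}(a)$ is its even endpoint, and $d(a)=0$ (resp. $1$) if the even endpoint is the left (resp. right) one. For $n\le 0$ let $l=-2n$ and let the type be $(s_1,s_0,\dots,s_1,s_0)$ ($l$ entries); for $n>0$ let $l=2n-1$ and the type be $(s_0,s_1,\dots,s_1,s_0)$ ($l$ entries). A walk is a binary word $b\in\{0,1\}^l$: start in the alcove $(0,1)$; at step $i$ look at the wall of the current alcove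 labelled by the $i$-th entry of the type; if $b_i=1$ cross it into the adjacent alcove, if $b_i=0$ stay (a folding). A folding is positive if that wall is the left endpoint of the current alcove and negative if it is the right endpoint. $J$ is the set of folding steps; $J_{0+},J_{0-}$ are the positive, negative foldings at steps with label $s_0$, and $J_+,J_-$ the positive, negative foldings at steps with label $s_1$; $p_J$ is the final alcove. Let $v=t^{1/2}$, $\xi_j=q^{\,l+1-j}v^2$, $\varepsilon(n)=-1$ if $n>0$ and $\varepsilon(n)=0$ if $n\le0$. Then $$E_n^{A_2^{(2)\dagger}}(x,q,t)=\sum_{b}v^{\varepsilon(n)+d(p_J)-|J|}(1-v^2)^{|J|}\prod_{j\in J_{0+}}\frac1{1-\xi_j^2}\prod_{j\in J_{0-}}\frac{\xi_j^2}{1-\xi_j^2}\prod_{j\in J_+}\frac1{1-\xi_j}\prod_{j\in J_-}\frac{\xi_j}{1-\xi_j}\;x^{\mathrm{wt}(p_J)}.$$ $E_n(x,q,0)$ and $E_n(x,q,\infty)$ denote the limits $t\to0$ and $t\to\infty$; $E_n(x,q^{-1},\infty)$ is the latter with $q$ replaced by $q^{-1}$. *)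

theory Defs
  imports "HOL-Analysis.Analysis" "HOL-Library.Poly_Mapping"
begin

section \<open>The Lie superalgebra osp(1,2) and its current algebra\<close>

datatype osp12 = Osp_e | Osp_h | Osp_f | Osp_gp | Osp_gm

fun osp_parity :: "osp12 \<Rightarrow> nat" where
  "osp_parity Osp_gp = 1"
| "osp_parity Osp_gm = 1"
| "osp_parity _ = 0"

text \<open>The super bracket of two basis vectors, as a vector of the five-dimensional space with
  basis \<^typ>\<open>osp12\<close>. Besides the usual table it lists the brackets forced by super
  skew-symmetry.\<close>

fun osp_bracket :: "osp12 \<Rightarrow> osp12 \<Rightarrow> (osp12 \<Rightarrow>\<^sub>0 complex)" where
  "osp_bracket Osp_e Osp_f = Poly_Mapping.single Osp_h 1"
| "osp_bracket Osp_f Osp_e = Poly_Mapping.single Osp_h (-1)"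
| "osp_bracket Osp_h Osp_e = Poly_Mapping.single Osp_e 2"
| "osp_bracket Osp_e Osp_h = Poly_Mapping.single Osp_e (-2)"
| "osp_bracket Osp_h Osp_f = Poly_Mapping.single Osp_f (-2)"
| "osp_bracket Osp_f Osp_h = Poly_Mapping.single Osp_f 2"
| "osp_bracket Osp_h Osp_gp = Poly_Mapping.single Osp_gp 1"
| "osp_bracket Osp_gp Osp_h = Poly_Mapping.single Osp_gp (-1)"
| "osp_bracket Osp_h Osp_gm = Poly_Mapping.single Osp_gm (-1)"
| "osp_bracket Osp_gm Osp_h = Poly_Mapping.single Osp_gm 1"
| "osp_bracket Osp_gp Osp_gm = Poly_Mapping.single Osp_h 1"
| "osp_bracket Osp_gm Osp_gp = Poly_Mapping.single Osp_h 1"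
| "osp_bracket Osp_gp Osp_gp = Poly_Mapping.single Osp_e 2"
| "osp_bracket Osp_gm Osp_gm = Poly_Mapping.single Osp_f (-2)"
| "osp_bracket Osp_f Osp_gp = Poly_Mapping.single Osp_gm (-1)"
| "osp_bracket Osp_gp Osp_f = Poly_Mapping.single Osp_gm 1"
| "osp_bracket Osp_e Osp_gm = Poly_Mapping.single Osp_gp (-1)"
| "osp_bracket Osp_gm Osp_e = Poly_Mapping.single Osp_gp 1"
| "osp_bracket _ _ = 0"

text \<open>The free associative algebra on the symbols $y_i = y \otimes t^i$, where $y$ runs over the
  basis of osp(1,2) and $i$ over the naturals: the monoid algebra of the free monoid on these
  symbols (lists under concatenation), with the convolution product of
  \<^theory>\<open>HOL-Library.Poly_Mapping\<close>.\<close>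

datatype osp_word = Osp_Word (letters: "(osp12 \<times> nat) list")

instantiation osp_word :: monoid_add
begin

definition zero_osp_word :: osp_word where
  "0 = Osp_Word []"

definition plus_osp_word :: "osp_word \<Rightarrow> osp_word \<Rightarrow> osp_word" where
  "a + b = Osp_Word (letters a @ letters b)"

instance
  by standard (auto simp: zero_osp_word_def plus_osp_word_def)

end

type_synonym free_alg = "osp_word \<Rightarrow>\<^sub>0 complex"

definition fscale :: "complex \<Rightarrow> free_alg \<Rightarrow> free_alg" where
  "fscale c p = Poly_Mapping.single 0 c * p"

global_interpretation fa: vector_space fscale
  by standard
    (simp_all add: fscale_def distrib_left distrib_right single_add mult_single
      flip: mult.assoc)

definition cur :: "osp12 \<Rightarrow> nat \<Rightarrow> free_alg" where
  "cur y i = Poly_Mapping.single (Osp_Word [(y, i)]) 1"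

text \<open>The universal enveloping superalgebra of osp(1,2)[t] is the free algebra modulo the
  two-sided ideal of the relations
  $y_i z_j - (-1)^{|y||z|} z_j y_i = [y,z]_{i+j}$; these are bilinear, so basis vectors suffice.\<close>

definition super_rel :: "osp12 \<Rightarrow> nat \<Rightarrow> osp12 \<Rightarrow> nat \<Rightarrow> free_alg" where
  "super_rel y i z j =
     cur y i * cur z j - fscale ((-1) ^ (osp_parity y * osp_parity z)) (cur z j * cur y i)
     - (\<Sum>x\<in>Poly_Mapping.keys (osp_bracket y z).
          fscale (Poly_Mapping.lookup (osp_bracket y z) x) (cur x (i + j)))"

definition enveloping_ideal :: "free_alg set" where
  "enveloping_ideal = fa.span {a * super_rel y i z j * b |a y i z j b. True}"

section \<open>The Weyl module\<close>

text \<open>Elements of the free algebra annihilating the generator $w_{-n}$.\<close>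

definition weyl_rels :: "nat \<Rightarrow> free_alg set" where
  "weyl_rels n =
     {cur y i |y i. y \<in> {Osp_f, Osp_gm, Osp_h} \<and> i \<ge> 1}
     \<union> {cur Osp_f 0, cur Osp_gm 0}
     \<union> {cur Osp_h 0 + fscale (of_nat n) 1}
     \<union> {cur Osp_e 0 ^ (n + 1)}"

text \<open>The Weyl module $W_{-n}$ is the quotient of the free algebra by the following left ideal
  (that is, the quotient of the enveloping algebra by the left ideal generated by the relations of
  $w_{-n}$). The generator is the class of 1 and $y_i$ acts by left multiplication with
  \<^term>\<open>cur y i\<close>. Subspaces of $W_{-n}$ are represented by their preimages, i.e. by subspaces of
  the free algebra containing this ideal.\<close>

definition weyl_ideal :: "nat \<Rightarrow> free_alg set" where
  "weyl_ideal n = fa.span (enveloping_ideal \<union> {a * r |a r. r \<in> weyl_rels n})"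

definition tdeg :: "osp_word \<Rightarrow> nat" where
  "tdeg w = (\<Sum>(y, i)\<leftarrow>letters w. i)"

text \<open>Preimage of the component of $t$-degree $m$ of $W_{-n}$.\<close>

definition weyl_component :: "nat \<Rightarrow> nat \<Rightarrow> free_alg set" where
  "weyl_component n m =
     fa.span (weyl_ideal n \<union> {p. \<forall>w\<in>Poly_Mapping.keys p. tdeg w = m})"

text \<open>Preimages of the members of the PBW filtration.\<close>

primrec pbw_filtration :: "nat \<Rightarrow> nat \<Rightarrow> free_alg set" where
  "pbw_filtration n 0 = fa.span (weyl_ideal n \<union> {1})"
| "pbw_filtration n (Suc s) =
     fa.span (pbw_filtration n s
       \<union> {cur y i * v |y i v. y \<in> {Osp_e, Osp_gp} \<and> v \<in> pbw_filtration n s})"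

text \<open>What is divided out of the \<open>s\<close>-th member in the associated graded space; in the lowest
  degree it is the zero subspace of $W_{-n}$.\<close>

definition pbw_below :: "nat \<Rightarrow> nat \<Rightarrow> free_alg set" where
  "pbw_below n s = (case s of 0 \<Rightarrow> weyl_ideal n | Suc s' \<Rightarrow> pbw_filtration n s')"

section \<open>Characters\<close>

text \<open>For subspaces $B \subseteq A$, \<open>S\<close> represents a basis of $A/B$. The dimension
  \<open>quot_dim A B\<close> is 0 when $A/B$ is infinite-dimensional.\<close>

definition basis_mod :: "free_alg set \<Rightarrow> free_alg set \<Rightarrow> free_alg set \<Rightarrow> bool" where
  "basis_mod A B S \<longleftrightarrow>
     S \<subseteq> A \<and> A \<subseteq> fa.span (S \<union> B) \<and>
     (\<forall>T c. finite T \<and> T \<subseteq> S \<and> (\<Sum>v\<in>T. fscale (c v) v) \<in> B \<longrightarrow> (\<forall>v\<in>T. c v = 0))"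

definition quot_dim :: "free_alg set \<Rightarrow> free_alg set \<Rightarrow> nat" where
  "quot_dim A B = card (SOME S. basis_mod A B S)"

text \<open>Preimage of the eigenspace of $h_0$ in $A/B$ for the eigenvalue \<open>k\<close>.\<close>

definition weight_space :: "free_alg set \<Rightarrow> free_alg set \<Rightarrow> int \<Rightarrow> free_alg set" where
  "weight_space A B k = {v \<in> A. cur Osp_h 0 * v - fscale (of_int k) v \<in> B}"

text \<open>The trace of $x^h$ on $A/B$: the operator $x^h$ is multiplication by $x^k$ on the
  eigenspace of $h$ for \<open>k\<close>.\<close>

definition weight_trace :: "free_alg set \<Rightarrow> free_alg set \<Rightarrow> complex \<Rightarrow> complex" where
  "weight_trace A B x =
     (\<Sum>\<^sub>\<infinity>k::int. of_nat (quot_dim (weight_space A B k) B) * x powi k)"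

definition weyl_char :: "nat \<Rightarrow> complex \<Rightarrow> complex \<Rightarrow> complex" where
  "weyl_char n x q =
     (\<Sum>\<^sub>\<infinity>m::nat. q ^ m * weight_trace (weyl_component n m) (weyl_ideal n) x)"

text \<open>The part of $t$-degree \<open>m\<close> and PBW degree \<open>s\<close> of the associated graded space is
  $(F_s \cap W_m) / (F_{s-1} \cap W_m)$, where $W_m$ is the component of $t$-degree \<open>m\<close>.\<close>

definition gr_weyl_char :: "nat \<Rightarrow> complex \<Rightarrow> complex \<Rightarrow> complex \<Rightarrow> complex" where
  "gr_weyl_char n x q u =
     (\<Sum>\<^sub>\<infinity>(s::nat, m::nat). u ^ s * q ^ m *
        weight_trace (pbw_filtration n s \<inter> weyl_component n m)
          (pbw_below n s \<inter> weyl_component n m) x)"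

section \<open>Nonsymmetric Macdonald polynomials by alcove walks\<close>

text \<open>The alcove $(a, a+1)$ is represented by the integer \<open>a\<close>.\<close>

datatype wall_label = S0 | S1

definition wall :: "wall_label \<Rightarrow> int \<Rightarrow> int" where
  "wall s a = (if even a \<longleftrightarrow> s = S1 then a else a + 1)"

definition cross :: "wall_label \<Rightarrow> int \<Rightarrow> int" where
  "cross s a = (if wall s a = a then a - 1 else a + 1)"

definition alcove_wt :: "int \<Rightarrow> int" where
  "alcove_wt a = wall S1 a div 2"

definition alcove_d :: "int \<Rightarrow> int" where
  "alcove_d a = (if wall S1 a = a then 0 else 1)"

definition walk_length :: "int \<Rightarrow> nat" where
  "walk_length n = (if n \<le> 0 then nat (- 2 * n) else nat (2 * n - 1))"

text \<open>Steps are numbered from 1.\<close>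

definition step_label :: "int \<Rightarrow> nat \<Rightarrow> wall_label" where
  "step_label n j = (if n \<le> 0 then (if odd j then S1 else S0) else (if odd j then S0 else S1))"

text \<open>A walk is a list of booleans, step \<open>j\<close> being governed by entry \<open>j - 1\<close>: true means
  crossing, false means folding. \<open>alcove_after n b j\<close> is the alcove reached after \<open>j\<close> steps.\<close>

primrec alcove_after :: "int \<Rightarrow> bool list \<Rightarrow> nat \<Rightarrow> int" where
  "alcove_after n b 0 = 0"
| "alcove_after n b (Suc j) =
     (if b ! j then cross (step_label n (Suc j)) (alcove_after n b j) else alcove_after n b j)"

definition walk_end :: "int \<Rightarrow> bool list \<Rightarrow> int" where
  "walk_end n b = alcove_after n b (walk_length n)"

definition foldings :: "int \<Rightarrow> bool list \<Rightarrow> nat set" where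
  "foldings n b = {j \<in> {1..walk_length n}. \<not> b ! (j - 1)}"

definition pos_foldings :: "wall_label \<Rightarrow> int \<Rightarrow> bool list \<Rightarrow> nat set" where
  "pos_foldings s n b = {j \<in> foldings n b. step_label n j = s \<and>
     wall s (alcove_after n b (j - 1)) = alcove_after n b (j - 1)}"

definition neg_foldings :: "wall_label \<Rightarrow> int \<Rightarrow> bool list \<Rightarrow> nat set" where
  "neg_foldings s n b = {j \<in> foldings n b. step_label n j = s \<and>
     wall s (alcove_after n b (j - 1)) = alcove_after n b (j - 1) + 1}"

definition walk_xi :: "int \<Rightarrow> complex \<Rightarrow> complex \<Rightarrow> nat \<Rightarrow> complex" where
  "walk_xi n q v j = q ^ (walk_length n + 1 - j) * v ^ 2"

text \<open>The polynomial evaluated at complex numbers. The total exponent of $v = t^{1/2}$ in each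
  summand is even, so the choice of the square root is immaterial. For fixed \<open>x\<close> and nonzero \<open>q\<close>
  the denominators vanish for finitely many \<open>t\<close> only and do not affect the limits $t \to 0$ and
  $t \to \infty$.\<close>

definition macdonald_E :: "int \<Rightarrow> complex \<Rightarrow> complex \<Rightarrow> complex \<Rightarrow> complex" where
  "macdonald_E n x q t =
    (let v = csqrt t; \<xi> = walk_xi n q v; \<epsilon> = (if n > 0 then -1 else 0) in
     \<Sum>b | length b = walk_length n.
       v powi (\<epsilon> + alcove_d (walk_end n b) - int (card (foldings n b)))
       * (1 - v ^ 2) ^ card (foldings n b)
       * (\<Prod>j\<in>pos_foldings S0 n b. 1 / (1 - (\<xi> j)^2))
       * (\<Prod>j\<in>neg_foldings S0 n b. (\<xi> j)^2 / (1 - (\<xi> j)^2))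
       * (\<Prod>j\<in>pos_foldings S1 n b. 1 / (1 - \<xi> j))
       * (\<Prod>j\<in>neg_foldings S1 n b. \<xi> j / (1 - \<xi> j))
       * x powi alcove_wt (walk_end n b))"

end

theory Submission
  imports Defs "HOL-Computational_Algebra.Polynomial" "HOL-Computational_Algebra.Formal_Power_Series"
    "HOL-Library.Multiset" "HOL-Library.Function_Algebras" "HOL-Combinatorics.Transposition"
begin

text \<open>
  \<^bold>\<open>Upper bound.\<close> Let \<open>e(z)\<close> be the generating function of the \<open>e\<^sub>i\<close>. Applying $f_1$ repeatedly to
  $e_0^{n+1} w = 0$ kills the coefficient of $z^a$ in $e(z)^b w$ for $a + b > n$. Encode monomials in $k$ even
  and $r$ odd raising operators applied to $w$ by monomials in $k + r$ commuting variables; the encoding is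
  symmetric in the first $k$ variables and, modulo lower PBW degree, antisymmetric in the last $r$. In
  these terms the relation, together with its images under the $h_j$ and $g^-_j$, says that the complete
  symmetric functions of degree $m > n - k - r$ in all variables act by zero modulo lower PBW degree. It follows
  that $W_{-n}$ is spanned by products of elementary symmetric functions of the two groups of variables, with
  exponent sums at most $n - k - r$ and $n - r$, times the staircase monomial in the odd
  variables. There are $3^n$ of these.

  \<^bold>\<open>Lower bound.\<close> The tensor product of \<open>n\<close> three-dimensional evaluation modules at distinct points
  is cyclic of dimension $3^n$, and the homogeneous components of the relations of $W_{-n}$ hold in it up to terms of
  lower $t$-degree. Hence the images of the spanning vectors span it too, so they are linearly
  independent. Both characters are therefore sums of $q$-trinomial coefficients.

  \<^bold>\<open>Alcove walks.\<close> Two consecutive steps preserve a two-dimensional space of functions on alcoves, so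
  the sum over walks is a product of $2 \times 2$ matrices rational in $t$. Their limits implement the recursions
  of the same $q$-trinomial sums.\<close>

section \<open>Linear extension to free modules\<close>

text \<open>One explicit family in the free algebra, \<open>box_elem\<close>, carries the
  comparison: its members are homogeneous in t-degree, are weight vectors modulo the ideal and have
  a definite PBW degree, so once they form a basis of W_{-n} both characters are read off from one
  index set. No PBW theorem is invoked: independence comes only from the tensor product. The
  obstacle is that this module is not a quotient of W_{-n}, as h_i with i \<ge> 1 multiplies its
  generator by a power sum of the points. The error has smaller t-degree, so relations are tested
  one t-degree at a time, modulo lower ones. Quotients are handled by preimages in the free algebra
  and by a linear projection with the ideal as kernel. The shape of the boxes comes from geometry:
  polynomials in k + r variables, symmetric in each group, modulo the complete symmetric functions
  of degree above n - k - r form the cohomology ring of a two-step flag variety, with a q-trinomial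
  coefficient as Poincare polynomial. The staircase shifts it by r(r-1)/2.\<close>

abbreviation lookup where "lookup \<equiv> Poly_Mapping.lookup"
abbreviation keys where "keys \<equiv> Poly_Mapping.keys"
abbreviation single where "single \<equiv> Poly_Mapping.single"

text \<open>The same scaling on an arbitrary monoid algebra: on words it is \<open>fscale\<close>,
  on exponent vectors it scales polynomials, so the free algebra and the polynomial ring share their
  linear algebra.\<close>

definition cscale :: "complex \<Rightarrow> ('a::monoid_add \<Rightarrow>\<^sub>0 complex) \<Rightarrow> ('a \<Rightarrow>\<^sub>0 complex)"
  where "cscale c p = single 0 c * p"

lemma fscale_eq_cscale: "fscale = cscale"
  by (intro ext) (simp add: fscale_def cscale_def)

global_interpretation pm: vector_space cscale
  by standard
    (simp_all add: cscale_def distrib_left distrib_right single_add mult_single flip: mult.assoc)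

lemma cscale_single [simp]: "cscale c (single a d) = single a (c * d)"
  by (simp add: cscale_def mult_single)

lemma sum_single_keys: "(\<Sum>a\<in>keys p. single a (lookup p a)) = p"
  by (intro poly_mapping_eqI) (auto simp: lookup_sum lookup_single when_def in_keys_iff)

lemma sum_cscale_keys: "(\<Sum>a\<in>keys p. cscale (lookup p a) (single a 1)) = p"
  using sum_single_keys[of p] by simp

lemma cscale_central: "p * single 0 c = single 0 c * p" for p :: "'a::monoid_add \<Rightarrow>\<^sub>0 complex"
proof -
  have "(\<Sum>a\<in>keys p. single a (lookup p a)) * single 0 c
      = single 0 c * (\<Sum>a\<in>keys p. single a (lookup p a))"
    by (simp add: sum_distrib_left sum_distrib_right mult_single mult.commute)
  then show ?thesis by (simp add: sum_single_keys)
qed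

lemma cscale_mult_left [simp]: "cscale c p * q = cscale c (p * q)"
  by (simp add: cscale_def mult.assoc)

lemma cscale_mult_right [simp]: "p * cscale c q = cscale c (p * q)"
  by (metis cscale_central cscale_def mult.assoc)

lemma lookup_cscale [simp]: "lookup (cscale c p) a = c * lookup p a"
proof -
  have "cscale c p = (\<Sum>b\<in>keys p. single b (c * lookup p b))"
    by (subst sum_cscale_keys[of p, symmetric]) (simp add: pm.scale_sum_right)
  then show ?thesis
    by (auto simp: lookup_sum lookup_single when_def in_keys_iff)
qed

lemma keys_cscale_subset: "keys (cscale c p) \<subseteq> keys p"
  by (auto simp: in_keys_iff)

lemma pm_induct [case_names zero single add]:
  fixes p :: "'a \<Rightarrow>\<^sub>0 complex"
  assumes "P 0" "\<And>a c. P (single a c)" "\<And>p q. P p \<Longrightarrow> P q \<Longrightarrow> P (p + q)"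
  shows "P p"
proof -
  have "P (\<Sum>a\<in>A. single a (lookup p a))" if "finite A" for A
    using that by induction (auto intro: assms)
  from this[of "keys p"] show ?thesis by (simp add: sum_single_keys)
qed

text \<open>Linear extensions take values in polynomial rings, in the free algebra and in spaces of
  functions, hence the target space is a locale parameter.\<close>

locale cvector_space = vector_space scale
  for scale :: "complex \<Rightarrow> 'v::ab_group_add \<Rightarrow> 'v"
begin

definition linext :: "('a \<Rightarrow> 'v) \<Rightarrow> ('a \<Rightarrow>\<^sub>0 complex) \<Rightarrow> 'v"
  where "linext f p = (\<Sum>a\<in>keys p. scale (lookup p a) (f a))"

lemma linext_superset:
  assumes "finite A" "keys p \<subseteq> A"
  shows "linext f p = (\<Sum>a\<in>A. scale (lookup p a) (f a))"
  unfolding linext_def using assms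
  by (intro sum.mono_neutral_left) (auto simp: in_keys_iff)

lemma linext_zero [simp]: "linext f 0 = 0"
  by (simp add: linext_def)

lemma linext_single [simp]: "linext f (single a c) = scale c (f a)"
  by (simp add: linext_def)

lemma linext_add: "linext f (p + q) = linext f p + linext f q"
proof -
  let ?A = "keys p \<union> keys q"
  have "linext f (p + q) = (\<Sum>a\<in>?A. scale (lookup (p + q) a) (f a))"
    by (rule linext_superset) (auto simp: Poly_Mapping.keys_add)
  also have "\<dots> = linext f p + linext f q"
    by (simp add: linext_superset[of ?A] lookup_add scale_left_distrib sum.distrib)
  finally show ?thesis .
qed

lemma linext_cscale: "linext f (cscale c p) = scale c (linext f p)"
  for p :: "'a::monoid_add \<Rightarrow>\<^sub>0 complex"
proof -
  have "linext f (cscale c p) = (\<Sum>a\<in>keys p. scale (lookup (cscale c p) a) (f a))"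
    by (rule linext_superset) (auto simp: keys_cscale_subset)
  then show ?thesis by (simp add: linext_def scale_sum_right)
qed

lemma linext_uminus: "linext f (- p) = - linext f p"
  using linext_add[of f p "- p"] by (simp add: eq_neg_iff_add_eq_0 add.commute)

lemma linext_diff: "linext f (p - q) = linext f p - linext f q"
  using linext_add[of f p "- q"] by (simp add: linext_uminus)

lemma linext_sum: "linext f (sum g A) = (\<Sum>i\<in>A. linext f (g i))"
  by (induction A rule: infinite_finite_induct) (auto simp: linext_add)

lemma linext_span:
  fixes P :: "('a::monoid_add \<Rightarrow>\<^sub>0 complex) set"
  assumes "p \<in> pm.span P" "\<And>q. q \<in> P \<Longrightarrow> linext f q \<in> U" "subspace U"
  shows "linext f p \<in> U"
  using assms(1)
proof (induction rule: pm.span_induct_alt)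
  case base show ?case using assms(3) by (simp add: subspace_0)
next
  case (step c x y) then show ?case
    using assms(2,3) by (auto simp: linext_add linext_cscale intro: subspace_add subspace_scale)
qed

lemma linext_mem:
  assumes "subspace U" "\<And>a. a \<in> keys p \<Longrightarrow> f a \<in> U"
  shows "linext f p \<in> U"
  unfolding linext_def using assms by (auto intro!: subspace_sum subspace_scale)

lemma linear_map_linext:
  assumes "\<And>u v. A (u + v) = A u + A v" "\<And>c v. A (scale c v) = scale c (A v)"
  shows "A (linext f p) = linext (\<lambda>a. A (f a)) p"
proof -
  have "A 0 = 0" using assms(2)[of 0 0] by simp
  have "A (sum g S) = (\<Sum>i\<in>S. A (g i))" if "finite S" for g :: "'a \<Rightarrow> 'v" and S
    using that by (induction S rule: finite_induct) (auto simp: assms \<open>A 0 = 0\<close>)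
  then show ?thesis by (simp add: linext_def assms)
qed

end

global_interpretation pm: cvector_space cscale ..

lemma pm_linext_mult:
  fixes p q :: "'a::monoid_add \<Rightarrow>\<^sub>0 complex" and f :: "'a \<Rightarrow> 'b::monoid_add \<Rightarrow>\<^sub>0 complex"
  assumes "\<And>a b. f (a + b) = f a * f b"
  shows "pm.linext f (p * q) = pm.linext f p * pm.linext f q"
proof (induction p rule: pm_induct)
  case (single a c)
  show ?case
    by (induction q rule: pm_induct)
      (auto simp: mult_single assms pm.linext_add distrib_left mult.commute)
qed (auto simp: pm.linext_add distrib_right)

section \<open>Gaussian binomials\<close>

text \<open>The Gaussian binomial coefficient of \<open>k + M\<close> over \<open>k\<close>,
  parametrized by the sides of a box: it enumerates the partitions inside a \<open>k\<close> by
  \<open>M\<close> rectangle. The recursion avoids division, so \<open>p\<close> may be a root of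
  unity.\<close>

fun qbin :: "'a::comm_ring_1 \<Rightarrow> nat \<Rightarrow> nat \<Rightarrow> 'a" where
  "qbin p 0 M = 1"
| "qbin p (Suc k) 0 = 1"
| "qbin p (Suc k) (Suc M) = qbin p k (Suc M) + p ^ Suc k * qbin p (Suc k) M"

lemma qbin_0 [simp]: "qbin p k 0 = 1"
  by (cases k) auto

primrec qfact :: "'a::comm_ring_1 \<Rightarrow> nat \<Rightarrow> 'a" where
  "qfact p 0 = 1"
| "qfact p (Suc n) = (\<Sum>i<Suc n. p ^ i) * qfact p n"

lemma sum_powers_add: "(\<Sum>i<a + b. p ^ i) = (\<Sum>i<a. p ^ i) + p ^ a * (\<Sum>i<b. p ^ i :: 'a::comm_ring_1)"
  by (induction b) (auto simp: algebra_simps power_add)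

lemma qbin_qfact: "qbin p k M * (qfact p k * qfact p M) = qfact p (k + M)"
proof (induction p k M rule: qbin.induct)
  case (3 p k M)
  have s: "(\<Sum>i<Suc (Suc (k + M)). p ^ i) = (\<Sum>i<Suc k. p ^ i) + p ^ Suc k * (\<Sum>i<Suc M. p ^ i)"
    using sum_powers_add[of p "Suc k" "Suc M"] by simp
  have "qbin p (Suc k) (Suc M) * (qfact p (Suc k) * qfact p (Suc M))
      = (\<Sum>i<Suc k. p ^ i) * (qbin p k (Suc M) * (qfact p k * qfact p (Suc M)))
        + p ^ Suc k * (\<Sum>i<Suc M. p ^ i) * (qbin p (Suc k) M * (qfact p (Suc k) * qfact p M))"
    unfolding qbin.simps qfact.simps by (simp add: algebra_simps del: sum.lessThan_Suc)
  also have "\<dots> = (\<Sum>i<Suc (Suc (k + M)). p ^ i) * qfact p (Suc (k + M))"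
    unfolding 3 s by (simp add: algebra_simps del: sum.lessThan_Suc qfact.simps)
  also have "\<dots> = qfact p (Suc k + Suc M)" by simp
  finally show ?case .
qed auto

lemma poly_qbin: "poly (qbin [:0, 1:] k M) x = qbin x k M"
  by (induction "[:0, 1:] :: 'a poly" k M rule: qbin.induct) auto

lemma poly_qfact: "poly (qfact [:0, 1:] k) x = qfact x k"
  by (induction k) (auto simp: poly_sum poly_power)

lemma qfact_0 [simp]: "qfact 0 k = 1"
  by (induction k) (auto simp: power_0_left)

text \<open>The q-factorials can vanish at roots of unity. They are therefore cancelled over the
  polynomial ring, with \<open>p\<close> an indeterminate, and the identities are specialized
  afterwards.\<close>

lemma qfact_poly_nonzero: "qfact [:0, 1 :: 'a::idom:] k \<noteq> 0"
proof
  assume "qfact [:0, 1 :: 'a:] k = 0"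
  then have "poly (qfact [:0, 1 :: 'a:] k) 0 = 0" by simp
  then show False by (simp add: poly_qfact)
qed

lemma qbin_commute: "qbin p k M = qbin p M k" for p :: "'a::idom"
proof -
  let ?X = "[:0, 1 :: 'a:]"
  have "qbin ?X k M * (qfact ?X k * qfact ?X M) = qbin ?X M k * (qfact ?X k * qfact ?X M)"
    using qbin_qfact[of ?X k M] qbin_qfact[of ?X M k] by (simp add: add.commute mult.commute)
  then have "qbin ?X k M = qbin ?X M k" by (simp add: qfact_poly_nonzero)
  then show ?thesis by (metis poly_qbin)
qed

text \<open>Both products are the q-multinomial coefficient of \<open>M + k + r\<close> over
  \<open>k\<close>, \<open>r\<close>, \<open>M\<close>.\<close>

lemma qbin_assoc: "qbin p k M * qbin p r (M + k) = qbin p r M * qbin p k (M + r)" for p :: "'a::idom"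
proof -
  let ?X = "[:0, 1 :: 'a:]"
  have "qbin ?X k M * qbin ?X r (M + k) * (qfact ?X k * qfact ?X M * qfact ?X r * qfact ?X (M + k))
     = qbin ?X k M * (qfact ?X k * qfact ?X M) * (qbin ?X r (M + k) * (qfact ?X r * qfact ?X (M + k)))"
    by algebra
  also have "\<dots> = qfact ?X (M + k) * qfact ?X (M + k + r)"
    by (simp add: qbin_qfact add_ac)
  finally have 1: "qbin ?X k M * qbin ?X r (M + k) * (qfact ?X k * qfact ?X M * qfact ?X r) = qfact ?X (M + k + r)"
    using qfact_poly_nonzero[of "M + k", where 'a = 'a] by (simp add: mult_ac)
  have "qbin ?X r M * qbin ?X k (M + r) * (qfact ?X k * qfact ?X M * qfact ?X r * qfact ?X (M + r))
     = qbin ?X r M * (qfact ?X r * qfact ?X M) * (qbin ?X k (M + r) * (qfact ?X k * qfact ?X (M + r)))"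
    by algebra
  also have "\<dots> = qfact ?X (M + r) * qfact ?X (M + k + r)"
    by (simp add: qbin_qfact add_ac)
  finally have 2: "qbin ?X r M * qbin ?X k (M + r) * (qfact ?X k * qfact ?X M * qfact ?X r) = qfact ?X (M + k + r)"
    using qfact_poly_nonzero[of "M + r", where 'a = 'a] by (simp add: mult_ac)
  have "qbin ?X k M * qbin ?X r (M + k) = qbin ?X r M * qbin ?X k (M + r)"
    using 1 2 qfact_poly_nonzero[where 'a = 'a]
    by (metis (no_types, lifting) mult_cancel_right mult_eq_0_iff)
  then have "poly (qbin ?X k M * qbin ?X r (M + k)) p = poly (qbin ?X r M * qbin ?X k (M + r)) p"
    by simp
  then show ?thesis by (simp add: poly_qbin)
qed

lemma qbin_Suc_Suc': "qbin p (Suc k) (Suc M) = p ^ Suc M * qbin p k (Suc M) + qbin p (Suc k) M"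
  for p :: "'a::idom"
proof -
  have "qbin p (Suc k) (Suc M) = qbin p (Suc M) (Suc k)" by (rule qbin_commute)
  also have "\<dots> = qbin p M (Suc k) + p ^ Suc M * qbin p (Suc M) k" by simp
  also have "qbin p M (Suc k) = qbin p (Suc k) M" by (rule qbin_commute)
  also have "qbin p (Suc M) k = qbin p k (Suc M)" by (rule qbin_commute)
  finally show ?thesis by simp
qed

text \<open>The q-trinomial coefficient in the factored form in which it arises later: with
  \<open>a = M\<close>, \<open>b = r\<close>, \<open>c = k\<close> the factors enumerate a
  \<open>k\<close> by \<open>M\<close> box and an \<open>r\<close> by \<open>M + k\<close> box. This
  form hides the symmetry in the three indices.\<close>

definition qtri :: "'a::comm_ring_1 \<Rightarrow> nat \<Rightarrow> nat \<Rightarrow> nat \<Rightarrow> 'a" where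
  "qtri p a b c = qbin p c a * qbin p b (a + c)"

lemma qtri_swap23: "qtri p a b c = qtri p a c b" for p :: "'a::idom"
  unfolding qtri_def by (rule qbin_assoc)

lemma qtri_swap13: "qtri p a b c = qtri p c b a" for p :: "'a::idom"
  unfolding qtri_def by (simp add: qbin_commute[of p c a] add.commute)

text \<open>By symmetry this Pascal recurrence may be read with the indices in any order, and the
  order decides which powers of \<open>p\<close> appear. Four orders are used below.\<close>

lemma qtri_rec:
  fixes p :: "'a::idom"
  assumes "a + b + c > 0"
  shows "qtri p a b c = (if a = 0 then 0 else qtri p (a - 1) b c)
    + (if b = 0 then 0 else p ^ a * qtri p a (b - 1) c)
    + (if c = 0 then 0 else p ^ (a + b) * qtri p a b (c - 1))"
proof -
  have t: "qtri p a b c = qbin p b a * qbin p c (a + b)" for a b c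
    by (subst qtri_swap23) (simp add: qtri_def)
  show ?thesis
    using assms unfolding t
    by (cases a; cases b; cases c)
      (simp_all add: qbin_Suc_Suc' algebra_simps power_add del: qbin.simps(3))
qed

definition triples :: "nat \<Rightarrow> (nat \<times> nat \<times> nat) set" where
  "triples N = {(a, b, c). a + b + c = N}"

lemma finite_triples [simp]: "finite (triples N)"
  by (rule finite_subset[of _ "{..N} \<times> {..N} \<times> {..N}"]) (auto simp: triples_def)

lemma triples_0: "triples 0 = {(0, 0, 0)}"
  by (auto simp: triples_def)

lemma sum_triples_Suc:
  fixes f g1 g2 g3 :: "nat \<Rightarrow> nat \<Rightarrow> nat \<Rightarrow> 'a::comm_monoid_add"
  assumes "\<And>a b c. a + b + c = Suc N \<Longrightarrow>
    f a b c = (if a = 0 then 0 else g1 (a - 1) b c) + (if b = 0 then 0 else g2 a (b - 1) c)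
      + (if c = 0 then 0 else g3 a b (c - 1))"
  shows "(\<Sum>(a, b, c)\<in>triples (Suc N). f a b c) = (\<Sum>(a, b, c)\<in>triples N. g1 a b c)
    + (\<Sum>(a, b, c)\<in>triples N. g2 a b c) + (\<Sum>(a, b, c)\<in>triples N. g3 a b c)"
proof -
  have 1: "(\<Sum>(a, b, c)\<in>triples (Suc N). if a = 0 then 0 else g (a - 1) b c)
      = (\<Sum>(a, b, c)\<in>triples N. g a b c)" for g :: "nat \<Rightarrow> nat \<Rightarrow> nat \<Rightarrow> 'a"
  proof -
    have "(\<Sum>(a, b, c)\<in>triples N. g a b c)
        = (\<Sum>(a, b, c)\<in>(\<lambda>(a, b, c). (Suc a, b, c)) ` triples N. if a = 0 then 0 else g (a - 1) b c)"
      by (subst sum.reindex) (auto simp: inj_on_def o_def split_def)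
    also have "\<dots> = (\<Sum>(a, b, c)\<in>triples (Suc N). if a = 0 then 0 else g (a - 1) b c)"
    proof (intro sum.mono_neutral_left ballI)
      show "(\<lambda>(a, b, c). (Suc a, b, c)) ` triples N \<subseteq> triples (Suc N)"
        by (auto simp: triples_def)
      fix t assume t: "t \<in> triples (Suc N) - (\<lambda>(a, b, c). (Suc a, b, c)) ` triples N"
      obtain a b c where abc: "t = (a, b, c)" by (cases t)
      have "a = 0"
      proof (rule ccontr)
        assume "a \<noteq> 0"
        then have "t = (\<lambda>(a, b, c). (Suc a, b, c)) (a - 1, b, c)" "(a - 1, b, c) \<in> triples N"
          using t abc by (auto simp: triples_def)
        then show False using t by blast
      qed
      then show "(case t of (a, b, c) \<Rightarrow> if a = 0 then 0 else g (a - 1) b c) = 0"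
        by (simp add: abc)
    qed simp
    finally show ?thesis by simp
  qed
  \<comment> \<open>Exchanging the first index with the second or the third reduces the two other
    shifts to \<open>1\<close>.\<close>
  have inv: "(\<Sum>(a, b, c)\<in>triples n. h a b c) = (\<Sum>(b, a, c)\<in>triples n. h a b c)"
    "(\<Sum>(a, b, c)\<in>triples n. h a b c) = (\<Sum>(c, b, a)\<in>triples n. h a b c)"
    for n and h :: "nat \<Rightarrow> nat \<Rightarrow> nat \<Rightarrow> 'a"
    by (rule sum.reindex_bij_witness[of _ "\<lambda>(a, b, c). (b, a, c)" "\<lambda>(a, b, c). (b, a, c)"]
          sum.reindex_bij_witness[of _ "\<lambda>(a, b, c). (c, b, a)" "\<lambda>(a, b, c). (c, b, a)"];
        auto simp: triples_def)+
  have "(\<Sum>(a, b, c)\<in>triples (Suc N). f a b c)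
      = (\<Sum>(a, b, c)\<in>triples (Suc N). if a = 0 then 0 else g1 (a - 1) b c)
        + (\<Sum>(a, b, c)\<in>triples (Suc N). if b = 0 then 0 else g2 a (b - 1) c)
        + (\<Sum>(a, b, c)\<in>triples (Suc N). if c = 0 then 0 else g3 a b (c - 1))"
    unfolding sum.distrib[symmetric] by (intro sum.cong) (auto simp: triples_def assms)
  also have "(\<Sum>(a, b, c)\<in>triples (Suc N). if b = 0 then 0 else g2 a (b - 1) c)
      = (\<Sum>(a, b, c)\<in>triples N. g2 a b c)"
    by (subst inv(1), subst (2) inv(1)) (rule 1[of "\<lambda>a b c. g2 b a c"])
  also have "(\<Sum>(a, b, c)\<in>triples (Suc N). if c = 0 then 0 else g3 a b (c - 1))
      = (\<Sum>(a, b, c)\<in>triples N. g3 a b c)"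
    by (subst inv(2), subst (2) inv(2)) (rule 1[of "\<lambda>a b c. g3 c b a"])
  finally show ?thesis by (simp add: 1)
qed

definition triangle :: "nat \<Rightarrow> nat" where "triangle r = r * (r - 1) div 2"

lemma triangle_0 [simp]: "triangle 0 = 0"
  by (simp add: triangle_def)

lemma triangle_Suc [simp]: "triangle (Suc r) = triangle r + r"
proof -
  have "Suc r * r = r * (r - 1) + 2 * r" by (cases r) auto
  then show ?thesis by (simp add: triangle_def)
qed

text \<open>The common shape of both characters and of both limits of the Macdonald polynomials.
  With \<open>M = N - k - r\<close> the exponent \<open>k - M\<close> is the weight
  \<open>2k + r - N\<close>.\<close>

definition trisum :: "(nat \<Rightarrow> nat \<Rightarrow> nat \<Rightarrow> complex) \<Rightarrow> complex \<Rightarrow> complex \<Rightarrow> nat \<Rightarrow> complex" where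
  "trisum g p x N = (\<Sum>(M, r, k)\<in>triples N. g M r k * qtri p M r k * x powi (int k - int M))"

lemma trisum_0: "trisum g p x 0 = g 0 0 0"
  by (simp add: trisum_def triples_0 qtri_def)

text \<open>\<open>e1\<close>, \<open>e2\<close>, \<open>e3\<close> are left free because the order
  of the indices in the recurrence has to be chosen for each \<open>g\<close>, so that the shifted
  weights \<open>g1\<close>, \<open>g2\<close>, \<open>g3\<close> are again of a known form.\<close>

lemma trisum_Suc:
  assumes x: "x \<noteq> 0"
    and rec: "\<And>M r k. M + r + k = Suc N \<Longrightarrow> qtri p M r k =
      (if M = 0 then 0 else p ^ e1 M r k * qtri p (M - 1) r k)
      + (if r = 0 then 0 else p ^ e2 M r k * qtri p M (r - 1) k)
      + (if k = 0 then 0 else p ^ e3 M r k * qtri p M r (k - 1))"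
    and g: "\<And>M r k. M + r + k = N \<Longrightarrow> g (Suc M) r k * p ^ e1 (Suc M) r k = g1 M r k"
      "\<And>M r k. M + r + k = N \<Longrightarrow> g M (Suc r) k * p ^ e2 M (Suc r) k = g2 M r k"
      "\<And>M r k. M + r + k = N \<Longrightarrow> g M r (Suc k) * p ^ e3 M r (Suc k) = g3 M r k"
  shows "trisum g p x (Suc N) = inverse x * trisum g1 p x N + trisum g2 p x N + x * trisum g3 p x N"
proof -
  have aux: "w * (if c then 0 else a) * y = (if c then 0 else b)" if "\<not> c \<Longrightarrow> b = w * a * y"
    for c and w a y b :: complex
    using that by simp
  have "trisum g p x (Suc N)
     = (\<Sum>(M, r, k)\<in>triples N. inverse x * (g1 M r k * qtri p M r k * x powi (int k - int M)))
       + (\<Sum>(M, r, k)\<in>triples N. g2 M r k * qtri p M r k * x powi (int k - int M))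
       + (\<Sum>(M, r, k)\<in>triples N. x * (g3 M r k * qtri p M r k * x powi (int k - int M)))"
    unfolding trisum_def
  proof (rule sum_triples_Suc)
    fix M r k assume s: "M + r + k = Suc N"
    have 1: "M \<noteq> 0 \<Longrightarrow> inverse x * (g1 (M - 1) r k * qtri p (M - 1) r k * x powi (int k - int (M - 1)))
        = g M r k * (p ^ e1 M r k * qtri p (M - 1) r k) * x powi (int k - int M)"
    proof -
      assume "M \<noteq> 0"
      then obtain M' where M: "M = Suc M'" by (cases M) auto
      have "int k - int M' = (int k - int M) + 1" using M by simp
      then have "x powi (int k - int M') = x powi (int k - int M) * x"
        using x power_int_add_1[of x "int k - int M"] by metis
      then show ?thesis using x g(1)[of M' r k] s by (simp add: M field_simps)
    qed
    have 2: "r \<noteq> 0 \<Longrightarrow> g2 M (r - 1) k * qtri p M (r - 1) k * x powi (int k - int M)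
        = g M r k * (p ^ e2 M r k * qtri p M (r - 1) k) * x powi (int k - int M)"
      using g(2)[of M "r - 1" k] s by (cases r) auto
    have 3: "k \<noteq> 0 \<Longrightarrow> x * (g3 M r (k - 1) * qtri p M r (k - 1) * x powi (int (k - 1) - int M))
        = g M r k * (p ^ e3 M r k * qtri p M r (k - 1)) * x powi (int k - int M)"
    proof -
      assume "k \<noteq> 0"
      then obtain k' where k: "k = Suc k'" by (cases k) auto
      have "int k - int M = (int k' - int M) + 1" using k by simp
      then have "x powi (int k - int M) = x powi (int k' - int M) * x"
        using x power_int_add_1[of x "int k' - int M"] by metis
      then show ?thesis using x g(3)[of M r k'] s by (simp add: k field_simps)
    qed
    show "g M r k * qtri p M r k * x powi (int k - int M) =
        (if M = 0 then 0 else inverse x * (g1 (M - 1) r k * qtri p (M - 1) r k * x powi (int k - int (M - 1))))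
      + (if r = 0 then 0 else g2 M (r - 1) k * qtri p M (r - 1) k * x powi (int k - int M))
      + (if k = 0 then 0 else x * (g3 M r (k - 1) * qtri p M r (k - 1) * x powi (int (k - 1) - int M)))"
      unfolding rec[OF s] distrib_left distrib_right
      by (intro arg_cong2[where f = "(+)"] aux 1 2 3)
  qed
  then show ?thesis
    by (simp add: trisum_def sum_distrib_left split_def)
qed

lemma qtri_rec_Mrk:
  fixes p :: "'a::idom"
  assumes "M + r + k = Suc N"
  shows "qtri p M r k =
      (if M = 0 then 0 else p ^ 0 * qtri p (M - 1) r k)
      + (if r = 0 then 0 else p ^ M * qtri p M (r - 1) k)
      + (if k = 0 then 0 else p ^ (M + r) * qtri p M r (k - 1))"
  using qtri_rec[of M r k p] assms by simp

lemma qtri_rec_kMr: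
  fixes p :: "'a::idom"
  assumes "M + r + k = Suc N"
  shows "qtri p M r k =
      (if M = 0 then 0 else p ^ k * qtri p (M - 1) r k)
      + (if r = 0 then 0 else p ^ (k + M) * qtri p M (r - 1) k)
      + (if k = 0 then 0 else p ^ 0 * qtri p M r (k - 1))"
proof -
  have perm: "qtri p k M r = qtri p M r k"
    "qtri p k (M - 1) r = qtri p (M - 1) r k"
    "qtri p k M (r - 1) = qtri p M (r - 1) k"
    "qtri p (k - 1) M r = qtri p M r (k - 1)"
    by (metis qtri_swap13 qtri_swap23)+
  have "k + M + r > 0" using assms by linarith
  from qtri_rec[OF this, of p] show ?thesis
    by (simp only: perm add_ac power_0 mult_1_left)
qed

lemma qtri_rec_Mkr:
  fixes p :: "'a::idom"
  assumes "M + r + k = Suc N"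
  shows "qtri p M r k =
      (if M = 0 then 0 else p ^ 0 * qtri p (M - 1) r k)
      + (if r = 0 then 0 else p ^ (M + k) * qtri p M (r - 1) k)
      + (if k = 0 then 0 else p ^ M * qtri p M r (k - 1))"
proof -
  have perm: "qtri p M k r = qtri p M r k"
    "qtri p (M - 1) k r = qtri p (M - 1) r k"
    "qtri p M k (r - 1) = qtri p M (r - 1) k"
    "qtri p M (k - 1) r = qtri p M r (k - 1)"
    by (metis qtri_swap13 qtri_swap23)+
  have "M + k + r > 0" using assms by linarith
  from qtri_rec[OF this, of p] show ?thesis
    by (simp only: perm add_ac power_0 mult_1_left)
qed

lemma qtri_rec_krM:
  fixes p :: "'a::idom"
  assumes "M + r + k = Suc N"
  shows "qtri p M r k =
      (if M = 0 then 0 else p ^ (k + r) * qtri p (M - 1) r k)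
      + (if r = 0 then 0 else p ^ k * qtri p M (r - 1) k)
      + (if k = 0 then 0 else p ^ 0 * qtri p M r (k - 1))"
proof -
  have perm: "qtri p k r M = qtri p M r k"
    "qtri p k r (M - 1) = qtri p (M - 1) r k"
    "qtri p k (r - 1) M = qtri p M (r - 1) k"
    "qtri p (k - 1) r M = qtri p M r (k - 1)"
    by (metis qtri_swap13 qtri_swap23)+
  have "k + r + M > 0" using assms by linarith
  from qtri_rec[OF this, of p] show ?thesis
    by (simp only: perm add_ac power_0 mult_1_left)
qed

lemma trisum_cmult: "trisum (\<lambda>M r k. c * g M r k) p x N = c * trisum g p x N"
  by (simp add: trisum_def sum_distrib_left split_def mult.assoc)

lemma trisum_cong:
  "(\<And>M r k. M + r + k = N \<Longrightarrow> g M r k = h M r k) \<Longrightarrow> trisum g p x N = trisum h p x N"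
  unfolding trisum_def by (intro sum.cong) (auto simp: triples_def)

text \<open>\<open>A\<close> is not closed under the recurrence; \<open>B\<close> is the companion
  that closes the system, and it becomes the second coordinate of the limit of the transfer vector.
  For \<open>B\<close> the order of the indices is such that the stray powers collect to
  \<open>p ^ Suc N\<close>, a constant.\<close>

lemma trisum_zero_rec:
  fixes p x :: complex
  assumes "x \<noteq> 0"
  defines "A \<equiv> trisum (\<lambda>M r k. p ^ triangle r) p x"
    and "B \<equiv> trisum (\<lambda>M r k. p ^ (triangle r + (M + r))) p x"
  shows "A 0 = 1" "B 0 = 1"
    and "A (Suc N) = inverse x * A N + (1 + x) * B N"
    and "B (Suc N) = p ^ Suc N * inverse x * A N + (x + p ^ Suc N) * B N"
proof -
  show "A 0 = 1" "B 0 = 1" by (simp_all add: A_def B_def trisum_0)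
  have "A (Suc N) = inverse x * A N + B N + x * B N"
    unfolding A_def B_def
    by (rule trisum_Suc[OF assms(1)], rule qtri_rec_Mrk, assumption) (auto simp flip: power_add power_Suc intro!: arg_cong[where f = "(^) p"])
  then show "A (Suc N) = inverse x * A N + (1 + x) * B N" by (simp add: algebra_simps)
  have "B (Suc N) = inverse x * trisum (\<lambda>M r k. p ^ Suc N * p ^ triangle r) p x N
      + trisum (\<lambda>M r k. p ^ Suc N * p ^ (triangle r + (M + r))) p x N
      + x * B N"
    unfolding B_def
    by (rule trisum_Suc[OF assms(1)], rule qtri_rec_kMr, assumption) (auto simp flip: power_add power_Suc intro!: arg_cong[where f = "(^) p"])
  then show "B (Suc N) = p ^ Suc N * inverse x * A N + (x + p ^ Suc N) * B N"
    unfolding A_def B_def trisum_cmult by (simp add: algebra_simps)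
qed

text \<open>The system for t = infinity. Here \<open>A\<close> carries the additional PBW factor
  \<open>u ^ (k + r)\<close> at \<open>u = p\<close>.\<close>

lemma trisum_infinity_rec:
  fixes p x :: complex
  assumes "x \<noteq> 0"
  defines "A \<equiv> trisum (\<lambda>M r k. p ^ (triangle r + r + k)) p x"
    and "B \<equiv> trisum (\<lambda>M r k. p ^ triangle r) p x"
  shows "A 0 = 1" "B 0 = 1"
    and "A (Suc N) = (p ^ Suc N + inverse x) * A N + p ^ Suc N * x * B N"
    and "B (Suc N) = (1 + inverse x) * A N + x * B N"
proof -
  show "A 0 = 1" "B 0 = 1" by (simp_all add: A_def B_def trisum_0)
  have "A (Suc N) = inverse x * A N
      + trisum (\<lambda>M r k. p ^ Suc N * p ^ (triangle r + r + k)) p x N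
      + x * trisum (\<lambda>M r k. p ^ Suc N * p ^ triangle r) p x N"
    unfolding A_def
    by (rule trisum_Suc[OF assms(1)], rule qtri_rec_Mkr, assumption) (auto simp flip: power_add power_Suc intro!: arg_cong[where f = "(^) p"])
  then show "A (Suc N) = (p ^ Suc N + inverse x) * A N + p ^ Suc N * x * B N"
    unfolding A_def B_def trisum_cmult by (simp add: algebra_simps)
  have "B (Suc N) = inverse x * A N + A N + x * B N"
    unfolding A_def B_def
    by (rule trisum_Suc[OF assms(1)], rule qtri_rec_krM, assumption) (auto simp flip: power_add power_Suc intro!: arg_cong[where f = "(^) p"])
  then show "B (Suc N) = (1 + inverse x) * A N + x * B N" by (simp add: algebra_simps)
qed

section \<open>A spanning set modulo complete symmetric functions\<close>

type_synonym 'a alg = "'a \<Rightarrow>\<^sub>0 complex"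

lemma pm_span_induct [consumes 1, case_names zero scale_add]:
  assumes "x \<in> pm.span S" "P 0" "\<And>c b y. b \<in> S \<Longrightarrow> P y \<Longrightarrow> P (cscale c b + y)"
  shows "P x"
  using assms by (rule pm.span_induct_alt)

lemma pm_span_mult:
  fixes S :: "'a::comm_monoid_add alg set"
  assumes "p \<in> pm.span S" "pm.subspace U" "\<And>s. s \<in> S \<Longrightarrow> q * s \<in> U"
  shows "q * p \<in> U"
  using assms(1)
  by (induction rule: pm_span_induct)
    (auto simp: distrib_left pm.subspace_0[OF assms(2)]
      intro!: pm.subspace_add[OF assms(2)] pm.subspace_scale[OF assms(2)] assms(3))

text \<open>Exponent vectors list the generators from \<open>c k\<close> down to \<open>c 1\<close>,
  so that consing adds a new top generator. Read as multiplicities of parts, \<open>a\<close> is a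
  partition of \<open>wsum a\<close> into \<open>sum_list a\<close> parts of size at most
  \<open>length a\<close>.\<close>

primrec wsum :: "nat list \<Rightarrow> nat" where
  "wsum [] = 0"
| "wsum (x # xs) = Suc (length xs) * x + wsum xs"

primrec cmon :: "(nat \<Rightarrow> 'r::comm_monoid_mult) \<Rightarrow> nat list \<Rightarrow> 'r" where
  "cmon c [] = 1"
| "cmon c (x # xs) = c (Suc (length xs)) ^ x * cmon c xs"

lemma cmon_increment:
  assumes "1 \<le> j" "j \<le> length a"
  obtains a' where "length a' = length a" "wsum a' = wsum a + j" "sum_list a' = Suc (sum_list a)"
    "\<And>c. cmon c a' = c j * (cmon c a :: 'r::comm_monoid_mult)"
proof -
  have "\<exists>a'. length a' = length a \<and> wsum a' = wsum a + j \<and> sum_list a' = Suc (sum_list a)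
    \<and> (\<forall>c. cmon c a' = c j * (cmon c a :: 'r))"
    using assms
  proof (induction a)
    case (Cons x xs)
    show ?case
    proof (cases "j = Suc (length xs)")
      case True
      then show ?thesis by (intro exI[of _ "Suc x # xs"]) (auto simp: mult_ac)
    next
      case False
      then obtain a' where "length a' = length xs" "wsum a' = wsum xs + j"
        "sum_list a' = Suc (sum_list xs)" "\<forall>c. cmon c a' = c j * (cmon c xs :: 'r)"
        using Cons by auto
      then show ?thesis by (intro exI[of _ "x # a'"]) (auto simp: mult_ac)
    qed
  qed simp
  then show ?thesis using that by blast
qed

text \<open>The sequence inverse to $1, c_1, \<dots>, c_k, 0, 0, \<dots>$ under convolution; for the signed elementary
  symmetric functions these are the complete symmetric functions.\<close>

fun hseq :: "(nat \<Rightarrow> 'r::comm_ring_1) \<Rightarrow> nat \<Rightarrow> nat \<Rightarrow> 'r" where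
  "hseq c k m = (if m = 0 then 1 else - (\<Sum>j\<in>{1..min k m}. c j * hseq c k (m - j)))"

declare hseq.simps [simp del]

lemma hseq_0 [simp]: "hseq c k 0 = 1"
  by (simp add: hseq.simps)

lemma hseq_pos: "m > 0 \<Longrightarrow> hseq c k m = - (\<Sum>j\<in>{1..min k m}. c j * hseq c k (m - j))"
  by (subst hseq.simps) simp

context
  fixes c :: "nat \<Rightarrow> 'a::comm_monoid_add alg"
begin

text \<open>The degree is that of formal exponent vectors, since the \<open>c j\<close> are
  arbitrary elements of the algebra and carry no grading of their own.\<close>

definition cpol :: "nat \<Rightarrow> nat \<Rightarrow> 'a alg set" where
  "cpol k d = pm.span {cmon c a |a. length a = k \<and> wsum a = d}"

lemma cmon_cpol: "length a = k \<Longrightarrow> wsum a = d \<Longrightarrow> cmon c a \<in> cpol k d"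
  unfolding cpol_def by (rule pm.span_base) blast

lemma subspace_cpol: "pm.subspace (cpol k d)"
  by (simp add: cpol_def)

lemma cpol_mult_gen:
  assumes "p \<in> cpol k d" "1 \<le> j" "j \<le> k"
  shows "c j * p \<in> cpol k (d + j)"
  using assms(1) unfolding cpol_def[of k d]
proof (rule pm_span_mult[OF _ subspace_cpol], clarify)
  fix a assume "k = length a" "d = wsum a"
  then obtain a' where "length a' = k" "wsum a' = d + j" "cmon c a' = c j * cmon c a"
    using cmon_increment[of j a] assms(2,3) by metis
  then show "c j * cmon c a \<in> cpol (length a) (wsum a + j)"
    using cmon_cpol \<open>k = _\<close> \<open>d = _\<close> by metis
qed

lemma cpol_mult_cmon:
  assumes "p \<in> cpol k d" "length b \<le> k"
  shows "cmon c b * p \<in> cpol k (wsum b + d)"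
  using assms(2)
proof (induction b)
  case Nil then show ?case using assms by simp
next
  case (Cons x xs)
  have "c (Suc (length xs)) ^ i * (cmon c xs * p) \<in> cpol k (Suc (length xs) * i + (wsum xs + d))" for i
  proof (induction i)
    case 0 then show ?case using Cons by simp
  next
    case (Suc i)
    from cpol_mult_gen[OF this, of "Suc (length xs)"] Cons.prems show ?case
      by (simp add: algebra_simps)
  qed
  from this[of x] show ?case by (simp add: mult.assoc add.assoc)
qed

lemma cpol_mult:
  assumes "p \<in> cpol k d" "q \<in> cpol k e"
  shows "p * q \<in> cpol k (d + e)"
proof -
  have "q * p \<in> cpol k (d + e)"
    using assms(1) unfolding cpol_def[of k d]
  proof (rule pm_span_mult[OF _ subspace_cpol], clarify)
    fix a assume "k = length a" "d = wsum a"
    then show "q * cmon c a \<in> cpol (length a) (wsum a + e)"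
      using cpol_mult_cmon[OF assms(2), of a] by (simp add: mult.commute)
  qed
  then show ?thesis by (simp add: mult.commute)
qed

lemma hseq_cpol: "hseq c k m \<in> cpol k m"
proof (induction m rule: less_induct)
  case (less m)
  show ?case
  proof (cases "m = 0")
    case True
    have "cmon c (replicate k 0) = 1" "wsum (replicate k 0) = 0" by (induction k) auto
    then show ?thesis using cmon_cpol[of "replicate k 0" k 0] True by simp
  next
    case False
    have "c j * hseq c k (m - j) \<in> cpol k m" if "j \<in> {1..min k m}" for j
      using cpol_mult_gen[OF less[of "m - j"], of j] that by auto
    moreover have "0 < m" using False by simp
    ultimately show ?thesis
      unfolding hseq_pos[OF \<open>0 < m\<close>]
      by (intro pm.subspace_neg[OF subspace_cpol] pm.subspace_sum[OF subspace_cpol])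
  qed
qed

text \<open>With \<open>C_k = 1 + c_1 T + ... + c_k T^k\<close> one has
  \<open>1/C_k - 1/C_(k+1) = c_(k+1) T^(k+1) / (C_k C_(k+1))\<close>: one more generator changes the
  complete symmetric functions by multiples of that generator only.\<close>

lemma hseq_Suc_diff:
  "\<exists>q\<in>cpol (Suc k) (m - Suc k). hseq c k m = hseq c (Suc k) m + c (Suc k) * q \<and> (m < Suc k \<longrightarrow> q = 0)"
proof (induction m rule: less_induct)
  case (less m)
  show ?case
  proof (cases "m = 0")
    case True
    then show ?thesis using pm.subspace_0[OF subspace_cpol] by (intro bexI[of _ 0]) auto
  next
    case False
    then have m: "0 < m" by simp
    have "\<forall>i\<in>{..<m}. \<exists>q. q \<in> cpol (Suc k) (i - Suc k) \<and>
        hseq c k i = hseq c (Suc k) i + c (Suc k) * q \<and> (i < Suc k \<longrightarrow> q = 0)"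
      using less by blast
    then obtain q where q: "\<And>i. i < m \<Longrightarrow> q i \<in> cpol (Suc k) (i - Suc k)"
        "\<And>i. i < m \<Longrightarrow> hseq c k i = hseq c (Suc k) i + c (Suc k) * q i"
        "\<And>i. i < m \<Longrightarrow> i < Suc k \<Longrightarrow> q i = 0"
      by (subst (asm) bchoice_iff) auto
    define Q where "Q = (if Suc k \<le> m then hseq c (Suc k) (m - Suc k) else 0)
      - (\<Sum>j\<in>{1..min k m}. c j * q (m - j))"
    have split: "(\<Sum>j\<in>{1..min (Suc k) m}. c j * hseq c (Suc k) (m - j))
      = (\<Sum>j\<in>{1..min k m}. c j * hseq c (Suc k) (m - j))
        + (if Suc k \<le> m then c (Suc k) * hseq c (Suc k) (m - Suc k) else 0)"
      by (cases "Suc k \<le> m") (auto simp: min_absorb1 min_absorb2)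
    have "hseq c k m = - (\<Sum>j\<in>{1..min k m}. c j * (hseq c (Suc k) (m - j) + c (Suc k) * q (m - j)))"
      unfolding hseq_pos[OF m, of c k]
      by (intro arg_cong[where f = uminus] sum.cong refl) (auto intro!: arg_cong[where f = "\<lambda>x. _ * x"] q(2))
    also have "\<dots> = hseq c (Suc k) m + c (Suc k) * Q"
      unfolding hseq_pos[OF m, of c "Suc k"] split Q_def
      by (auto simp: distrib_left sum.distrib sum_distrib_left right_diff_distrib mult_ac)
    finally have 1: "hseq c k m = hseq c (Suc k) m + c (Suc k) * Q" .
    have "c j * q (m - j) \<in> cpol (Suc k) (m - Suc k)" if j: "j \<in> {1..min k m}" for j
    proof (cases "m - j < Suc k")
      case True
      then have "q (m - j) = 0" using q(3)[of "m - j"] j by auto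
      then show ?thesis by (simp add: pm.subspace_0[OF subspace_cpol])
    next
      case F: False
      then have "c j * q (m - j) \<in> cpol (Suc k) (m - j - Suc k + j)"
        using j by (intro cpol_mult_gen q) auto
      moreover have "m - j - Suc k + j = m - Suc k" using F j by auto
      ultimately show ?thesis by simp
    qed
    then have 2: "Q \<in> cpol (Suc k) (m - Suc k)"
      unfolding Q_def using hseq_cpol
      by (intro pm.subspace_diff[OF subspace_cpol] pm.subspace_sum[OF subspace_cpol])
        (auto simp: pm.subspace_0[OF subspace_cpol])
    have 3: "Q = 0" if "m < Suc k"
    proof -
      have "(\<Sum>j\<in>{1..min k m}. c j * q (m - j)) = 0"
        using that by (intro sum.neutral) (auto simp: q(3))
      then show ?thesis using that by (simp add: Q_def)
    qed
    show ?thesis using 1 2 3 by blast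
  qed
qed

text \<open>Box monomials together with the multiples of the complete symmetric functions of degree at
  least \<open>L\<close>.\<close>

definition boxrel :: "nat \<Rightarrow> nat \<Rightarrow> nat \<Rightarrow> 'a alg set" where
  "boxrel k L d = pm.span ({cmon c a |a. length a = k \<and> sum_list a < L \<and> wsum a = d}
     \<union> {cmon c a * hseq c k m |a m. length a = k \<and> L \<le> m \<and> wsum a + m = d})"

lemma subspace_boxrel: "pm.subspace (boxrel k L d)"
  by (simp add: boxrel_def)

lemma boxrel_box: "length a = k \<Longrightarrow> sum_list a < L \<Longrightarrow> wsum a = d \<Longrightarrow> cmon c a \<in> boxrel k L d"
  unfolding boxrel_def by (rule pm.span_base) blast

lemma boxrel_rel:
  "length a = k \<Longrightarrow> L \<le> m \<Longrightarrow> wsum a + m = d \<Longrightarrow> cmon c a * hseq c k m \<in> boxrel k L d"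
  unfolding boxrel_def by (rule pm.span_base) blast

text \<open>The new factor raises exponent sums by one, hence \<open>Suc L\<close>. Among the
  relations only \<open>m = L\<close> then falls below the bound, and it is rewritten through
  relations of higher degree.\<close>

lemma boxrel_mult_last:
  assumes "p \<in> boxrel (Suc k) L d"
  shows "c (Suc k) * p \<in> boxrel (Suc k) (Suc L) (d + Suc k)"
  using assms unfolding boxrel_def[of _ L]
proof (rule pm_span_mult[OF _ subspace_boxrel], elim UnE)
  fix s assume "s \<in> {cmon c a |a. length a = Suc k \<and> sum_list a < L \<and> wsum a = d}"
  then obtain a where a: "s = cmon c a" "length a = Suc k" "sum_list a < L" "wsum a = d" by blast
  obtain a' where "length a' = Suc k" "wsum a' = d + Suc k" "sum_list a' < Suc L"
    "cmon c a' = c (Suc k) * cmon c a"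
    using cmon_increment[of "Suc k" a] a by (metis Suc_le_mono Suc_leI le_add1 le_refl less_Suc_eq_le plus_1_eq_Suc)
  then show "c (Suc k) * s \<in> boxrel (Suc k) (Suc L) (d + Suc k)"
    using boxrel_box a(1) by metis
next
  fix s assume "s \<in> {cmon c a * hseq c (Suc k) m |a m. length a = Suc k \<and> L \<le> m \<and> wsum a + m = d}"
  then obtain a m where a: "s = cmon c a * hseq c (Suc k) m" "length a = Suc k" "L \<le> m" "wsum a + m = d"
    by blast
  have rel: "cmon c a * (c j * hseq c (Suc k) i) \<in> boxrel (Suc k) (Suc L) (d + Suc k)"
    if j: "1 \<le> j" "j \<le> Suc k" "Suc L \<le> i" "wsum a + j + i = d + Suc k" for i j
  proof -
    obtain a' where a': "length a' = Suc k" "wsum a' = wsum a + j" "cmon c a' = c j * cmon c a"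
      by (rule cmon_increment[of j a]) (use a j in auto)
    then have "cmon c a' * hseq c (Suc k) i \<in> boxrel (Suc k) (Suc L) (d + Suc k)"
      using j by (intro boxrel_rel) auto
    then show ?thesis unfolding a'(3) by (simp add: mult_ac)
  qed
  show "c (Suc k) * s \<in> boxrel (Suc k) (Suc L) (d + Suc k)"
  proof (cases "m = L")
    case False
    then show ?thesis using rel[of "Suc k" m] a by (simp add: mult_ac)
  next
    case True
    \<comment> \<open>The recursion in degree \<open>L + Suc k\<close> isolates
      \<open>c (Suc k) * hseq c (Suc k) L\<close>; the indices of all other terms exceed
      \<open>L\<close>.\<close>
    have "hseq c (Suc k) (L + Suc k)
        = - (\<Sum>j\<in>{1..k}. c j * hseq c (Suc k) (L + Suc k - j)) - c (Suc k) * hseq c (Suc k) L"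
      by (subst hseq_pos) auto
    then have "c (Suc k) * hseq c (Suc k) L
        = - hseq c (Suc k) (L + Suc k) - (\<Sum>j\<in>{1..k}. c j * hseq c (Suc k) (L + Suc k - j))"
      by (simp only: diff_minus_eq_add minus_diff_eq minus_minus minus_add_distrib) simp
    moreover have "c (Suc k) * s = cmon c a * (c (Suc k) * hseq c (Suc k) L)"
      by (simp only: a(1) True mult_ac)
    ultimately have "c (Suc k) * s = - (cmon c a * hseq c (Suc k) (L + Suc k))
        - (\<Sum>j\<in>{1..k}. cmon c a * (c j * hseq c (Suc k) (L + Suc k - j)))"
      by (simp only: right_diff_distrib sum_distrib_left mult_minus_right)
    also have "\<dots> \<in> boxrel (Suc k) (Suc L) (d + Suc k)"
      using a True
      by (intro pm.subspace_diff[OF subspace_boxrel] pm.subspace_neg[OF subspace_boxrel]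
          pm.subspace_sum[OF subspace_boxrel] boxrel_rel rel) auto
    finally show ?thesis .
  qed
qed

text \<open>Double induction on the number of generators and on \<open>L\<close>: a monomial
  divisible by the top generator gives up that factor and one unit of \<open>L\<close>, any other
  involves fewer generators. For \<open>L > 0\<close> this is the spanning half of the monomial
  basis of the cohomology of the Grassmannian of \<open>k\<close>-planes in dimension
  \<open>L + k - 1\<close>.\<close>

proposition cpol_subset_boxrel: "cpol k d \<subseteq> boxrel k L d"
proof (induction k arbitrary: d L)
  case 0
  have "cmon c [] \<in> boxrel 0 L 0"
    using boxrel_box[of "[]" 0 L 0] boxrel_rel[of "[]" 0 L 0 0] by (cases L) auto
  then show ?case
    unfolding cpol_def by (intro pm.span_minimal subspace_boxrel) auto
next
  case (Suc k)
  note IHk = Suc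
  show ?case
  proof (induction L arbitrary: d)
    case 0
    have "cmon c a \<in> boxrel (Suc k) 0 d" if "length a = Suc k" "wsum a = d" for a
      using boxrel_rel[of a "Suc k" 0 0 d] that by simp
    then show ?case
      unfolding cpol_def by (intro pm.span_minimal subspace_boxrel) auto
  next
    case (Suc L)
    have last: "c (Suc k) * p \<in> boxrel (Suc k) (Suc L) (d + Suc k)" if "p \<in> cpol (Suc k) d" for p d
      using boxrel_mult_last that Suc by blast
    show ?case
      unfolding cpol_def
    proof (intro pm.span_minimal subspace_boxrel, clarify)
      fix a assume a: "length a = Suc k" "d = wsum a"
      then obtain x xs where xs: "a = x # xs" "length xs = k" by (cases a) auto
      show "cmon c a \<in> boxrel (Suc k) (Suc L) (wsum a)"
      proof (cases x)
        case (Suc y)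
        have "c (Suc k) * cmon c (y # xs) \<in> boxrel (Suc k) (Suc L) (wsum (y # xs) + Suc k)"
          using xs by (intro last cmon_cpol) auto
        moreover have "wsum (y # xs) + Suc k = wsum a" using xs Suc by simp
        moreover have "c (Suc k) * cmon c (y # xs) = cmon c a" using xs Suc by (simp add: mult_ac)
        ultimately show ?thesis by simp
      next
        case 0
        have "cmon c xs \<in> boxrel k (Suc L) (wsum a)"
          using IHk[of "wsum a" "Suc L"] cmon_cpol[of xs k "wsum a"] xs 0 by auto
        then have "1 * cmon c xs \<in> boxrel (Suc k) (Suc L) (wsum a)"
          unfolding boxrel_def[of k]
        proof (rule pm_span_mult[OF _ subspace_boxrel], elim UnE)
          fix s assume "s \<in> {cmon c a' |a'. length a' = k \<and> sum_list a' < Suc L \<and> wsum a' = wsum a}"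
          then obtain a' where "s = cmon c a'" "length a' = k" "sum_list a' < Suc L" "wsum a' = wsum a"
            by blast
          then show "1 * s \<in> boxrel (Suc k) (Suc L) (wsum a)"
            using boxrel_box[of "0 # a'" "Suc k" "Suc L" "wsum a"] by simp
        next
          fix s assume "s \<in> {cmon c a' * hseq c k m |a' m. length a' = k \<and> Suc L \<le> m \<and> wsum a' + m = wsum a}"
          then obtain a' m where s: "s = cmon c a' * hseq c k m" "length a' = k" "Suc L \<le> m" "wsum a' + m = wsum a"
            by blast
          \<comment> \<open>A relation for \<open>k\<close> generators is one for
            \<open>Suc k\<close> generators up to a multiple of the new generator, and such
            multiples are covered by \<open>last\<close>.\<close>
          obtain q where q: "q \<in> cpol (Suc k) (m - Suc k)"
              "hseq c k m = hseq c (Suc k) m + c (Suc k) * q" "m < Suc k \<longrightarrow> q = 0"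
            using hseq_Suc_diff by blast
          have "cmon c (0 # a') * hseq c (Suc k) m \<in> boxrel (Suc k) (Suc L) (wsum a)"
            using s by (intro boxrel_rel) auto
          moreover have "c (Suc k) * (cmon c (0 # a') * q) \<in> boxrel (Suc k) (Suc L) (wsum a)"
          proof (cases "m < Suc k")
            case True then show ?thesis using q(3) by (simp add: pm.subspace_0[OF subspace_boxrel])
          next
            case False
            have "c (Suc k) * (cmon c (0 # a') * q)
              \<in> boxrel (Suc k) (Suc L) (wsum (0 # a') + (m - Suc k) + Suc k)"
              using s by (intro last cpol_mult_cmon q) auto
            then show ?thesis using False s by simp
          qed
          ultimately have "cmon c (0 # a') * hseq c (Suc k) m + c (Suc k) * (cmon c (0 # a') * q)
              \<in> boxrel (Suc k) (Suc L) (wsum a)"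
            by (rule pm.subspace_add[OF subspace_boxrel])
          moreover have "s = cmon c (0 # a') * hseq c (Suc k) m + c (Suc k) * (cmon c (0 # a') * q)"
            by (simp add: s(1) q(2) algebra_simps)
          ultimately show "1 * s \<in> boxrel (Suc k) (Suc L) (wsum a)" by simp
        qed
        then show ?thesis using xs 0 by simp
      qed
    qed
  qed
qed

end

section \<open>Elementary and complete symmetric functions of sets of variables\<close>

type_synonym mpol = "(nat \<Rightarrow>\<^sub>0 nat) alg"

definition var :: "nat \<Rightarrow> mpol" where
  "var i = single (single i 1) 1"

text \<open>The elementary symmetric functions carry the sign of the generating function
  $\prod_{i \in A} (1 - x_i T)$.\<close>

definition esf :: "nat set \<Rightarrow> nat \<Rightarrow> mpol" where
  "esf A j = (- 1) ^ j * (\<Sum>S | S \<subseteq> A \<and> card S = j. \<Prod>i\<in>S. var i)"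

definition csf :: "nat set \<Rightarrow> nat \<Rightarrow> mpol" where
  "csf A m = hseq (esf A) (card A) m"

lemma esf_0: "finite A \<Longrightarrow> esf A 0 = 1"
proof -
  assume "finite A"
  then have "{S. S \<subseteq> A \<and> card S = 0} = {{}}" by (auto dest: finite_subset)
  then show ?thesis by (simp add: esf_def)
qed

lemma esf_eq_0: "finite A \<Longrightarrow> card A < j \<Longrightarrow> esf A j = 0"
proof -
  assume "finite A" "card A < j"
  then have *: "{S. S \<subseteq> A \<and> card S = j} = {}" by (auto dest: card_mono)
  show ?thesis unfolding esf_def * by simp
qed

lemma esf_insert:
  assumes "finite A" "a \<notin> A"
  shows "esf (insert a A) (Suc j) = esf A (Suc j) - var a * esf A j"
proof -
  let ?U = "{S. S \<subseteq> A \<and> card S = Suc j}" and ?V = "{S. S \<subseteq> A \<and> card S = j}"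
  have "{S. S \<subseteq> insert a A \<and> card S = Suc j} = ?U \<union> insert a ` ?V" (is "?L = ?R")
  proof (intro equalityI subsetI)
    fix S assume S: "S \<in> ?L"
    show "S \<in> ?R"
    proof (cases "a \<in> S")
      case True
      then have "S = insert a (S - {a})" "S - {a} \<subseteq> A" "card (S - {a}) = j"
        using S by auto
      then show ?thesis by blast
    qed (use S in auto)
  next
    fix S assume "S \<in> ?R"
    then consider "S \<in> ?U" | S' where "S = insert a S'" "S' \<subseteq> A" "card S' = j" by blast
    then show "S \<in> ?L"
    proof cases
      case 2
      moreover have "a \<notin> S'" "finite S'" using 2 assms by (auto dest: finite_subset)
      ultimately show ?thesis by auto
    qed auto
  qed
  then have "(\<Sum>S\<in>?L. \<Prod>i\<in>S. var i) = (\<Sum>S\<in>?U. \<Prod>i\<in>S. var i) + (\<Sum>S\<in>insert a ` ?V. \<Prod>i\<in>S. var i)"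
    using assms by (simp only:) (intro sum.union_disjoint; auto intro: finite_subset[of _ "Pow A"])
  also have "(\<Sum>S\<in>insert a ` ?V. \<Prod>i\<in>S. var i) = (\<Sum>S\<in>?V. var a * (\<Prod>i\<in>S. var i))"
  proof (subst sum.reindex)
    show "inj_on (insert a) ?V"
      unfolding inj_on_def using assms by (metis (no_types, lifting) insert_ident mem_Collect_eq subsetD)
    show "sum ((\<lambda>S. \<Prod>i\<in>S. var i) \<circ> insert a) ?V = (\<Sum>S\<in>?V. var a * (\<Prod>i\<in>S. var i))"
    proof (intro sum.cong refl)
      fix S assume "S \<in> ?V"
      then have "finite S" "a \<notin> S" using assms by (auto dest: finite_subset)
      then show "((\<lambda>S. \<Prod>i\<in>S. var i) \<circ> insert a) S = var a * (\<Prod>i\<in>S. var i)" by simp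
    qed
  qed
  finally show ?thesis
    by (simp only: esf_def sum_distrib_left [symmetric]) (simp add: algebra_simps)
qed

definition efps :: "nat set \<Rightarrow> mpol fps" where "efps A = Abs_fps (esf A)"
definition cfps :: "nat set \<Rightarrow> mpol fps" where "cfps A = Abs_fps (csf A)"

lemma fps_linear_mult_nth:
  "fps_nth ((1 - fps_const c * fps_X) * F) n = fps_nth F n - c * (if n = 0 then 0 else fps_nth F (n - 1))"
  for c :: "'r::comm_ring_1"
proof -
  have "(1 - fps_const c * fps_X) * F = F - fps_const c * (fps_X * F)"
    by (simp only: left_diff_distrib mult_1_left mult.assoc)
  then show ?thesis
    by (simp only: fps_sub_nth fps_mult_left_const_nth fps_X_mult_nth)
qed

lemma efps_insert:
  assumes "finite A" "a \<notin> A"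
  shows "efps (insert a A) = (1 - fps_const (var a) * fps_X) * efps A"
proof (rule fps_ext)
  fix n
  show "fps_nth (efps (insert a A)) n = fps_nth ((1 - fps_const (var a) * fps_X) * efps A) n"
    unfolding fps_linear_mult_nth using assms by (cases n) (simp_all add: efps_def esf_0 esf_insert)
qed

lemma efps_union:
  assumes "finite A" "finite B" "A \<inter> B = {}"
  shows "efps (A \<union> B) = efps A * efps B"
  using assms(1,3)
proof (induction A rule: finite_induct)
  case empty
  have "efps {} = 1"
  proof (rule fps_ext)
    fix n show "fps_nth (efps {}) n = fps_nth 1 n"
      by (cases "n = 0") (auto simp: efps_def esf_0 esf_eq_0)
  qed
  then show ?case by simp
next
  case (insert a A)
  then have h: "efps (A \<union> B) = efps A * efps B" "a \<notin> A \<union> B" "finite (A \<union> B)"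
    using assms(2) by auto
  show ?case
    by (simp only: Un_insert_left efps_insert[OF h(3,2)] efps_insert[OF insert.hyps(1,2)] h(1) mult.assoc)
qed

lemma efps_cfps: 
  assumes "finite A"
  shows "efps A * cfps A = 1"
proof (rule fps_ext)
  fix n
  show "fps_nth (efps A * cfps A) n = fps_nth 1 n"
  proof (cases "n = 0")
    case True then show ?thesis using assms by (simp add: efps_def cfps_def esf_0 csf_def)
  next
    case False
    have "fps_nth (efps A * cfps A) n = (\<Sum>j\<in>{0..n}. esf A j * csf A (n - j))"
      by (simp add: fps_mult_nth efps_def cfps_def)
    also have "\<dots> = (\<Sum>j\<in>{0..min (card A) n}. esf A j * csf A (n - j))"
      using assms by (intro sum.mono_neutral_right) (auto simp: esf_eq_0)
    also have "\<dots> = csf A n + (\<Sum>j\<in>{1..min (card A) n}. esf A j * csf A (n - j))"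
      using assms by (subst sum.atLeast_Suc_atMost) (auto simp: esf_0)
    also have "\<dots> = 0"
      using False by (simp add: csf_def hseq_pos[of n])
    finally show ?thesis using False by simp
  qed
qed

lemma cfps_unique: "finite A \<Longrightarrow> efps A * H = 1 \<Longrightarrow> H = cfps A"
proof -
  assume A: "finite A" and H: "efps A * H = 1"
  have "H = (efps A * cfps A) * H" using A by (simp only: efps_cfps mult_1_left)
  also have "\<dots> = cfps A * (efps A * H)" by (simp only: mult_ac)
  finally show ?thesis by (simp only: H mult_1_right)
qed

lemma cfps_union:
  assumes "finite A" "finite B" "A \<inter> B = {}"
  shows "cfps (A \<union> B) = cfps A * cfps B"
proof -
  have "efps (A \<union> B) * (cfps A * cfps B) = (efps A * cfps A) * (efps B * cfps B)"
    by (simp only: efps_union[OF assms] mult_ac)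
  also have "\<dots> = 1" using assms by (simp only: efps_cfps mult_1_left)
  finally show ?thesis using cfps_unique[of "A \<union> B" "cfps A * cfps B"] assms by simp
qed

lemma csf_union:
  assumes "finite A" "finite B" "A \<inter> B = {}"
  shows "csf (A \<union> B) m = (\<Sum>i\<le>m. csf A i * csf B (m - i))"
proof -
  have "fps_nth (cfps (A \<union> B)) m = fps_nth (cfps A * cfps B) m" by (simp only: cfps_union[OF assms])
  then show ?thesis by (simp add: fps_mult_nth cfps_def atLeast0AtMost)
qed

text \<open>The series identity \<open>cfps A = efps B * cfps (A \<union> B)\<close>: complete
  symmetric functions of one group are combinations of those of all variables, which is where the
  relations live.\<close>

lemma csf_eq_esf_csf_union:
  assumes "finite A" "finite B" "A \<inter> B = {}"
  shows "csf A m = (\<Sum>j\<in>{0..min (card B) m}. esf B j * csf (A \<union> B) (m - j))"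
proof -
  have "efps B * cfps (A \<union> B) = cfps A * (efps B * cfps B)"
    by (simp only: cfps_union[OF assms] mult_ac)
  then have "fps_nth (cfps A) m = fps_nth (efps B * cfps (A \<union> B)) m"
    using assms(2) by (simp only: efps_cfps mult_1_right)
  then have "csf A m = (\<Sum>j\<in>{0..m}. esf B j * csf (A \<union> B) (m - j))"
    by (simp add: fps_mult_nth cfps_def efps_def)
  also have "\<dots> = (\<Sum>j\<in>{0..min (card B) m}. esf B j * csf (A \<union> B) (m - j))"
    using assms by (intro sum.mono_neutral_right) (auto simp: esf_eq_0)
  finally show ?thesis .
qed

lemma csf_insert:
  assumes "finite A" "a \<notin> A"
  shows "csf (insert a A) m = (\<Sum>i\<le>m. var a ^ i * csf A (m - i))"
proof -
  have 1: "csf (insert a A) (Suc m) = csf A (Suc m) + var a * csf (insert a A) m" for m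
  proof -
    have "cfps A = cfps A * (efps (insert a A) * cfps (insert a A))"
      using assms by (simp only: efps_cfps finite_insert mult_1_right)
    also have "\<dots> = (1 - fps_const (var a) * fps_X) * cfps (insert a A) * (efps A * cfps A)"
      by (simp only: efps_insert[OF assms] mult_ac)
    also have "\<dots> = (1 - fps_const (var a) * fps_X) * cfps (insert a A)"
      using assms(1) by (simp only: efps_cfps mult_1_right)
    finally have "cfps A = (1 - fps_const (var a) * fps_X) * cfps (insert a A)" .
    then have "fps_nth (cfps A) (Suc m) = fps_nth ((1 - fps_const (var a) * fps_X) * cfps (insert a A)) (Suc m)"
      by simp
    then show ?thesis unfolding fps_linear_mult_nth by (simp add: cfps_def)
  qed
  show ?thesis
  proof (induction m)
    case 0 then show ?case by (simp add: csf_def)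
  next
    case (Suc m)
    show ?case unfolding 1 Suc
      by (subst sum.atMost_Suc_shift) (simp add: sum_distrib_left mult.assoc)
  qed
qed

text \<open>The variable is a root of the product of all \<open>T - x_i\<close>. The partial sums
  are the elementary symmetric functions of the remaining variables, and the last one has a degree
  exceeding their number.\<close>

lemma esf_root:
  assumes "finite A" "a \<in> A"
  shows "(\<Sum>j\<le>card A. esf A j * var a ^ (card A - j)) = 0"
proof -
  define A' where "A' = A - {a}"
  have A: "A = insert a A'" "finite A'" "a \<notin> A'" "card A = Suc (card A')"
    using assms card.remove[of A a] by (auto simp: A'_def)
  have "(\<Sum>j\<le>r. esf A j * var a ^ (r - j)) = esf A' r" for r
  proof (induction r)
    case 0 then show ?case by (simp add: esf_0 A(2) assms(1))
  next
    case (Suc r)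
    have "(\<Sum>j\<le>Suc r. esf A j * var a ^ (Suc r - j))
        = (\<Sum>j\<le>r. var a * (esf A j * var a ^ (r - j))) + esf A (Suc r)"
      by (simp add: Suc_diff_le mult_ac)
    also have "\<dots> = esf A' (Suc r)"
      unfolding sum_distrib_left[symmetric] Suc by (simp add: A(1) esf_insert[OF A(2,3)])
    finally show ?case .
  qed
  from this[of "card A"] show ?thesis using A by (simp add: esf_eq_0)
qed

text \<open>Relations in all variables bound the two groups in turn. For \<open>A\<close>,
  \<open>csf A m\<close> with \<open>m \<ge> L\<close> is a relation plus terms of smaller degree in
  \<open>A\<close> with coefficients in \<open>B\<close>. For \<open>B\<close>,
  \<open>csf B m\<close> is a combination of \<open>csf (A \<union> B) (m - j)\<close> with
  \<open>j \<le> card A\<close>, and all of these are relations once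
  \<open>m \<ge> L + card A\<close>; this is the source of the second bound.\<close>

proposition box_span_two_sets:
  fixes A B :: "nat set" and K :: "mpol set"
  assumes "finite A" "finite B" "A \<inter> B = {}"
    and K: "pm.subspace K"
    and rel: "\<And>a b m. length a = card A \<Longrightarrow> length b = card B \<Longrightarrow> L \<le> m \<Longrightarrow>
      cmon (esf A) a * cmon (esf B) b * csf (A \<union> B) m \<in> K"
    and a: "length a = card A" and b: "length b = card B"
  shows "cmon (esf A) a * cmon (esf B) b \<in>
    pm.span ({cmon (esf A) a' * cmon (esf B) b' |a' b'.
      length a' = card A \<and> sum_list a' < L \<and> length b' = card B \<and> sum_list b' < L + card A} \<union> K)"
    (is "_ \<in> pm.span (?G \<union> K)")
proof -
  have Ksub: "p \<in> pm.span (?G \<union> K)" if "p \<in> K" for p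
    using that by (intro pm.span_base UnI2)
  \<comment> \<open>\<open>Y\<close> puts no bound on the exponents of \<open>B\<close>: while the
    \<open>A\<close> part is reduced, the \<open>B\<close> part may grow freely.\<close>
  define Y where "Y = pm.span {cmon (esf B) b |b. length b = card B}"
  have Y: "pm.subspace Y" by (simp add: Y_def)
  have cpolY: "cpol (esf B) (card B) d \<subseteq> Y" for d
    unfolding cpol_def Y_def by (intro pm.span_mono) auto
  have Ymult: "p * q \<in> Y" if p: "p \<in> Y" and q: "q \<in> cpol (esf B) (card B) d" for p q d
  proof -
    have "q * p \<in> Y"
      using p unfolding Y_def
    proof (rule pm_span_mult, goal_cases)
      case 1 show ?case by simp
    next
      case (2 s)
      then obtain b where "s = cmon (esf B) b" "length b = card B" by blast
      then have "q * s \<in> cpol (esf B) (card B) (wsum b + d)"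
        using cpol_mult_cmon[OF q, of b] by (simp add: mult.commute)
      then show ?case using cpolY unfolding Y_def by blast
    qed
    then show ?thesis by (simp add: mult.commute)
  qed
  have esfY: "p * esf B j \<in> Y" if "p \<in> Y" "j \<le> card B" for p j
  proof (cases "j = 0")
    case True then show ?thesis using that(1) by (simp add: esf_0[OF assms(2)])
  next
    case False
    have "esf B j * hseq (esf B) (card B) 0 \<in> cpol (esf B) (card B) (0 + j)"
      using False that by (intro cpol_mult_gen hseq_cpol) auto
    then show ?thesis using Ymult[OF that(1)] by simp
  qed
  have relY: "cmon (esf A) a * s * csf (A \<union> B) m \<in> K" if "length a = card A" "s \<in> Y" "L \<le> m" for a s m
  proof -
    have "(cmon (esf A) a * csf (A \<union> B) m) * s \<in> K"
      using that(2) unfolding Y_def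
    proof (rule pm_span_mult[OF _ K])
      fix p assume "p \<in> {cmon (esf B) b |b. length b = card B}"
      then obtain b where b: "p = cmon (esf B) b" "length b = card B" by blast
      show "(cmon (esf A) a * csf (A \<union> B) m) * p \<in> K"
        using rel[OF that(1) b(2) that(3)] by (simp only: b(1) mult_ac)
    qed
    then show ?thesis by (simp only: mult_ac)
  qed
  define V where "V = pm.span ({cmon (esf A) a' * s |a' s. length a' = card A \<and> sum_list a' < L \<and> s \<in> Y} \<union> K)"
  have V: "pm.subspace V" by (simp add: V_def)
  have KV: "p \<in> V" if "p \<in> K" for p unfolding V_def using that by (intro pm.span_base UnI2)
  \<comment> \<open>Induction on the degree in \<open>A\<close>: in every term that is not a
    relation, a factor \<open>esf B j\<close> with \<open>j \<ge> 1\<close> has taken degree away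
    from \<open>A\<close>.\<close>
  have step1: "q * s \<in> V" if "q \<in> cpol (esf A) (card A) d" "s \<in> Y" for q s d
    using that
  proof (induction d arbitrary: q s rule: less_induct)
    case (less d)
    have "q \<in> boxrel (esf A) (card A) L d" using less.prems(1) cpol_subset_boxrel by blast
    then have "s * q \<in> V"
      unfolding boxrel_def
    proof (rule pm_span_mult[OF _ V], elim UnE)
      fix p assume "p \<in> {cmon (esf A) a |a. length a = card A \<and> sum_list a < L \<and> wsum a = d}"
      then obtain a where "s * p = cmon (esf A) a * s" "length a = card A" "sum_list a < L"
        by (auto simp: mult.commute)
      then show "s * p \<in> V"
        unfolding V_def using less.prems(2) by (intro pm.span_base UnI1) blast
    next
      fix p assume "p \<in> {cmon (esf A) a * hseq (esf A) (card A) m |a m. length a = card A \<and> L \<le> m \<and> wsum a + m = d}"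
      then obtain a m where p: "p = cmon (esf A) a * csf A m" "length a = card A" "L \<le> m" "wsum a + m = d"
        by (auto simp: csf_def)
      have E: "csf A m = csf (A \<union> B) m + (\<Sum>j\<in>{1..min (card B) m}. esf B j * csf (A \<union> B) (m - j))"
        unfolding csf_eq_esf_csf_union[OF assms(1-3), of m]
        by (subst sum.atLeast_Suc_atMost) (simp_all add: esf_0[OF assms(2)])
      have "s * p = cmon (esf A) a * s * csf (A \<union> B) m
         + (\<Sum>j\<in>{1..min (card B) m}. cmon (esf A) a * s * (esf B j * csf (A \<union> B) (m - j)))"
        by (simp only: p(1) E distrib_left sum_distrib_left mult_ac)
      also have "(\<Sum>j\<in>{1..min (card B) m}. cmon (esf A) a * s * (esf B j * csf (A \<union> B) (m - j)))
         = (\<Sum>j\<in>{1..min (card B) m}. \<Sum>i\<le>m - j. (cmon (esf A) a * csf A i) * (s * esf B j * csf B (m - j - i)))"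
        by (simp only: csf_union[OF assms(1-3)] sum_distrib_left mult_ac)
      finally have sp: "s * p = cmon (esf A) a * s * csf (A \<union> B) m
         + (\<Sum>j\<in>{1..min (card B) m}. \<Sum>i\<le>m - j. (cmon (esf A) a * csf A i) * (s * esf B j * csf B (m - j - i)))" .
      show "s * p \<in> V"
        unfolding sp
      proof (intro pm.subspace_add[OF V] pm.subspace_sum[OF V])
        show "cmon (esf A) a * s * csf (A \<union> B) m \<in> V"
          using relY p less.prems by (intro KV) auto
        fix j i assume ji: "j \<in> {1..min (card B) m}" "i \<in> {..m - j}"
        show "(cmon (esf A) a * csf A i) * (s * esf B j * csf B (m - j - i)) \<in> V"
        proof (rule less.IH)
          show "wsum a + i < d" using ji p by auto
          show "cmon (esf A) a * csf A i \<in> cpol (esf A) (card A) (wsum a + i)"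
            using p unfolding csf_def by (intro cpol_mult_cmon hseq_cpol) auto
          show "s * esf B j * csf B (m - j - i) \<in> Y"
            using ji less.prems unfolding csf_def by (intro Ymult[OF _ hseq_cpol] esfY) auto
        qed
      qed
    qed
    then show ?case by (simp add: mult.commute)
  qed
  have step2: "cmon (esf A) a' * s \<in> pm.span (?G \<union> K)" if a': "length a' = card A" "sum_list a' < L" and s: "s \<in> Y" for a' s
    using s unfolding Y_def
  proof (rule pm_span_mult, goal_cases)
    case 1 show ?case by simp
  next
    case (2 p)
    then obtain b' where b': "p = cmon (esf B) b'" "length b' = card B" by blast
    then have "p \<in> boxrel (esf B) (card B) (L + card A) (wsum b')"
      using cmon_cpol[of b' "card B" "wsum b'"] cpol_subset_boxrel by blast
    then show ?case
      unfolding boxrel_def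
    proof (rule pm_span_mult, goal_cases)
      case 1 show ?case by simp
    next
      case (2 t)
      then show ?case
      proof (elim UnE)
        assume "t \<in> {cmon (esf B) a |a. length a = card B \<and> sum_list a < L + card A \<and> wsum a = wsum b'}"
        then show ?thesis using a' by (intro pm.span_base) auto
      next
        assume "t \<in> {cmon (esf B) a * hseq (esf B) (card B) m |a m. length a = card B \<and> L + card A \<le> m \<and> wsum a + m = wsum b'}"
        then obtain c m where t: "t = cmon (esf B) c * csf B m" "length c = card B" "L + card A \<le> m"
          by (auto simp: csf_def)
        have "B \<inter> A = {}" using assms(3) by blast
        from csf_eq_esf_csf_union[OF assms(2,1) this, of m]
        have E: "csf B m = (\<Sum>j\<in>{0..min (card A) m}. esf A j * csf (A \<union> B) (m - j))"
          by (simp only: Un_commute)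
        have "cmon (esf A) a' * t
            = (\<Sum>j\<in>{0..min (card A) m}. esf A j * cmon (esf A) a' * cmon (esf B) c * csf (A \<union> B) (m - j))"
          by (simp only: t(1) E sum_distrib_left mult_ac)
        also have "\<dots> \<in> K"
        proof (rule pm.subspace_sum[OF K])
          fix j assume j: "j \<in> {0..min (card A) m}"
          show "esf A j * cmon (esf A) a' * cmon (esf B) c * csf (A \<union> B) (m - j) \<in> K"
          proof (cases "j = 0")
            case True
            then show ?thesis using rel[of a' c m] a' t by (simp add: esf_0[OF assms(1)])
          next
            case False
            obtain a'' where "length a'' = length a'" "cmon (esf A) a'' = esf A j * cmon (esf A) a'"
              by (rule cmon_increment[of j a']) (use False j a' in auto)
            then show ?thesis using rel[of a'' c "m - j"] a' t j by auto
          qed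
        qed
        finally show ?thesis by (rule Ksub)
      qed
    qed
  qed
  have "cmon (esf A) a * cmon (esf B) b \<in> V"
    using a b by (intro step1[OF cmon_cpol]) (auto simp: Y_def intro: pm.span_base)
  also have "V \<subseteq> pm.span (?G \<union> K)"
    unfolding V_def using step2 Ksub by (intro pm.span_minimal) auto
  finally show ?thesis .
qed

section \<open>The alcove walk sum as a product of transfer matrices\<close>

definition fold_weight :: "int \<Rightarrow> complex \<Rightarrow> complex \<Rightarrow> nat \<Rightarrow> int \<Rightarrow> complex" where
  "fold_weight n q v j a = inverse v * (1 - v ^ 2) *
     (let \<xi> = walk_xi n q v j in
      if step_label n j = S0
      then (if wall S0 a = a then 1 / (1 - \<xi> ^ 2) else \<xi> ^ 2 / (1 - \<xi> ^ 2))
      else (if wall S1 a = a then 1 / (1 - \<xi>) else \<xi> / (1 - \<xi>)))"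

text \<open>The terminal weight \<open>g\<close> is arbitrary so that the last step of a walk can be
  absorbed into it.\<close>

definition walk_sum :: "int \<Rightarrow> complex \<Rightarrow> complex \<Rightarrow> nat \<Rightarrow> (int \<Rightarrow> complex) \<Rightarrow> complex" where
  "walk_sum n q v l g = (\<Sum>b | length b = l.
     (\<Prod>j\<in>{1..l}. if b ! (j - 1) then 1 else fold_weight n q v j (alcove_after n b (j - 1)))
     * g (alcove_after n b l))"

lemma wall_cases: "wall s a = a \<or> wall s a = a + 1"
  by (simp add: wall_def)

lemma walk_term:
  assumes "v \<noteq> 0"
  shows "v powi (d - int (card (foldings n b))) * (1 - v ^ 2) ^ card (foldings n b)
       * (\<Prod>j\<in>pos_foldings S0 n b. 1 / (1 - (walk_xi n q v j)^2))
       * (\<Prod>j\<in>neg_foldings S0 n b. (walk_xi n q v j)^2 / (1 - (walk_xi n q v j)^2))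
       * (\<Prod>j\<in>pos_foldings S1 n b. 1 / (1 - walk_xi n q v j))
       * (\<Prod>j\<in>neg_foldings S1 n b. walk_xi n q v j / (1 - walk_xi n q v j))
     = v powi d * (\<Prod>j\<in>{1..walk_length n}. if b ! (j - 1) then 1
         else fold_weight n q v j (alcove_after n b (j - 1)))"
proof -
  let ?L = "{1..walk_length n}"
  have filt: "prod g {j \<in> ?L. P j} = (\<Prod>j\<in>?L. if P j then g j else 1)" for g :: "nat \<Rightarrow> complex" and P
    by (rule prod.inter_filter) simp
  have lab: "step_label n j \<noteq> S1 \<longleftrightarrow> step_label n j = S0" for j
    by (cases "step_label n j") auto
  have eqs: "foldings n b = {j \<in> ?L. \<not> b ! (j - 1)}"
    "pos_foldings s n b = {j \<in> ?L. \<not> b ! (j - 1) \<and> step_label n j = s \<and>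
       wall s (alcove_after n b (j - 1)) = alcove_after n b (j - 1)}"
    "neg_foldings s n b = {j \<in> ?L. \<not> b ! (j - 1) \<and> step_label n j = s \<and>
       wall s (alcove_after n b (j - 1)) \<noteq> alcove_after n b (j - 1)}" for s
    using wall_cases by (auto simp: foldings_def pos_foldings_def neg_foldings_def)
  have "v powi (d - int (card (foldings n b))) * (1 - v ^ 2) ^ card (foldings n b)
     = v powi d * (inverse v * (1 - v ^ 2)) ^ card (foldings n b)"
    using assms by (simp add: power_int_diff power_mult_distrib power_inverse field_simps)
  also have "(inverse v * (1 - v ^ 2)) ^ card (foldings n b)
     = (\<Prod>j\<in>foldings n b. inverse v * (1 - v ^ 2))" by simp
  finally have head: "v powi (d - int (card (foldings n b))) * (1 - v ^ 2) ^ card (foldings n b)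
     = v powi d * (\<Prod>j\<in>foldings n b. inverse v * (1 - v ^ 2))" .
  show ?thesis
    unfolding head unfolding eqs filt mult.assoc
    unfolding prod.distrib[symmetric]
    by (intro arg_cong2[where f = "(*)"] prod.cong)
      (auto simp: fold_weight_def Let_def lab)
qed

lemma alcove_after_append: "j \<le> length b \<Longrightarrow> alcove_after n (b @ [c]) j = alcove_after n b j"
  by (induction j) (auto simp: nth_append)

lemma walk_sum_Suc:
  "walk_sum n q v (Suc m) g = walk_sum n q v m
     (\<lambda>a. g (cross (step_label n (Suc m)) a) + fold_weight n q v (Suc m) a * g a)"
proof -
  let ?W = "\<lambda>b l. \<Prod>j\<in>{1..l}. if b ! (j - 1) then 1 else fold_weight n q v j (alcove_after n b (j - 1))"
  have lists: "{b :: bool list. length b = Suc m} = (\<lambda>(b, c). b @ [c]) ` ({b. length b = m} \<times> UNIV)"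
    by (auto simp: length_Suc_conv_rev)
  have "walk_sum n q v (Suc m) g
    = (\<Sum>(b, c)\<in>{b. length b = m} \<times> UNIV. ?W (b @ [c]) (Suc m) * g (alcove_after n (b @ [c]) (Suc m)))"
    unfolding walk_sum_def
    unfolding lists by (subst sum.reindex) (auto simp: inj_on_def split_def)
  also have "\<dots> = (\<Sum>b | length b = m. \<Sum>c\<in>UNIV. ?W (b @ [c]) (Suc m) * g (alcove_after n (b @ [c]) (Suc m)))"
    by (rule sum.cartesian_product[symmetric])
  also have "\<dots> = walk_sum n q v m
     (\<lambda>a. g (cross (step_label n (Suc m)) a) + fold_weight n q v (Suc m) a * g a)"
    unfolding walk_sum_def
  proof (intro sum.cong refl)
    fix b :: "bool list" assume b: "b \<in> {b. length b = m}"
    have W: "?W (b @ [c]) m = ?W b m" for c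
      using b by (intro prod.cong) (auto simp: nth_append alcove_after_append)
    have "?W (b @ [c]) (Suc m)
        = ?W b m * (if c then 1 else fold_weight n q v (Suc m) (alcove_after n b m))" for c
      using b W[of c] by (simp add: nth_append alcove_after_append)
    then show "(\<Sum>c\<in>UNIV. ?W (b @ [c]) (Suc m) * g (alcove_after n (b @ [c]) (Suc m)))
      = ?W b m * (g (cross (step_label n (Suc m)) (alcove_after n b m))
          + fold_weight n q v (Suc m) (alcove_after n b m) * g (alcove_after n b m))"
      using b by (simp add: UNIV_bool nth_append alcove_after_append algebra_simps)
  qed
  finally show ?thesis .
qed

text \<open>The invariant two-dimensional space of functions on alcoves. The factor \<open>v\<close> at odd alcoves
  absorbs $v^{d(p_J)}$ and makes the matrix entries rational in $t = v^2$.\<close>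

definition alcove_fun :: "complex \<Rightarrow> complex \<Rightarrow> complex \<times> complex \<Rightarrow> int \<Rightarrow> complex" where
  "alcove_fun x v \<gamma> a = (if even a then x powi (a div 2) * fst \<gamma> else v * x powi ((a + 1) div 2) * snd \<gamma>)"

text \<open>Up to powers of \<open>v\<close>, \<open>u\<close> and \<open>w\<close> are the weights
  of positive foldings at an \<open>S1\<close> and an \<open>S0\<close> step, \<open>u * R\<close>
  and \<open>z\<close> those of the negative ones. \<open>R\<close> and \<open>S\<close> are the
  powers of \<open>q\<close> in the \<xi> of the two steps.\<close>

definition transfer :: "complex \<Rightarrow> complex \<Rightarrow> complex \<Rightarrow> complex \<Rightarrow> complex \<times> complex \<Rightarrow> complex \<times> complex" where
  "transfer x t R S \<gamma> =
    (let u = (1 - t) / (1 - R * t); w = (1 - t) / (1 - S ^ 2 * t ^ 2);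
         z = (1 - t) * S ^ 2 * t / (1 - S ^ 2 * t ^ 2)
     in ((u * z + inverse x) * fst \<gamma> + (u * x + w) * snd \<gamma>,
         (z + u * R * inverse x) * fst \<gamma> + (x + u * R * w) * snd \<gamma>))"

text \<open>All step weights are invariant under translation by 2, and the functions
  \<open>alcove_fun\<close> are those multiplied by \<open>x\<close> under this translation, so
  every step preserves them.\<close>

lemma walk_sum_transfer:
  assumes "x \<noteq> 0" "v \<noteq> 0" "n \<le> 0" "even m" "m + 2 \<le> walk_length n"
  shows "walk_sum n q v (Suc (Suc m)) (alcove_fun x v \<gamma>)
    = walk_sum n q v m (alcove_fun x v
        (transfer x (v ^ 2) (q ^ (walk_length n - m)) (q ^ (walk_length n - m - 1)) \<gamma>))"
proof -
  define t R S where "t = v ^ 2" and "R = q ^ (walk_length n - m)" and "S = q ^ (walk_length n - m - 1)"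
  define u w z where "u = (1 - t) / (1 - R * t)" and "w = (1 - t) / (1 - S ^ 2 * t ^ 2)"
    and "z = (1 - t) * S ^ 2 * t / (1 - S ^ 2 * t ^ 2)"
  \<comment> \<open>The coordinates after the \<open>S0\<close> step alone. They contain odd powers
    of \<open>v\<close>, which disappear with the \<open>S1\<close> step; this is why steps are
    taken in pairs.\<close>
  define \<delta> where "\<delta> = (v * x * snd \<gamma> + v * z * fst \<gamma>,
    inverse v * inverse x * fst \<gamma> + inverse v * w * snd \<gamma>)"
  have xi: "walk_xi n q v (Suc m) = R * t" "walk_xi n q v (Suc (Suc m)) = S * t"
    using assms by (simp_all add: walk_xi_def Suc_diff_Suc t_def R_def S_def)
  have lab: "step_label n (Suc m) = S1" "step_label n (Suc (Suc m)) = S0"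
    using assms by (simp_all add: step_label_def)
  have pw: "x powi (c + 1) = x * x powi c" "x powi (1 + c) = x * x powi c" for c
    using assms by (simp_all add: power_int_add_1' add.commute[of 1])
  have vt: "inverse v * t = v" using assms by (simp add: t_def power2_eq_square)
  have "inverse v * (1 - t) * ((S * t) ^ 2 / (1 - (S * t) ^ 2)) = (inverse v * t) * z"
    by (simp add: z_def power2_eq_square mult_ac)
  then have fw0: "fold_weight n q v (Suc (Suc m)) (2 * c) = v * z"
    "fold_weight n q v (Suc (Suc m)) (2 * c + 1) = inverse v * w" for c
    unfolding vt by (simp_all add: fold_weight_def lab xi wall_def Let_def w_def power_mult_distrib
        flip: t_def)
  have fw1: "fold_weight n q v (Suc m) (2 * c) = inverse v * u"
    "fold_weight n q v (Suc m) (2 * c + 1) = inverse v * u * R * t" for c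
    by (simp_all add: fold_weight_def lab xi wall_def Let_def u_def flip: t_def)
  have half: "(2 * c + 2) div 2 = c + 1" for c :: int by simp
  have step0: "alcove_fun x v \<gamma> (cross S0 a) + fold_weight n q v (Suc (Suc m)) a * alcove_fun x v \<gamma> a
      = alcove_fun x v \<delta> a" for a
  proof (cases "even a")
    case True
    then obtain c where a: "a = 2 * c" by (elim evenE)
    show ?thesis unfolding a fw0
      by (simp add: alcove_fun_def cross_def wall_def \<delta>_def half pw algebra_simps)
  next
    case False
    then obtain c where a: "a = 2 * c + 1" by (elim oddE)
    show ?thesis unfolding a fw0
      using assms by (simp add: alcove_fun_def cross_def wall_def \<delta>_def half pw algebra_simps)
        (simp add: field_simps)
  qed
  have step1: "alcove_fun x v \<delta> (cross S1 a) + fold_weight n q v (Suc m) a * alcove_fun x v \<delta> a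
      = alcove_fun x v (transfer x t R S \<gamma>) a" for a
  proof -
    have tr: "transfer x t R S \<gamma> = (v * snd \<delta> + inverse v * u * fst \<delta>,
        inverse v * fst \<delta> + inverse v * u * R * t * snd \<delta>)"
    proof -
      have f: "inverse v * fst \<delta> = x * snd \<gamma> + z * fst \<gamma>"
        "inverse v * u * fst \<delta> = u * (x * snd \<gamma> + z * fst \<gamma>)"
        using assms by (simp_all add: \<delta>_def field_simps)
      have g: "v * snd \<delta> = inverse x * fst \<gamma> + w * snd \<gamma>"
        using assms by (simp add: \<delta>_def field_simps)
      have "inverse v * u * R * t * snd \<delta> = u * R * (inverse v * t * snd \<delta>)" by simp
      also have "\<dots> = u * R * (inverse x * fst \<gamma> + w * snd \<gamma>)" unfolding vt g ..
      finally have h: "inverse v * u * R * t * snd \<delta> = u * R * (inverse x * fst \<gamma> + w * snd \<gamma>)" .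
      have "transfer x t R S \<gamma> = ((u * z + inverse x) * fst \<gamma> + (u * x + w) * snd \<gamma>,
          (z + u * R * inverse x) * fst \<gamma> + (x + u * R * w) * snd \<gamma>)"
        by (simp only: transfer_def Let_def u_def w_def z_def)
      then show ?thesis unfolding f g h by (simp add: algebra_simps)
    qed
    show ?thesis
    proof (cases "even a")
      case True
      then obtain c where a: "a = 2 * c" by (elim evenE)
      show ?thesis unfolding tr a fw1
        by (simp add: alcove_fun_def cross_def wall_def algebra_simps)
    next
      case False
      then obtain c where a: "a = 2 * c + 1" by (elim oddE)
      show ?thesis unfolding tr a fw1
        using assms by (simp add: alcove_fun_def cross_def wall_def half algebra_simps)
    qed
  qed
  show ?thesis
    unfolding walk_sum_Suc lab step0 step1 t_def R_def S_def ..
qed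

text \<open>Pairs of steps are counted from the end of the walk: \<open>walk_xi\<close> depends only
  on the distance to the end, so the same vectors serve every \<open>n\<close>.\<close>

primrec transfer_vec :: "complex \<Rightarrow> complex \<Rightarrow> complex \<Rightarrow> nat \<Rightarrow> complex \<times> complex" where
  "transfer_vec x q t 0 = (1, 1)"
| "transfer_vec x q t (Suc i) = transfer x t (q ^ (2 * Suc i)) (q ^ (2 * i + 1)) (transfer_vec x q t i)"

lemma macdonald_E_transfer:
  assumes "x \<noteq> 0" "t \<noteq> 0"
  shows "macdonald_E (- int n) x q t = fst (transfer_vec x q t n)"
proof -
  define v where "v = csqrt t"
  have v: "v \<noteq> 0" "v ^ 2 = t" using assms by (auto simp: v_def)
  have l: "walk_length (- int n) = 2 * n" by (simp add: walk_length_def)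
  have end_fun: "v powi alcove_d a * x powi alcove_wt a = alcove_fun x v (1, 1) a" for a
    by (auto simp: alcove_d_def alcove_wt_def wall_def alcove_fun_def)
  have "macdonald_E (- int n) x q t = walk_sum (- int n) q v (2 * n) (alcove_fun x v (1, 1))"
    unfolding macdonald_E_def Let_def v_def[symmetric] walk_sum_def l
  proof (intro sum.cong refl)
    fix b :: "bool list" assume "b \<in> {b. length b = 2 * n}"
    show "v powi ((if 0 < - int n then - 1 else 0) + alcove_d (walk_end (- int n) b) - int (card (foldings (- int n) b)))
       * (1 - v ^ 2) ^ card (foldings (- int n) b)
       * (\<Prod>j\<in>pos_foldings S0 (- int n) b. 1 / (1 - (walk_xi (- int n) q v j)^2))
       * (\<Prod>j\<in>neg_foldings S0 (- int n) b. (walk_xi (- int n) q v j)^2 / (1 - (walk_xi (- int n) q v j)^2))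
       * (\<Prod>j\<in>pos_foldings S1 (- int n) b. 1 / (1 - walk_xi (- int n) q v j))
       * (\<Prod>j\<in>neg_foldings S1 (- int n) b. walk_xi (- int n) q v j / (1 - walk_xi (- int n) q v j))
       * x powi alcove_wt (walk_end (- int n) b)
      = (\<Prod>j\<in>{1..2 * n}. if b ! (j - 1) then 1 else fold_weight (- int n) q v j (alcove_after (- int n) b (j - 1)))
       * alcove_fun x v (1, 1) (alcove_after (- int n) b (2 * n))"
      using walk_term[OF v(1), of "alcove_d (walk_end (- int n) b)" "- int n" b q]
        end_fun[of "alcove_after (- int n) b (2 * n)"]
      by (simp add: l walk_end_def mult_ac)
  qed
  moreover have rec: "walk_sum (- int n) q v (2 * n) (alcove_fun x v (1, 1))
    = walk_sum (- int n) q v (2 * (n - i)) (alcove_fun x v (transfer_vec x q t i))" if "i \<le> n" for i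
    using that
  proof (induction i)
    case (Suc i)
    have 1: "2 * (n - i) = Suc (Suc (2 * (n - Suc i)))" using Suc.prems by simp
    have 2: "2 * n - 2 * (n - Suc i) = 2 * Suc i" "2 * Suc i - 1 = 2 * i + 1" using Suc.prems by auto
    show ?case using Suc walk_sum_transfer[of x v "- int n" "2 * (n - Suc i)" q "transfer_vec x q t i"]
        assms v by (simp add: 1 2 l del: power_Suc)
  qed simp
  \<comment> \<open>The initial alcove 0 is even, which selects the first coordinate.\<close>
  moreover have "walk_sum (- int n) q v 0 (alcove_fun x v \<gamma>) = fst \<gamma>" for \<gamma>
    by (simp add: walk_sum_def alcove_fun_def)
  ultimately show ?thesis using rec[of n] by simp
qed

section \<open>Limits of the transfer matrices at t = 0 and t = infinity\<close>

lemma transfer_tendsto: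
  assumes "(f \<longlongrightarrow> \<gamma>) F"
    and "((\<lambda>t. (1 - t) / (1 - R * t)) \<longlongrightarrow> u) F"
    and "((\<lambda>t. (1 - t) / (1 - S ^ 2 * t ^ 2)) \<longlongrightarrow> w) F"
    and "((\<lambda>t. (1 - t) * S ^ 2 * t / (1 - S ^ 2 * t ^ 2)) \<longlongrightarrow> z) F"
  shows "((\<lambda>t. transfer x t R S (f t)) \<longlongrightarrow>
    ((u * z + inverse x) * fst \<gamma> + (u * x + w) * snd \<gamma>,
     (z + u * R * inverse x) * fst \<gamma> + (x + u * R * w) * snd \<gamma>)) F"
  unfolding transfer_def Let_def by (intro tendsto_intros assms)

lemma transfer_coeffs_at_0:
  fixes R S :: complex
  shows "((\<lambda>t. (1 - t) / (1 - R * t)) \<longlongrightarrow> 1) (at 0)"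
    and "((\<lambda>t. (1 - t) / (1 - S ^ 2 * t ^ 2)) \<longlongrightarrow> 1) (at 0)"
    and "((\<lambda>t. (1 - t) * S ^ 2 * t / (1 - S ^ 2 * t ^ 2)) \<longlongrightarrow> 0) (at 0)"
  by (auto intro!: tendsto_eq_intros)

text \<open>The substitution \<open>t = 1/s\<close> produces rational functions that are regular at
  \<open>s = 0\<close>.\<close>

lemma transfer_coeffs_at_infinity:
  fixes R S :: complex
  assumes "R \<noteq> 0" "S \<noteq> 0"
  shows "((\<lambda>t. (1 - t) / (1 - R * t)) \<longlongrightarrow> inverse R) at_infinity"
    and "((\<lambda>t. (1 - t) / (1 - S ^ 2 * t ^ 2)) \<longlongrightarrow> 0) at_infinity"
    and "((\<lambda>t. (1 - t) * S ^ 2 * t / (1 - S ^ 2 * t ^ 2)) \<longlongrightarrow> 1) at_infinity"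
proof -
  have ev: "eventually (\<lambda>s. s \<noteq> 0) (at (0::complex))"
    by (simp add: eventually_at_filter)
  have "((\<lambda>s. (s - 1) / (s - R)) \<longlongrightarrow> inverse R) (at 0)"
    using assms by (auto intro!: tendsto_eq_intros simp: field_simps)
  then show "((\<lambda>t. (1 - t) / (1 - R * t)) \<longlongrightarrow> inverse R) at_infinity"
    unfolding lim_at_infinity_0 o_def
    by (rule Lim_transform_eventually) (use ev in eventually_elim, simp add: divide_simps)
  have "((\<lambda>s. (s - 1) * s / (s ^ 2 - S ^ 2)) \<longlongrightarrow> 0) (at 0)"
    using assms by (auto intro!: tendsto_eq_intros simp: field_simps)
  then show "((\<lambda>t. (1 - t) / (1 - S ^ 2 * t ^ 2)) \<longlongrightarrow> 0) at_infinity"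
    unfolding lim_at_infinity_0 o_def
    by (rule Lim_transform_eventually) (use ev in eventually_elim, simp add: divide_simps power2_eq_square)
  have "((\<lambda>s. (s - 1) * S ^ 2 / (s ^ 2 - S ^ 2)) \<longlongrightarrow> 1) (at 0)"
    using assms by (auto intro!: tendsto_eq_intros simp: field_simps)
  then show "((\<lambda>t. (1 - t) * S ^ 2 * t / (1 - S ^ 2 * t ^ 2)) \<longlongrightarrow> 1) at_infinity"
    unfolding lim_at_infinity_0 o_def
    by (rule Lim_transform_eventually) (use ev in eventually_elim, simp add: divide_simps power2_eq_square)
qed

text \<open>The limit of the transfer matrix is the matrix of the recursion in
  \<open>trisum_zero_rec\<close>; the induction has to follow both coordinates although only the
  first is wanted.\<close>

lemma macdonald_E_tendsto_0:
  assumes "x \<noteq> 0"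
  shows "(macdonald_E (- int n) x q \<longlongrightarrow> trisum (\<lambda>M r k. (q ^ 2) ^ triangle r) (q ^ 2) x n) (at 0)"
proof -
  let ?A = "trisum (\<lambda>M r k. (q ^ 2) ^ triangle r) (q ^ 2) x"
  let ?B = "trisum (\<lambda>M r k. (q ^ 2) ^ (triangle r + (M + r))) (q ^ 2) x"
  have "((\<lambda>t. transfer_vec x q t n) \<longlongrightarrow> (?A n, ?B n)) (at 0)"
  proof (induction n)
    case 0 then show ?case by (simp add: trisum_zero_rec(1,2)[OF assms])
  next
    case (Suc n)
    have R: "q ^ (2 * Suc n) = (q ^ 2) ^ Suc n" by (simp only: power_mult)
    have "((\<lambda>t. transfer x t (q ^ (2 * Suc n)) (q ^ (2 * n + 1)) (transfer_vec x q t n))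
      \<longlongrightarrow> (inverse x * ?A n + (1 + x) * ?B n,
         (q ^ 2) ^ Suc n * inverse x * ?A n + (x + (q ^ 2) ^ Suc n) * ?B n)) (at 0)"
      using transfer_tendsto[OF Suc transfer_coeffs_at_0, of x "q ^ (2 * Suc n)" "q ^ (2 * n + 1)"]
      unfolding R by (simp add: add.commute)
    then show ?case
      unfolding transfer_vec.simps trisum_zero_rec(3,4)[OF assms] .
  qed
  then have "((\<lambda>t. fst (transfer_vec x q t n)) \<longlongrightarrow> ?A n) (at 0)"
    using tendsto_fst by fastforce
  then show ?thesis
    by (rule Lim_transform_eventually)
      (auto simp: eventually_at_filter macdonald_E_transfer[OF assms])
qed

lemma macdonald_E_tendsto_infinity:
  assumes "x \<noteq> 0" "q \<noteq> 0"
  shows "(macdonald_E (- int n) x (inverse q) \<longlongrightarrow>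
    trisum (\<lambda>M r k. (q ^ 2) ^ (triangle r + r + k)) (q ^ 2) x n) at_infinity"
proof -
  let ?A = "trisum (\<lambda>M r k. (q ^ 2) ^ (triangle r + r + k)) (q ^ 2) x"
  let ?B = "trisum (\<lambda>M r k. (q ^ 2) ^ triangle r) (q ^ 2) x"
  have "((\<lambda>t. transfer_vec x (inverse q) t n) \<longlongrightarrow> (?A n, ?B n)) at_infinity"
  proof (induction n)
    case 0 then show ?case by (simp add: trisum_infinity_rec(1,2)[OF assms(1)])
  next
    case (Suc n)
    \<comment> \<open>The limit of the \<open>S1\<close> folding coefficient is
      \<open>1 / R\<close>; with \<open>q\<close> inverted it becomes a positive power of
      \<open>q ^ 2\<close>.\<close>
    have R: "inverse (inverse q ^ (2 * Suc n)) = (q ^ 2) ^ Suc n"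
      by (simp only: power_inverse inverse_inverse_eq power_mult)
    have nz: "inverse q ^ (2 * Suc n) \<noteq> 0" "inverse q ^ (2 * n + 1) \<noteq> 0"
      using assms by simp_all
    have c: "(q ^ 2) ^ Suc n * inverse q ^ (2 * Suc n) = 1"
      using R nz by (metis left_inverse)
    have "((\<lambda>t. transfer x t (inverse q ^ (2 * Suc n)) (inverse q ^ (2 * n + 1)) (transfer_vec x (inverse q) t n))
      \<longlongrightarrow> (((q ^ 2) ^ Suc n + inverse x) * ?A n + (q ^ 2) ^ Suc n * x * ?B n,
         (1 + inverse x) * ?A n + x * ?B n)) at_infinity"
      using transfer_tendsto[OF Suc transfer_coeffs_at_infinity[OF nz], of x]
      unfolding R c by simp
    then show ?case
      unfolding transfer_vec.simps trisum_infinity_rec(3,4)[OF assms(1)] .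
  qed
  then have "((\<lambda>t. fst (transfer_vec x (inverse q) t n)) \<longlongrightarrow> ?A n) at_infinity"
    using tendsto_fst by fastforce
  moreover have "eventually (\<lambda>t::complex. t \<noteq> 0) at_infinity"
    by (rule eventually_at_infinityI[of 1]) auto
  ultimately show ?thesis
    by (rule Lim_transform_eventually[OF _ eventually_mono])
      (simp add: macdonald_E_transfer[OF assms(1)])
qed

section \<open>Modules over the current superalgebra\<close>

text \<open>Instantiated by a copy of W_{-n} inside the free algebra and by the tensor products of
  evaluation modules.\<close>

locale osp_module = cvector_space scale
  for scale :: "complex \<Rightarrow> 'v::ab_group_add \<Rightarrow> 'v" +
  fixes act :: "osp12 \<Rightarrow> nat \<Rightarrow> 'v \<Rightarrow> 'v"
  assumes act_add: "act y i (u + v) = act y i u + act y i v"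
    and act_scale: "act y i (scale c v) = scale c (act y i v)"
    and act_super: "act y i (act z j v)
      = scale ((-1) ^ (osp_parity y * osp_parity z)) (act z j (act y i v))
        + (\<Sum>x\<in>keys (osp_bracket y z). scale (lookup (osp_bracket y z) x) (act x (i + j) v))"
begin

abbreviation "E \<equiv> act Osp_e"
abbreviation "G \<equiv> act Osp_gp"
abbreviation "H \<equiv> act Osp_h"
abbreviation "Gm \<equiv> act Osp_gm"
abbreviation "Fo \<equiv> act Osp_f"

lemma act_zero [simp]: "act y i 0 = 0"
  using act_scale[of y i 0 0] by simp

lemma act_sum: "act y i (sum f A) = (\<Sum>a\<in>A. act y i (f a))"
  by (induction A rule: infinite_finite_induct) (auto simp: act_add)

lemma act_uminus: "act y i (- v) = - act y i v"
  using act_add[of y i v "- v"] by (simp add: eq_neg_iff_add_eq_0 add.commute)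

lemma E_E: "E i (E j v) = E j (E i v)"
  using act_super[of Osp_e i Osp_e j v] by simp

lemma G_E: "G i (E j v) = E j (G i v)"
  using act_super[of Osp_gp i Osp_e j v] by simp

lemma G_G: "G i (G j v) = - G j (G i v) + scale 2 (E (i + j) v)"
  using act_super[of Osp_gp i Osp_gp j v] by simp

lemma H_E: "H i (E j v) = E j (H i v) + scale 2 (E (i + j) v)"
  using act_super[of Osp_h i Osp_e j v] by simp

lemma H_G: "H i (G j v) = G j (H i v) + G (i + j) v"
  using act_super[of Osp_h i Osp_gp j v] by simp

lemma Gm_E: "Gm i (E j v) = E j (Gm i v) + G (i + j) v"
  using act_super[of Osp_gm i Osp_e j v] by simp

lemma Gm_G: "Gm i (G j v) = - G j (Gm i v) + H (i + j) v"
  using act_super[of Osp_gm i Osp_gp j v] by simp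

lemma Fo_E: "Fo i (E j v) = E j (Fo i v) - H (i + j) v"
  using act_super[of Osp_f i Osp_e j v] by simp

definition wact :: "osp_word \<Rightarrow> 'v \<Rightarrow> 'v" where
  "wact x v = foldr (\<lambda>(y, i). act y i) (letters x) v"

definition ev :: "'v \<Rightarrow> free_alg \<Rightarrow> 'v" where
  "ev v = linext (\<lambda>x. wact x v)"

lemma wact_add: "wact x (u + v) = wact x u + wact x v"
proof -
  have "foldr (\<lambda>(y, i). act y i) ys (u + v) = foldr (\<lambda>(y, i). act y i) ys u + foldr (\<lambda>(y, i). act y i) ys v" for ys
    by (induction ys) (auto simp: act_add)
  then show ?thesis by (simp add: wact_def)
qed

lemma wact_scale: "wact x (scale c v) = scale c (wact x v)"
proof -
  have "foldr (\<lambda>(y, i). act y i) ys (scale c v) = scale c (foldr (\<lambda>(y, i). act y i) ys v)" for ys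
    by (induction ys) (auto simp: act_scale)
  then show ?thesis by (simp add: wact_def)
qed

lemma wact_zero [simp]: "wact x 0 = 0"
  using wact_scale[of x 0 0] by simp

lemma ev_mult: "ev v (p * q) = ev (ev v q) p"
proof (induction p rule: pm_induct)
  case (single a c)
  show ?case
  proof (induction q rule: pm_induct)
    case (single b d)
    then show ?case
      by (simp add: ev_def mult_single wact_def plus_osp_word_def foldr_append)
        (metis scale_scale wact_def wact_scale)
  qed (auto simp: ev_def linext_add distrib_left wact_add scale_right_distrib)
qed (auto simp: ev_def linext_add distrib_right)

lemma ev_cur [simp]: "ev v (cur y i) = act y i v"
  by (simp add: ev_def cur_def wact_def)

lemma ev_one [simp]: "ev v 1 = v"
  unfolding single_one[symmetric] by (simp add: ev_def wact_def zero_osp_word_def)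

lemma ev_simps: "ev v (p + q) = ev v p + ev v q" "ev v (p - q) = ev v p - ev v q"
  "ev v (cscale c p) = scale c (ev v p)" "ev v (sum f A) = (\<Sum>a\<in>A. ev v (f a))" "ev v 0 = 0"
  by (simp_all add: ev_def linext_add linext_diff linext_cscale linext_sum)

lemma ev_0_left [simp]: "ev 0 p = 0"
  by (simp add: ev_def linext_def)

lemma ev_super_rel: "ev v (super_rel y i z j) = 0"
  unfolding super_rel_def fscale_eq_cscale
  by (simp add: ev_simps ev_mult act_super[of y i z j])

lemma ev_enveloping_ideal: "p \<in> enveloping_ideal \<Longrightarrow> ev v p = 0"
  unfolding enveloping_ideal_def fscale_eq_cscale
  by (induction rule: pm_span_induct) (auto simp: ev_simps ev_mult ev_super_rel)
    
definition mon :: "'v \<Rightarrow> nat list \<Rightarrow> nat list \<Rightarrow> 'v" where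
  "mon v es gs = foldr E es (foldr G gs v)"

lemma foldr_E_add: "foldr E es (u + v) = foldr E es u + foldr E es v"
  by (induction es) (auto simp: act_add)

lemma foldr_E_scale: "foldr E es (scale c v) = scale c (foldr E es v)"
  by (induction es) (auto simp: act_scale)

lemma foldr_E_uminus: "foldr E es (- v) = - foldr E es v"
  by (induction es) (auto simp: act_uminus)

lemma foldr_G_add: "foldr G es (u + v) = foldr G es u + foldr G es v"
  by (induction es) (auto simp: act_add)

lemma foldr_E_mset:
  assumes "mset es = mset es'"
  shows "foldr E es v = foldr E es' v"
proof -
  have "fold E (rev es) = fold E (rev es')"
    using assms by (intro fold_multiset_equiv) (auto simp: E_E fun_eq_iff)
  then show ?thesis by (simp add: foldr_conv_fold)
qed

lemma G_foldr_E: "G i (foldr E es v) = foldr E es (G i v)"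
  by (induction es) (auto simp: G_E)

lemma H_foldr_E:
  "H j (foldr E es v) = foldr E es (H j v) + (\<Sum>i<length es. scale 2 (foldr E (es[i := es ! i + j]) v))"
proof (induction es)
  case (Cons e es)
  show ?case
    by (simp add: H_E Cons act_add act_sum act_scale sum.lessThan_Suc_shift add_ac del: sum.lessThan_Suc)
qed simp

lemma Gm_foldr_E:
  "Gm j (foldr E es v) = foldr E es (Gm j v)
    + (\<Sum>a<length es. foldr E (take a es @ drop (Suc a) es) (G (es ! a + j) v))"
proof (induction es)
  case (Cons e es)
  show ?case
    by (simp add: Gm_E Cons act_add act_sum G_foldr_E sum.lessThan_Suc_shift add_ac del: sum.lessThan_Suc)
qed simp

text \<open>The coefficient of $z^a$ in $(\sum_i e_i z^i)^b v$.\<close>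

primrec econv :: "'v \<Rightarrow> nat \<Rightarrow> nat \<Rightarrow> 'v" where
  "econv v 0 a = (if a = 0 then v else 0)"
| "econv v (Suc b) a = (\<Sum>i\<le>a. E i (econv v b (a - i)))"

lemma econv_E: "econv (E j v) b a = E j (econv v b a)"
  by (induction b arbitrary: a) (auto simp: act_sum E_E[of j])

lemma sum_triangle_swap:
  "(\<Sum>i\<le>a. \<Sum>l\<le>a - i. f i l) = (\<Sum>l\<le>a. \<Sum>i\<le>a - l. f i l)" for a :: nat
  by (subst sum.Sigma, simp, simp, subst sum.Sigma, simp, simp)
    (rule sum.reindex_bij_witness[of _ "\<lambda>(x, y). (y, x)" "\<lambda>(x, y). (y, x)"]; auto)

lemma sum_constant_nat_scale: "finite A \<Longrightarrow> (\<Sum>i\<in>A. v) = scale (of_nat (card A)) v"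
  by (induction A rule: finite_induct) (auto simp: scale_left_distrib)

lemma sum_triangle_diagonal:
  "(\<Sum>i\<le>a. \<Sum>l\<le>a - i. g (i + l)) = (\<Sum>s\<le>a. scale (of_nat (Suc s)) (g s))" for a :: nat
proof -
  have "(\<Sum>i\<le>a. \<Sum>l\<le>a - i. g (i + l)) = (\<Sum>s\<le>a. \<Sum>i\<le>s. g s)"
    by (subst sum.Sigma, simp, simp, subst sum.Sigma, simp, simp)
      (rule sum.reindex_bij_witness[of _ "\<lambda>(s, i). (i, s - i)" "\<lambda>(i, l). (i + l, i)"]; auto)
  then show ?thesis by (simp add: sum_constant_nat_scale)
qed

end

section \<open>Vanishing of the coefficients of e(z)^b w\<close>

locale weyl_rep = osp_module +
  fixes w :: 'a and n :: nat
  assumes pos_w: "i \<ge> 1 \<Longrightarrow> y \<in> {Osp_f, Osp_gm, Osp_h} \<Longrightarrow> act y i w = 0"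
    and Gm_0_w: "Gm 0 w = 0"
    and H_0_w: "H 0 w = - scale (of_nat n) w"
    and E_0_w: "foldr E (replicate (Suc n) 0) w = 0"
begin

lemma H_w: "j \<ge> 1 \<Longrightarrow> H j w = 0"
  and Fo_w: "j \<ge> 1 \<Longrightarrow> Fo j w = 0"
  and Gm_w: "Gm j w = 0"
  using pos_w[of j] Gm_0_w by (cases "j = 0"; simp)+

abbreviation "T \<equiv> econv w"

text \<open>The bracket of \<open>h_j\<close> with \<open>e(z)\<close> is twice the series with
  coefficients \<open>e_(i+j)\<close>; this is the coefficient of \<open>z ^ a\<close> in that
  series, without the factor 2, times \<open>e(z)^b w\<close>.\<close>

definition "econv_shift b j a = (\<Sum>i\<le>a. E (i + j) (T b (a - i)))"

text \<open>The coefficient of \<open>z ^ a\<close> in \<open>e'(z) e(z)^b w\<close>.\<close>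

definition "econv_deriv b a = (\<Sum>i\<le>a. scale (of_nat (Suc i)) (E (Suc i) (T b (a - i))))"

lemma sum_atMost_last: "(\<And>i. i < a \<Longrightarrow> f i = 0) \<Longrightarrow> (\<Sum>i\<le>a. f i) = f a" for a :: nat and f :: "nat \<Rightarrow> 'a"
  by (cases a) (auto simp: less_Suc_eq_le)

lemma E_econv_shift: "(\<Sum>i\<le>a. E i (econv_shift b j (a - i))) = econv_shift (Suc b) j a"
proof -
  have "(\<Sum>i\<le>a. E i (econv_shift b j (a - i))) = (\<Sum>i\<le>a. \<Sum>l\<le>a - i. E i (E (l + j) (T b (a - i - l))))"
    by (simp add: econv_shift_def act_sum)
  also have "\<dots> = (\<Sum>l\<le>a. \<Sum>i\<le>a - l. E i (E (l + j) (T b (a - i - l))))"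
    by (rule sum_triangle_swap)
  also have "\<dots> = econv_shift (Suc b) j a"
    by (auto simp: econv_shift_def act_sum intro!: sum.cong) (subst E_E, simp add: add.commute diff_right_commute)
  finally show ?thesis .
qed

lemma E_econv_deriv: "(\<Sum>i\<le>a. E i (econv_deriv b (a - i))) = econv_deriv (Suc b) a"
proof -
  have "(\<Sum>i\<le>a. E i (econv_deriv b (a - i)))
     = (\<Sum>i\<le>a. \<Sum>l\<le>a - i. scale (of_nat (Suc l)) (E i (E (Suc l) (T b (a - i - l)))))"
    by (simp add: econv_deriv_def act_sum act_scale)
  also have "\<dots> = (\<Sum>l\<le>a. \<Sum>i\<le>a - l. scale (of_nat (Suc l)) (E i (E (Suc l) (T b (a - i - l)))))"
    by (rule sum_triangle_swap)
  also have "\<dots> = econv_deriv (Suc b) a"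
    unfolding econv_deriv_def econv.simps act_sum scale_sum_right
    by (intro sum.cong refl) (simp add: E_E[of "Suc _"] add.commute)
  finally show ?thesis .
qed

lemma H_econv:
  assumes "j \<ge> 1"
  shows "H j (T (Suc b) a) = scale (2 * of_nat (Suc b)) (econv_shift b j a)"
proof (induction b arbitrary: a)
  case 0
  have "T (Suc 0) a = E a w" "econv_shift 0 j a = E (a + j) w"
    by (simp_all add: econv_shift_def sum_atMost_last)
  then show ?case using assms by (simp add: H_E H_w add.commute del: econv.simps)
next
  case (Suc b)
  have "H j (T (Suc (Suc b)) a)
      = (\<Sum>i\<le>a. E i (H j (T (Suc b) (a - i))) + scale 2 (E (i + j) (T (Suc b) (a - i))))"
    by (simp only: econv.simps(2)[of w "Suc b"] act_sum H_E add.commute[of j])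
  also have "\<dots> = scale (2 * of_nat (Suc b)) (econv_shift (Suc b) j a) + scale 2 (econv_shift (Suc b) j a)"
    unfolding Suc sum.distrib act_scale scale_sum_right[symmetric] E_econv_shift
    by (simp add: econv_shift_def)
  also have "\<dots> = scale (2 * of_nat (Suc (Suc b))) (econv_shift (Suc b) j a)"
  proof -
    have "2 * of_nat (Suc (Suc b)) = 2 * of_nat (Suc b) + (2 :: complex)" by simp
    then show ?thesis by (simp only: scale_left_distrib)
  qed
  finally show ?case .
qed

text \<open>Coefficients of \<open>(b + 1) e'(z) e(z)^b = (e(z)^(b+1))'\<close>.\<close>

lemma econv_deriv_eq: "scale (of_nat (Suc b)) (econv_deriv b a) = scale (of_nat (Suc a)) (T (Suc b) (Suc a))"
proof (induction b arbitrary: a)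
  case 0
  show ?case
    by (simp add: econv_deriv_def sum_atMost_last del: sum.atMost_Suc)
next
  case (Suc b)
  have 1: "scale (of_nat (Suc a)) (E i (T (Suc b) (Suc a - i)))
     = scale (of_nat i) (E i (T (Suc b) (Suc a - i))) + E i (scale (of_nat (Suc a - i)) (T (Suc b) (Suc a - i)))"
    if "i \<le> Suc a" for i
  proof -
    have "of_nat (Suc a) = of_nat i + (of_nat (Suc a - i) :: complex)"
      using that by (simp add: of_nat_diff)
    then show ?thesis by (simp only: act_scale scale_left_distrib)
  qed
  have 2: "E i (scale (of_nat (Suc a - i)) (T (Suc b) (Suc a - i)))
     = scale (of_nat (Suc b)) (E i (econv_deriv b (a - i)))" if "i \<le> a" for i
    using Suc[of "a - i"] that by (simp add: Suc_diff_le flip: act_scale)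
  have "scale (of_nat (Suc a)) (T (Suc (Suc b)) (Suc a))
     = (\<Sum>i\<le>Suc a. scale (of_nat i) (E i (T (Suc b) (Suc a - i))))
       + (\<Sum>i\<le>Suc a. E i (scale (of_nat (Suc a - i)) (T (Suc b) (Suc a - i))))"
    unfolding econv.simps(2)[of w "Suc b"] scale_sum_right sum.distrib[symmetric]
    by (intro sum.cong refl 1) auto
  also have "(\<Sum>i\<le>Suc a. scale (of_nat i) (E i (T (Suc b) (Suc a - i)))) = econv_deriv (Suc b) a"
    unfolding econv_deriv_def by (subst sum.atMost_Suc_shift) simp
  also have "(\<Sum>i\<le>Suc a. E i (scale (of_nat (Suc a - i)) (T (Suc b) (Suc a - i))))
      = (\<Sum>i\<le>a. scale (of_nat (Suc b)) (E i (econv_deriv b (a - i))))"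
    by (subst sum.atMost_Suc) (simp only: diff_self_eq_0 of_nat_0 scale_zero_left act_zero add_0_right,
        intro sum.cong refl 2, simp)
  also have "\<dots> = scale (of_nat (Suc b)) (econv_deriv (Suc b) a)"
    by (simp only: scale_sum_right[symmetric] E_econv_deriv)
  finally show ?case
    by (simp only: of_nat_Suc[of "Suc b"] scale_left_distrib scale_one)
qed

text \<open>Each factor \<open>e(z)\<close> met by \<open>f_1\<close> leaves a series in the
  \<open>h_i\<close>, which is bracketed with the remaining factors. In series form,
  \<open>f_1 e(z)^(b+1) w = - b (b + 1) e'(z) e(z)^(b-1) w\<close>; at \<open>b = 0\<close> the
  truncated \<open>b - 1\<close> comes with coefficient zero.\<close>

lemma Fo_econv: "Fo 1 (T (Suc b) a) = - scale (of_nat (Suc b * b)) (econv_deriv (b - 1) a)"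
proof (induction b arbitrary: a)
  case 0
  show ?case
    by (simp add: sum_atMost_last Fo_E Fo_w H_w)
next
  case (Suc b)
  have "Fo 1 (T (Suc (Suc b)) a)
     = (\<Sum>i\<le>a. E i (Fo 1 (T (Suc b) (a - i)))) - (\<Sum>i\<le>a. H (Suc i) (T (Suc b) (a - i)))"
    by (simp only: econv.simps(2)[of w "Suc b"] act_sum Fo_E sum_subtractf plus_1_eq_Suc)
  also have "(\<Sum>i\<le>a. H (Suc i) (T (Suc b) (a - i)))
      = scale (2 * of_nat (Suc b)) (\<Sum>i\<le>a. \<Sum>l\<le>a - i. E (Suc (i + l)) (T b (a - (i + l))))"
    by (simp add: H_econv econv_shift_def scale_sum_right add.commute del: econv.simps)
  also have "(\<Sum>i\<le>a. \<Sum>l\<le>a - i. E (Suc (i + l)) (T b (a - (i + l)))) = econv_deriv b a"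
    using sum_triangle_diagonal[where a = a and g = "\<lambda>s. E (Suc s) (T b (a - s))"] by (simp only: econv_deriv_def)
  also have "(\<Sum>i\<le>a. E i (Fo 1 (T (Suc b) (a - i)))) = - scale (of_nat (Suc b * b)) (econv_deriv b a)"
  proof (cases b)
    case 0
    have "Fo 1 (T (Suc 0) c) = 0" for c using Suc[of c] 0 by (simp del: econv.simps)
    then show ?thesis using 0 by (simp del: econv.simps)
  next
    case (Suc b')
    have "(\<Sum>i\<le>a. E i (Fo 1 (T (Suc b) (a - i))))
       = - scale (of_nat (Suc b * b)) (\<Sum>i\<le>a. E i (econv_deriv b' (a - i)))"
      unfolding Suc.IH using Suc by (simp add: act_uminus act_scale sum_negf scale_sum_right)
    then show ?thesis unfolding E_econv_deriv using Suc by simp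
  qed
  also have "- scale (of_nat (Suc b * b)) (econv_deriv b a) - scale (2 * of_nat (Suc b)) (econv_deriv b a)
     = - scale (of_nat (Suc (Suc b) * Suc b)) (econv_deriv (Suc b - 1) a)"
  proof -
    have "(of_nat (Suc (Suc b) * Suc b) :: complex) = of_nat (Suc b * b) + 2 * of_nat (Suc b)"
      by (simp add: algebra_simps)
    then show ?thesis by (simp only: scale_left_distrib diff_Suc_1 minus_add_distrib diff_conv_add_uminus)
  qed
  finally show ?case .
qed

text \<open>\<open>f_1\<close> leads from the coefficient of \<open>z ^ a\<close> in
  \<open>e(z)^(b+1)\<close> to that of \<open>z ^ (a+1)\<close> in \<open>e(z)^b\<close>, preserving
  the sum of the two exponents. The numerical factors are nonzero for \<open>b > 0\<close>.\<close>

lemma econv_eq_0: "Suc n \<le> a + b \<Longrightarrow> T b a = 0"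
proof (induction a arbitrary: b)
  case 0
  have "T b 0 = foldr E (replicate b 0) w" for b by (induction b) auto
  moreover have "foldr E (replicate b 0) w = foldr E (replicate (b - Suc n) 0 @ replicate (Suc n) 0) w"
    using 0 by (simp only: replicate_add[symmetric] le_add_diff_inverse2 add_0_left)
  moreover have "foldr E es 0 = 0" for es by (induction es) auto
  ultimately show ?case by (simp only: foldr_append o_def E_0_w)
next
  case (Suc a)
  show ?case
  proof (cases b)
    case 0 then show ?thesis by simp
  next
    case b: (Suc b')
    have "T (Suc b) a = 0" using Suc by (simp del: econv.simps)
    then have "Fo 1 (T (Suc b) a) = 0" by (simp only: act_zero)
    then have "econv_deriv b' a = 0"
      unfolding Fo_econv using b by (simp del: of_nat_Suc of_nat_mult)
    then have "scale (of_nat (Suc a)) (T b (Suc a)) = 0"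
      using econv_deriv_eq[of b' a] b by simp
    then show ?thesis by (simp del: of_nat_Suc econv.simps)
  qed
qed

end

section \<open>Polynomials in the t-indices and permutations of their variables\<close>

lemma mset_map_upt: "mset (map f [a..<b]) = image_mset f (mset_set {a..<b})"
  by simp

abbreviation xmon :: "(nat \<Rightarrow>\<^sub>0 nat) \<Rightarrow> mpol" where
  "xmon \<alpha> \<equiv> single \<alpha> 1"

lemma xmon_mult: "xmon \<alpha> * xmon \<beta> = xmon (\<alpha> + \<beta>)"
  by (simp add: mult_single)

lemma var_power: "var i ^ j = xmon (single i j)"
  by (induction j) (auto simp: var_def mult_single simp flip: single_add)

text \<open>Renaming of variables: the exponent of $x_i$ becomes that of $x_{\sigma(i)}$.\<close>

definition ren :: "(nat \<Rightarrow> nat) \<Rightarrow> mpol \<Rightarrow> mpol" where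
  "ren \<sigma> = pm.linext (\<lambda>\<alpha>. xmon (Poly_Mapping.map_key \<sigma> \<alpha>))"

lemma lookup_map_key: "inj \<sigma> \<Longrightarrow> lookup (Poly_Mapping.map_key \<sigma> \<alpha>) i = lookup \<alpha> (\<sigma> i)"
  by (simp add: map_key.rep_eq)

lemma ren_mult: "inj \<sigma> \<Longrightarrow> ren \<sigma> (p * q) = ren \<sigma> p * ren \<sigma> q"
  unfolding ren_def by (rule pm_linext_mult) (simp add: map_key_plus mult_single)

lemma ren_simps: "ren \<sigma> (p + q) = ren \<sigma> p + ren \<sigma> q" "ren \<sigma> (p - q) = ren \<sigma> p - ren \<sigma> q"
  "ren \<sigma> (- p) = - ren \<sigma> p" "ren \<sigma> (cscale c p) = cscale c (ren \<sigma> p)"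
  "ren \<sigma> (sum f A) = (\<Sum>a\<in>A. ren \<sigma> (f a))" "ren \<sigma> 0 = 0"
  by (simp_all add: ren_def pm.linext_add pm.linext_diff pm.linext_cscale pm.linext_sum pm.linext_uminus)

lemma ren_xmon: "ren \<sigma> (xmon \<alpha>) = xmon (Poly_Mapping.map_key \<sigma> \<alpha>)"
  by (simp add: ren_def)

lemma ren_1 [simp]: "inj \<sigma> \<Longrightarrow> ren \<sigma> 1 = 1"
  unfolding single_one[symmetric] ren_xmon by (simp add: map_key_zero)

lemma ren_power: "inj \<sigma> \<Longrightarrow> ren \<sigma> (p ^ m) = ren \<sigma> p ^ m"
  by (induction m) (auto simp: ren_mult)

lemma ren_var:
  assumes "bij \<sigma>"
  shows "ren \<sigma> (var (\<sigma> i)) = var i"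
  unfolding var_def ren_xmon using map_key_single[of \<sigma> i 1] assms by (simp add: bij_is_inj)

lemma ren_prod: "inj \<sigma> \<Longrightarrow> ren \<sigma> (prod f A) = (\<Prod>a\<in>A. ren \<sigma> (f a))"
  by (induction A rule: infinite_finite_induct) (auto simp: ren_mult)

lemma ren_esf:
  assumes \<sigma>: "bij \<sigma>" "\<sigma> ` A = A"
  shows "ren \<sigma> (esf A j) = esf A j"
proof -
  have inj: "inj \<sigma>" using \<sigma>(1) by (rule bij_is_inj)
  have sgn: "ren \<sigma> ((- 1) ^ j) = (- 1) ^ j"
    using inj by (simp add: ren_power ren_simps)
  have "ren \<sigma> (\<Sum>S | S \<subseteq> A \<and> card S = j. \<Prod>i\<in>S. var i)
      = (\<Sum>S | S \<subseteq> A \<and> card S = j. \<Prod>i\<in>S. ren \<sigma> (var i))"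
    using inj by (simp add: ren_simps ren_prod)
  also have "\<dots> = (\<Sum>S | S \<subseteq> A \<and> card S = j. \<Prod>i\<in>\<sigma> ` S. ren \<sigma> (var i))"
  proof (rule sum.reindex_bij_witness[of _ "\<lambda>S. \<sigma> ` S" "\<lambda>S. inv \<sigma> ` S"])
    fix S assume S: "S \<in> {S. S \<subseteq> A \<and> card S = j}"
    show "\<sigma> ` inv \<sigma> ` S = S" using \<sigma>(1) by (simp add: image_f_inv_f bij_is_surj)
    have "inv \<sigma> ` A = A" using \<sigma> by (metis bij_is_inj image_inv_f_f)
    moreover have "card (inv \<sigma> ` S) = card S"
      using \<sigma>(1) by (intro card_image inj_on_subset[OF bij_is_inj[OF bij_imp_bij_inv]]) auto
    ultimately show "inv \<sigma> ` S \<in> {S. S \<subseteq> A \<and> card S = j}" using S by auto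
    show "(\<Prod>i\<in>\<sigma> ` inv \<sigma> ` S. ren \<sigma> (var i)) = (\<Prod>i\<in>S. ren \<sigma> (var i))"
      using \<sigma>(1) by (simp add: image_f_inv_f bij_is_surj)
  next
    fix S assume S: "S \<in> {S. S \<subseteq> A \<and> card S = j}"
    show "inv \<sigma> ` \<sigma> ` S = S" using inj by (simp add: image_inv_f_f)
    show "\<sigma> ` S \<in> {S. S \<subseteq> A \<and> card S = j}"
      using S \<sigma>(2) card_image[OF inj_on_subset[OF inj], of S] by auto
  qed
  also have "\<dots> = (\<Sum>S | S \<subseteq> A \<and> card S = j. \<Prod>i\<in>S. var i)"
    using inj \<sigma>(1) by (intro sum.cong refl, subst prod.reindex) (auto simp: ren_var inj_on_def)
  finally show ?thesis using inj by (simp add: esf_def ren_mult sgn)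
qed

lemma ren_hseq:
  assumes "inj \<sigma>" "\<And>j. ren \<sigma> (c j) = c j"
  shows "ren \<sigma> (hseq c k m) = hseq c k m"
proof (induction m rule: less_induct)
  case (less m)
  show ?case
  proof (cases "m = 0")
    case False
    then have "0 < m" by simp
    then show ?thesis
      using assms less unfolding hseq_pos[OF \<open>0 < m\<close>] by (simp add: ren_simps ren_mult)
  next
    case True then show ?thesis using assms by simp
  qed
qed

lemma ren_csf: "bij \<sigma> \<Longrightarrow> \<sigma> ` A = A \<Longrightarrow> ren \<sigma> (csf A m) = csf A m"
  unfolding csf_def by (intro ren_hseq ren_esf bij_is_inj)

lemma ren_cmon: "inj \<sigma> \<Longrightarrow> (\<And>j. ren \<sigma> (c j) = c j) \<Longrightarrow> ren \<sigma> (cmon c a) = cmon c a"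
  by (induction a) (auto simp: ren_mult ren_power)

lemma bij_transpose: "bij (Transposition.transpose i j)"
  by (simp add: bij_betw_def)

lemma transpose_image: "i \<in> A \<Longrightarrow> j \<in> A \<Longrightarrow> Transposition.transpose i j ` A = A"
  by (intro permutes_image permutes_swap_id)

section \<open>The PBW filtration in a module and the encoding of its vectors\<close>

context weyl_rep
begin

primrec filt :: "nat \<Rightarrow> 'a set" where
  "filt 0 = span {w}"
| "filt (Suc s) = span (filt s \<union> {act y i v |y i v. y \<in> {Osp_e, Osp_gp} \<and> v \<in> filt s})"

definition filt_below :: "nat \<Rightarrow> 'a set" where
  "filt_below s = (case s of 0 \<Rightarrow> {0} | Suc s' \<Rightarrow> filt s')"

lemma subspace_filt: "subspace (filt s)"
  by (cases s) auto

lemma subspace_filt_below: "subspace (filt_below s)"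
proof (cases s)
  case 0 then show ?thesis by (simp add: filt_below_def subspace_def)
next
  case (Suc t) then show ?thesis by (simp add: filt_below_def subspace_filt)
qed

lemma filt_Suc: "v \<in> filt s \<Longrightarrow> v \<in> filt (Suc s)"
  by (auto intro: span_base)

lemma filt_E: "v \<in> filt s \<Longrightarrow> E i v \<in> filt (Suc s)"
  by (auto intro!: span_base)

lemma filt_G: "v \<in> filt s \<Longrightarrow> G i v \<in> filt (Suc s)"
  by (auto intro!: span_base)

declare filt.simps(2) [simp del]

lemma filt_mono: "s \<le> t \<Longrightarrow> v \<in> filt s \<Longrightarrow> v \<in> filt t"
  by (induction t rule: dec_induct) (auto intro: filt_Suc)

lemma filt_foldr_E: "v \<in> filt s \<Longrightarrow> foldr E es v \<in> filt (length es + s)"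
  by (induction es) (auto intro: filt_E)

lemma filt_foldr_G: "v \<in> filt s \<Longrightarrow> foldr G es v \<in> filt (length es + s)"
  by (induction es) (auto intro: filt_G)

lemma w_filt: "w \<in> filt 0"
  by (simp add: span_base)

lemma filt_stable_aux:
  assumes "\<And>y i v. y \<in> {Osp_e, Osp_gp} \<Longrightarrow> v \<in> filt s \<Longrightarrow> act z j (act y i v) \<in> filt (Suc s)"
    and "\<And>v. v \<in> filt s \<Longrightarrow> act z j v \<in> filt s" and "v \<in> filt (Suc s)"
  shows "act z j v \<in> filt (Suc s)"
  using assms(3) unfolding filt.simps(2)[of s]
proof (induction rule: span_induct_alt)
  case base then show ?case by (simp add: span_zero)
next
  case (step c x y)
  have "act z j x \<in> filt (Suc s)"
    using step(1) assms(1) assms(2)[THEN filt_Suc] by blast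
  then show ?case using step(2) unfolding filt.simps(2)[of s]
    by (simp add: act_add act_scale span_add span_scale)
qed

text \<open>The bracket of \<open>h_j\<close> with a raising operator is again a raising operator,
  so the number of factors does not grow.\<close>

lemma filt_H: "v \<in> filt s \<Longrightarrow> H j v \<in> filt s"
proof (induction s arbitrary: v)
  case 0
  have "H j w \<in> span {w}"
    using H_w[of j] H_0_w by (cases "j = 0") (auto intro: span_neg span_scale span_base span_zero)
  from 0 show ?case unfolding filt.simps(1)
    by (induction rule: span_induct_alt)
      (auto simp: act_add act_scale span_zero intro!: span_add span_scale \<open>H j w \<in> span {w}\<close>)
next
  case (Suc s)
  show ?case
  proof (rule filt_stable_aux[OF _ Suc.IH Suc.prems])
    fix y i v assume y: "y \<in> {Osp_e, Osp_gp}" and v: "v \<in> filt s"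
    show "H j (act y i v) \<in> filt (Suc s)"
      using y filt_E[OF v] filt_E[OF Suc.IH[OF v]] filt_G[OF v] filt_G[OF Suc.IH[OF v]]
      by (auto simp: H_E H_G intro!: subspace_add[OF subspace_filt] subspace_scale[OF subspace_filt])
  qed
qed

lemma filt_Gm: "v \<in> filt s \<Longrightarrow> Gm j v \<in> filt s"
proof (induction s arbitrary: v)
  case 0
  from 0 show ?case unfolding filt.simps(1)
    by (induction rule: span_induct_alt)
      (auto simp: act_add act_scale span_zero Gm_w intro!: span_add span_scale)
next
  case (Suc s)
  show ?case
  proof (rule filt_stable_aux[OF _ Suc.IH Suc.prems])
    fix y i v assume y: "y \<in> {Osp_e, Osp_gp}" and v: "v \<in> filt s"
    show "Gm j (act y i v) \<in> filt (Suc s)"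
      using y filt_G[OF v] filt_E[OF Suc.IH[OF v]] filt_Suc[OF filt_H[OF v]] filt_G[OF Suc.IH[OF v]]
      by (auto simp: Gm_E Gm_G intro!: subspace_add[OF subspace_filt] subspace_diff[OF subspace_filt])
  qed
qed

text \<open>A \<open>g^-\<close> meeting a \<open>g^+\<close> turns it into an \<open>h\<close>,
  which preserves the filtration: one raising operator is lost.\<close>

lemma Gm_foldr_G: "Gm j (foldr G gs w) \<in> filt_below (length gs)"
proof (induction gs)
  case Nil then show ?case by (simp add: Gm_w filt_below_def)
next
  case (Cons g gs)
  have 1: "foldr G gs w \<in> filt (length gs)" using filt_foldr_G[OF w_filt, of gs] by simp
  have 2: "G g (Gm j (foldr G gs w)) \<in> filt (length gs)"
    using Cons by (cases gs) (auto simp: filt_below_def span_zero intro: filt_G)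
  show ?case
    using filt_H[OF 1] 2
    by (simp add: filt_below_def Gm_G subspace_diff[OF subspace_filt])
qed

definition gmon :: "nat \<Rightarrow> nat \<Rightarrow> (nat \<Rightarrow>\<^sub>0 nat) \<Rightarrow> 'a" where
  "gmon k r \<alpha> = mon w (map (lookup \<alpha>) [0..<k]) (map (lookup \<alpha>) [k..<k + r])"

text \<open>The encoding of vectors by polynomials: an exponent is the \<open>t\<close>-index of a raising operator, the first
  \<open>k\<close> variables standing for the \<open>e\<^sub>i\<close> and the next \<open>r\<close> for the $g^+_i$.\<close>

definition phi :: "nat \<Rightarrow> nat \<Rightarrow> mpol \<Rightarrow> 'a" where
  "phi k r = linext (gmon k r)"

lemma phi_simps: "phi k r (p + q) = phi k r p + phi k r q" "phi k r (p - q) = phi k r p - phi k r q"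
  "phi k r (cscale c p) = scale c (phi k r p)" "phi k r (sum f A) = (\<Sum>a\<in>A. phi k r (f a))"
  "phi k r 0 = 0" "phi k r (- p) = - phi k r p"
  by (simp_all add: phi_def linext_add linext_diff linext_cscale linext_sum linext_uminus)

lemma phi_xmon [simp]: "phi k r (xmon \<alpha>) = gmon k r \<alpha>"
  by (simp add: phi_def)

text \<open>To see that the operator \<open>D\<close> on polynomials models the operator
  \<open>A\<close> on vectors modulo \<open>U\<close>, monomials suffice.\<close>

lemma phi_linear_mem:
  assumes "subspace U" "\<And>\<alpha>. A (gmon k r \<alpha>) - phi k' r' (D \<alpha>) \<in> U"
    "\<And>u v. A (u + v) = A u + A v" "\<And>c v. A (scale c v) = scale c (A v)"
  shows "A (phi k r p) - phi k' r' (pm.linext D p) \<in> U"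
proof (induction p rule: pm_induct)
  case zero
  have "A 0 = 0" using assms(4)[of 0 0] by simp
  then show ?case by (simp add: phi_simps pm.linext_def subspace_0[OF assms(1)])
next
  case (single \<alpha> c)
  have "scale c (A (gmon k r \<alpha>) - phi k' r' (D \<alpha>)) \<in> U"
    by (intro subspace_scale assms)
  then show ?case
    by (simp add: phi_def assms(4) linext_cscale scale_right_diff_distrib)
next
  case (add p q)
  have "A (phi k r (p + q)) - phi k' r' (pm.linext D (p + q))
    = (A (phi k r p) - phi k' r' (pm.linext D p)) + (A (phi k r q) - phi k' r' (pm.linext D q))"
    by (simp add: phi_simps assms(3) pm.linext_add)
  then show ?case using subspace_add[OF assms(1) add] by simp
qed

lemma phi_ren:
  assumes "\<sigma> permutes {0..<k}"
  shows "phi k r (ren \<sigma> p) = phi k r p"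
proof -
  have inj: "inj \<sigma>" using assms by (rule permutes_inj)
  have gm: "gmon k r (Poly_Mapping.map_key \<sigma> \<alpha>) = gmon k r \<alpha>" for \<alpha>
  proof -
    have lk: "lookup (Poly_Mapping.map_key \<sigma> \<alpha>) = (\<lambda>i. lookup \<alpha> (\<sigma> i))"
      using inj by (intro ext) (rule lookup_map_key)
    have "mset (map (lookup (Poly_Mapping.map_key \<sigma> \<alpha>)) [0..<k])
        = image_mset (lookup \<alpha>) (image_mset \<sigma> (mset_set {0..<k}))"
      by (simp add: lk multiset.map_comp o_def)
    also have "image_mset \<sigma> (mset_set {0..<k}) = mset_set {0..<k}"
      using assms inj by (subst image_mset_mset_set) (auto simp: permutes_image inj_on_def)
    finally have 1: "mset (map (lookup (Poly_Mapping.map_key \<sigma> \<alpha>)) [0..<k]) = mset (map (lookup \<alpha>) [0..<k])"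
      by simp
    have 2: "map (lookup (Poly_Mapping.map_key \<sigma> \<alpha>)) [k..<k + r] = map (lookup \<alpha>) [k..<k + r]"
      using inj permutes_not_in[OF assms] by (simp add: lookup_map_key)
    show ?thesis unfolding gmon_def mon_def 2 by (rule foldr_E_mset[OF 1])
  qed
  have "pm.linext (\<lambda>\<alpha>. xmon (Poly_Mapping.map_key \<sigma> \<alpha>)) p = ren \<sigma> p"
    and "phi k r p - phi k r (pm.linext (\<lambda>\<alpha>. xmon (Poly_Mapping.map_key \<sigma> \<alpha>)) p) \<in> {0}"
    by (simp add: ren_def) (rule phi_linear_mem[where A = "\<lambda>v. v"]; simp add: gm subspace_def)
  then show ?thesis by simp
qed

lemma phi_ren_transpose: "i < k \<Longrightarrow> j < k \<Longrightarrow> phi k r (ren (Transposition.transpose i j) p) = phi k r p"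
  by (rule phi_ren) (auto intro: permutes_swap_id)

text \<open>\<open>g_a g_b + g_b g_a = 2 e_(a+b)\<close> has one raising operator in place of
  two.\<close>

lemma phi_ren_adjacent:
  assumes "k \<le> i" "Suc i < k + r"
  shows "phi k r p + phi k r (ren (Transposition.transpose i (Suc i)) p) \<in> filt_below (k + r)"
proof -
  let ?\<tau> = "Transposition.transpose i (Suc i)"
  have inj: "inj ?\<tau>" by (simp add: bij_is_inj)
  have key: "gmon k r \<alpha> - phi k r (- xmon (Poly_Mapping.map_key ?\<tau> \<alpha>)) \<in> filt_below (k + r)" for \<alpha>
  proof -
    define xs ys where "xs = map (lookup \<alpha>) [k..<i]" and "ys = map (lookup \<alpha>) [Suc (Suc i)..<k + r]"
    have upt: "[k..<k + r] = [k..<i] @ i # Suc i # [Suc (Suc i)..<k + r]"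
      using upt_add_eq_append[of k i "k + r - i"] assms by (simp add: upt_conv_Cons)
    have l1: "map (lookup \<alpha>) [k..<k + r] = xs @ lookup \<alpha> i # lookup \<alpha> (Suc i) # ys"
      unfolding upt by (simp add: xs_def ys_def)
    have l2: "map (lookup (Poly_Mapping.map_key ?\<tau> \<alpha>)) [k..<k + r] = xs @ lookup \<alpha> (Suc i) # lookup \<alpha> i # ys"
      unfolding upt xs_def ys_def by (auto simp: lookup_map_key[OF inj] transpose_def)
    have l3: "map (lookup (Poly_Mapping.map_key ?\<tau> \<alpha>)) [0..<k] = map (lookup \<alpha>) [0..<k]"
      using assms by (auto simp: lookup_map_key[OF inj] transpose_def)
    have len: "length xs + length ys + 2 = r" using assms by (simp add: xs_def ys_def)
    let ?u = "foldr G ys w"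
    have "foldr G (xs @ a # b # ys) w + foldr G (xs @ b # a # ys) w = foldr G xs (scale 2 (E (a + b) ?u))" for a b
      unfolding foldr_append by (simp add: foldr_G_add[symmetric] G_G[of a b])
    then have "gmon k r \<alpha> + gmon k r (Poly_Mapping.map_key ?\<tau> \<alpha>)
        = foldr E (map (lookup \<alpha>) [0..<k]) (foldr G xs (scale 2 (E (lookup \<alpha> i + lookup \<alpha> (Suc i)) ?u)))"
      unfolding gmon_def mon_def l1 l2 l3 by (simp only: foldr_E_add[symmetric])
    also have "\<dots> \<in> filt (k + (length xs + Suc (length ys)))"
    proof -
      have "scale 2 (E (lookup \<alpha> i + lookup \<alpha> (Suc i)) ?u) \<in> filt (Suc (length ys))"
        using filt_E[OF filt_foldr_G[OF w_filt, of ys]] by (simp add: subspace_scale[OF subspace_filt])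
      from filt_foldr_E[OF filt_foldr_G[OF this, of xs], of "map (lookup \<alpha>) [0..<k]"]
      show ?thesis by simp
    qed
    also have "filt (k + (length xs + Suc (length ys))) = filt_below (k + r)"
      unfolding filt_below_def len[symmetric] by simp
    finally show ?thesis by (simp add: phi_simps)
  qed
  have lin: "pm.linext (\<lambda>\<alpha>. - xmon (Poly_Mapping.map_key ?\<tau> \<alpha>)) p = - ren ?\<tau> p"
    by (induction p rule: pm_induct) (auto simp: pm.linext_add ren_simps, simp add: ren_def)
  have "phi k r p - phi k r (pm.linext (\<lambda>\<alpha>. - xmon (Poly_Mapping.map_key ?\<tau> \<alpha>)) p) \<in> filt_below (k + r)"
    by (rule phi_linear_mem[where A = "\<lambda>v. v", OF subspace_filt_below key]) auto
  then show ?thesis unfolding lin by (simp add: phi_simps)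
qed

section \<open>Complete symmetric functions act by zero modulo lower PBW degree\<close>

lemma foldr_E_zero: "foldr E es 0 = 0"
  by (induction es) auto

text \<open>The generating series of \<open>csf\<close> is a product of geometric series
  \<open>1 / (1 - x_i z)\<close>, and each of them encodes one factor \<open>e(z)\<close>. The
  variables from \<open>b\<close> on carry fixed exponents.\<close>

lemma phi_csf_econv:
  assumes "b \<le> N" "\<And>i. i < b \<Longrightarrow> lookup \<alpha> i = 0"
  shows "phi N 0 (xmon \<alpha> * csf {0..<b} m) = econv (foldr E (map (lookup \<alpha>) [b..<N]) w) b m"
  using assms
proof (induction b arbitrary: \<alpha> m)
  case 0
  have "csf {} m = (if m = 0 then 1 else 0)"
    by (cases "m = 0") (auto simp: csf_def hseq_pos)
  then show ?case by (simp add: phi_simps gmon_def mon_def)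
next
  case (Suc b)
  have ins: "{0..<Suc b} = insert b {0..<b}" by auto
  have step: "phi N 0 (xmon \<alpha> * (var b ^ i * csf {0..<b} (m - i)))
      = E i (econv (foldr E (map (lookup \<alpha>) [Suc b..<N]) w) b (m - i))" for i
  proof -
    have 1: "xmon \<alpha> * (var b ^ i * csf {0..<b} (m - i)) = xmon (\<alpha> + single b i) * csf {0..<b} (m - i)"
      by (simp only: var_power mult.assoc[symmetric] xmon_mult)
    have 2: "map (lookup (\<alpha> + single b i)) [b..<N] = i # map (lookup \<alpha>) [Suc b..<N]"
      using Suc.prems by (subst upt_conv_Cons) (auto simp: lookup_add lookup_single)
    have 3: "phi N 0 (xmon (\<alpha> + single b i) * csf {0..<b} (m - i))
        = econv (foldr E (map (lookup (\<alpha> + single b i)) [b..<N]) w) b (m - i)"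
      using Suc.prems by (intro Suc.IH) (auto simp: lookup_add lookup_single)
    show ?thesis unfolding 1 3 2 by (simp add: econv_E)
  qed
  have "phi N 0 (xmon \<alpha> * csf {0..<Suc b} m)
      = (\<Sum>i\<le>m. phi N 0 (xmon \<alpha> * (var b ^ i * csf {0..<b} (m - i))))"
    unfolding ins by (subst csf_insert) (simp_all add: sum_distrib_left phi_simps)
  then show ?case unfolding step by simp
qed

text \<open>Each bracket \<open>[h_j, e_i] = 2 e_(i+j)\<close> raises one exponent by
  \<open>j\<close>, and \<open>h_j w = 0\<close>; so \<open>h_j\<close> acts as twice a power
  sum.\<close>

lemma H_phi:
  assumes "j \<ge> 1"
  shows "H j (phi N 0 p) = phi N 0 (\<Sum>i\<in>{0..<N}. cscale 2 (var i ^ j * p))"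
proof -
  have key: "H j (gmon N 0 \<alpha>) - phi N 0 (\<Sum>i\<in>{0..<N}. cscale 2 (var i ^ j * xmon \<alpha>)) \<in> {0}" for \<alpha>
  proof -
    let ?es = "map (lookup \<alpha>) [0..<N]"
    have "map (lookup (single i j + \<alpha>)) [0..<N] = ?es[i := ?es ! i + j]" if "i < N" for i
      using that by (intro nth_equalityI) (auto simp: lookup_add lookup_single nth_list_update)
    then show ?thesis
      unfolding phi_simps var_power xmon_mult phi_xmon gmon_def mon_def
      using assms by (auto simp: H_foldr_E H_w foldr_E_zero foldr_E_scale lessThan_atLeast0 intro!: sum.cong)
  qed
  have lin: "pm.linext (\<lambda>\<alpha>. \<Sum>i\<in>{0..<N}. cscale 2 (var i ^ j * xmon \<alpha>)) p
      = (\<Sum>i\<in>{0..<N}. cscale 2 (var i ^ j * p))"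
  proof (induction p rule: pm_induct)
    case (single a c)
    have "single a c = cscale c (xmon a)" by simp
    then show ?case by (simp only: pm.linext_cscale pm.linext_single)
      (simp only: pm.scale_sum_right cscale_mult_right pm.scale_left_commute pm.scale_one)
  qed (auto simp: pm.linext_add distrib_left pm.scale_right_distrib sum.distrib)
  have "H j (phi N 0 p) - phi N 0 (pm.linext (\<lambda>\<alpha>. \<Sum>i\<in>{0..<N}. cscale 2 (var i ^ j * xmon \<alpha>)) p) \<in> {0}"
    by (rule phi_linear_mem[where A = "H j", OF _ key]) (auto simp: act_add act_scale subspace_def)
  then show ?thesis unfolding lin by simp
qed

text \<open>Induction on the number of variables occurring in \<alpha>; with none it is
  \<open>econv_eq_0\<close>. Otherwise one variable, of exponent \<open>j\<close>, is removed and
  \<open>h_j\<close> is applied. The power sum puts \<open>x_i ^ j\<close> either on a variable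
  still present, a case with fewer variables, or on an absent one, and by symmetry all the latter
  give the same vector.\<close>

lemma phi_csf_eq_0:
  assumes "Suc n \<le> m + N"
  shows "phi N 0 (xmon \<alpha> * csf {0..<N} m) = 0"
proof (induction "card {i. i < N \<and> lookup \<alpha> i \<noteq> 0}" arbitrary: \<alpha>)
  case 0
  then have z: "\<And>i. i < N \<Longrightarrow> lookup \<alpha> i = 0" by auto
  show ?case using phi_csf_econv[of N N \<alpha> m] z econv_eq_0[of m N] assms by simp
next
  case (Suc s)
  then obtain i0 where i0: "i0 < N" "lookup \<alpha> i0 \<noteq> 0"
    by (metis (mono_tags, lifting) Collect_empty_eq card.empty nat.distinct(1))
  define j where "j = lookup \<alpha> i0"
  define \<alpha>' where "\<alpha>' = \<alpha> - single i0 j"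
  have l': "lookup \<alpha>' i = (if i = i0 then 0 else lookup \<alpha> i)" for i
    by (simp add: \<alpha>'_def lookup_minus lookup_single j_def)
  have \<alpha>: "\<alpha> = \<alpha>' + single i0 j"
    by (intro poly_mapping_eqI) (simp add: lookup_add lookup_single l' j_def)
  let ?A = "{i. i < N \<and> lookup \<alpha> i \<noteq> 0}"
  have supp: "{i. i < N \<and> lookup \<alpha>' i \<noteq> 0} = ?A - {i0}" by (auto simp: l')
  have s: "s = card (?A - {i0})" using Suc.hyps(2) i0 by simp
  define P where "P i = phi N 0 (xmon (\<alpha>' + single i j) * csf {0..<N} m)" for i
  have P: "phi N 0 (var i ^ j * (xmon \<alpha>' * csf {0..<N} m)) = P i" for i
    unfolding P_def by (simp only: var_power mult.assoc[symmetric] xmon_mult add.commute)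
  have "phi N 0 (xmon \<alpha>' * csf {0..<N} m) = 0"
    using s supp by (intro Suc.hyps(1)) simp
  then have "0 = H j (phi N 0 (xmon \<alpha>' * csf {0..<N} m))" by simp
  also have "\<dots> = scale 2 (\<Sum>i\<in>{0..<N}. P i)"
    using i0 by (subst H_phi) (simp add: j_def, simp only: phi_simps P scale_sum_right)
  finally have sum0: "(\<Sum>i\<in>{0..<N}. P i) = 0" by simp
  have P1: "P i = 0" if "i < N" "lookup \<alpha>' i \<noteq> 0" for i
  proof -
    have "{l. l < N \<and> lookup (\<alpha>' + single i j) l \<noteq> 0} = ?A - {i0}"
      using that i0 by (auto simp: lookup_add lookup_single l' when_def)
    then show ?thesis unfolding P_def using s by (intro Suc.hyps(1)) simp
  qed
  have P2: "P i = P i0" if "i < N" "lookup \<alpha>' i = 0" for i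
  proof -
    let ?\<tau> = "Transposition.transpose i i0"
    have inj: "inj ?\<tau>" by (simp add: bij_is_inj)
    have "Poly_Mapping.map_key ?\<tau> (\<alpha>' + single i j) = \<alpha>' + single i0 j"
      using that by (intro poly_mapping_eqI)
        (auto simp: lookup_map_key[OF inj] lookup_add lookup_single l' when_def transpose_def)
    then have "ren ?\<tau> (xmon (\<alpha>' + single i j) * csf {0..<N} m) = xmon (\<alpha>' + single i0 j) * csf {0..<N} m"
      using that i0 by (simp add: ren_mult[OF inj] ren_xmon ren_csf transpose_image)
    then show ?thesis unfolding P_def using phi_ren_transpose[OF that(1) i0(1)] by metis
  qed
  have "(\<Sum>i\<in>{0..<N}. P i) = (\<Sum>i\<in>{i\<in>{0..<N}. lookup \<alpha>' i = 0}. P i0)"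
  proof -
    have "(\<Sum>i\<in>{0..<N}. P i) = (\<Sum>i\<in>{0..<N}. if lookup \<alpha>' i = 0 then P i0 else 0)"
    proof (rule sum.cong[OF refl])
      fix i assume "i \<in> {0..<N}"
      then have "i < N" by simp
      show "P i = (if lookup \<alpha>' i = 0 then P i0 else 0)"
      proof (cases "lookup \<alpha>' i = 0")
        case True then show ?thesis unfolding if_P[OF True] by (rule P2[OF \<open>i < N\<close>])
      next
        case False then show ?thesis unfolding if_not_P[OF False] by (rule P1[OF \<open>i < N\<close>])
      qed
    qed
    also have "\<dots> = (\<Sum>i\<in>{i\<in>{0..<N}. lookup \<alpha>' i = 0}. P i0)"
      by (rule sum.inter_filter[symmetric]) simp
    finally show ?thesis .
  qed
  also have "\<dots> = scale (of_nat (card {i\<in>{0..<N}. lookup \<alpha>' i = 0})) (P i0)"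
    by (rule sum_constant_nat_scale) simp
  finally have "scale (of_nat (card {i\<in>{0..<N}. lookup \<alpha>' i = 0})) (P i0) = 0" using sum0 by simp
  moreover have "card {i\<in>{0..<N}. lookup \<alpha>' i = 0} \<noteq> 0"
    using i0 by (auto simp: l')
  ultimately have "P i0 = 0" by (simp only: scale_eq_0_iff of_nat_eq_0_iff) simp
  then show ?case unfolding P_def \<alpha>[symmetric] .
qed

text \<open>\<open>g^-_j\<close> turns one \<open>e_i\<close> into \<open>g^+_(i+j)\<close>. In the
  encoding a transposition moves the exponent concerned to variable \<open>k\<close>, now the first
  odd one, where it is raised by \<open>j\<close>. The term in which \<open>g^-_j\<close> passes on
  to the odd operators loses PBW degree.\<close>

lemma Gm_gmon:
  "Gm j (gmon (Suc k) r \<alpha>)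
    - phi k (Suc r) (\<Sum>a\<in>{0..k}. var k ^ j * ren (Transposition.transpose a k) (xmon \<alpha>)) \<in> filt (k + r)"
proof -
  let ?es = "map (lookup \<alpha>) [0..<Suc k]" and ?gs = "map (lookup \<alpha>) [Suc k..<Suc k + r]"
  have "foldr E (take a ?es @ drop (Suc a) ?es) (G (?es ! a + j) (foldr G ?gs w))
      = phi k (Suc r) (var k ^ j * ren (Transposition.transpose a k) (xmon \<alpha>))" if a: "a \<le> k" for a
  proof -
    let ?\<tau> = "Transposition.transpose a k"
    have inj: "inj ?\<tau>" by (simp add: bij_is_inj)
    let ?\<beta> = "single k j + Poly_Mapping.map_key ?\<tau> \<alpha>"
    have lb: "lookup ?\<beta> i = (if i = k then lookup \<alpha> a + j else if i = a then lookup \<alpha> k else lookup \<alpha> i)" for i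
      by (auto simp: lookup_add lookup_single lookup_map_key[OF inj] transpose_def when_def)
    have 1: "map (lookup ?\<beta>) [k..<k + Suc r] = (?es ! a + j) # ?gs"
      using a by (subst upt_conv_Cons) (auto simp: lb nth_append)
    have "mset ?es = add_mset (lookup \<alpha> a) (mset (take a ?es @ drop (Suc a) ?es))"
    proof -
      have "?es = take a ?es @ ?es ! a # drop (Suc a) ?es" using a by (intro id_take_nth_drop) simp
      then have "mset ?es = mset (take a ?es @ ?es ! a # drop (Suc a) ?es)" by metis
      moreover have "?es ! a = lookup \<alpha> a" using a by (simp add: nth_append del: upt_Suc)
      ultimately show ?thesis by (simp del: upt_Suc)
    qed
    moreover have "mset ?es = add_mset (lookup \<alpha> a) (mset (map (lookup ?\<beta>) [0..<k]))"
    proof -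
      have "mset (map (lookup ?\<beta>) [0..<Suc k]) + {#lookup \<alpha> a#} = mset (map (lookup \<alpha>) [0..<Suc k]) + {#lookup \<alpha> a + j#}"
      proof -
        have "image_mset (\<lambda>i. lookup \<alpha> (?\<tau> i)) (mset_set {0..<Suc k}) = image_mset (lookup \<alpha>) (image_mset ?\<tau> (mset_set {0..<Suc k}))"
          by (simp add: multiset.map_comp o_def)
        also have "image_mset ?\<tau> (mset_set {0..<Suc k}) = mset_set {0..<Suc k}"
          using a by (subst image_mset_mset_set) (auto simp: transpose_image intro: inj_on_subset[OF inj])
        finally have 3: "image_mset (\<lambda>i. lookup \<alpha> (?\<tau> i)) (mset_set {0..<Suc k}) = image_mset (lookup \<alpha>) (mset_set {0..<Suc k})" .
        have "mset (map (lookup ?\<beta>) [0..<k]) = mset (map (\<lambda>i. lookup \<alpha> (?\<tau> i)) [0..<k])"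
          by (intro arg_cong[where f = mset] map_cong refl) (auto simp: lb transpose_def)
        moreover have "?\<tau> k = a" by simp
        ultimately show ?thesis using 3 by (simp add: lb atLeast0_lessThan_Suc)
      qed
      then show ?thesis by (simp add: lb)
    qed
    ultimately have "mset (take a ?es @ drop (Suc a) ?es) = mset (map (lookup ?\<beta>) [0..<k])"
      by (metis add_mset_remove_trivial)
    from foldr_E_mset[OF this]
    have "foldr E (take a ?es @ drop (Suc a) ?es) (G (?es ! a + j) (foldr G ?gs w)) = gmon k (Suc r) ?\<beta>"
      unfolding gmon_def mon_def 1 by simp
    also have "\<dots> = phi k (Suc r) (var k ^ j * ren ?\<tau> (xmon \<alpha>))"
      by (simp only: ren_xmon var_power xmon_mult phi_xmon)
    finally show ?thesis .
  qed
  then have "(\<Sum>a<length ?es. foldr E (take a ?es @ drop (Suc a) ?es) (G (?es ! a + j) (foldr G ?gs w)))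
      = phi k (Suc r) (\<Sum>a\<in>{0..k}. var k ^ j * ren (Transposition.transpose a k) (xmon \<alpha>))"
    unfolding phi_simps by (intro sum.cong) auto
  then have "Gm j (gmon (Suc k) r \<alpha>)
      - phi k (Suc r) (\<Sum>a\<in>{0..k}. var k ^ j * ren (Transposition.transpose a k) (xmon \<alpha>))
    = foldr E ?es (Gm j (foldr G ?gs w))"
    unfolding gmon_def mon_def by (simp only: Gm_foldr_E add_diff_cancel_right')
  also have "\<dots> \<in> filt (k + r)"
  proof (cases r)
    case 0
    then have "Gm j (foldr G ?gs w) = 0" using Gm_foldr_G[of j ?gs] by (simp add: filt_below_def)
    then show ?thesis by (simp only: foldr_E_zero subspace_0[OF subspace_filt])
  next
    case (Suc r')
    have "length ?gs = Suc r'" using Suc by (simp del: upt_Suc)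
    then have "Gm j (foldr G ?gs w) \<in> filt r'"
      using Gm_foldr_G[of j ?gs] by (simp only: filt_below_def nat.case)
    from filt_foldr_E[OF this, of ?es] show ?thesis using Suc by simp
  qed
  finally show ?thesis .
qed

lemma Gm_phi:
  "Gm j (phi (Suc k) r p)
    - phi k (Suc r) (\<Sum>a\<in>{0..k}. var k ^ j * ren (Transposition.transpose a k) p) \<in> filt (k + r)"
proof -
  let ?D = "\<lambda>\<alpha>. \<Sum>a\<in>{0..k}. var k ^ j * ren (Transposition.transpose a k) (xmon \<alpha>)"
  have "pm.linext ?D p = (\<Sum>a\<in>{0..k}. var k ^ j * ren (Transposition.transpose a k) p)"
  proof (induction p rule: pm_induct)
    case (single a c)
    have "single a c = cscale c (xmon a)" by simp
    then show ?case by (simp only: pm.linext_cscale pm.linext_single)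
      (simp only: pm.scale_sum_right ren_simps cscale_mult_right pm.scale_one)
  qed (auto simp: pm.linext_add distrib_left ren_simps sum.distrib)
  moreover have "Gm j (phi (Suc k) r p) - phi k (Suc r) (pm.linext ?D p) \<in> filt (k + r)"
    by (rule phi_linear_mem[where A = "Gm j", OF subspace_filt Gm_gmon]) (auto simp: act_add act_scale)
  ultimately show ?thesis by simp
qed

text \<open>The relation for \<open>Suc k\<close> and \<open>r\<close> is carried to
  \<open>k\<close> and \<open>Suc r\<close> by \<open>g^-_j\<close>, where \<open>j\<close> is the
  exponent of the first odd variable, stripped from \<beta> beforehand. In the resulting sum the
  positions \<open>a\<close> with exponent zero in \<alpha> all give back \<beta>; the others leave
  fewer even variables with nonzero exponent and fall under the inner induction.\<close>

lemma phi_csf_filt_below: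
  assumes "Suc n \<le> m + (k + r)"
  shows "phi k r (xmon \<beta> * csf {0..<k + r} m) \<in> filt_below (k + r)"
  using assms
proof (induction r arbitrary: k \<beta>)
  case 0
  then show ?case using phi_csf_eq_0[of m k \<beta>] by (simp add: subspace_0[OF subspace_filt_below])
next
  case (Suc r)
  let ?h = "csf {0..<k + Suc r} m"
  have "phi k (Suc r) (xmon \<beta> * ?h) \<in> filt (k + r)" for \<beta>
  proof (induction "card {i. i < k \<and> lookup \<beta> i \<noteq> 0}" arbitrary: \<beta> rule: less_induct)
    case less
    define j where "j = lookup \<beta> k"
    define \<alpha> where "\<alpha> = \<beta> - single k j"
    have la: "lookup \<alpha> i = (if i = k then 0 else lookup \<beta> i)" for i
      by (simp add: \<alpha>_def lookup_minus lookup_single j_def)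
    define P where "P a = phi k (Suc r) (var k ^ j * ren (Transposition.transpose a k) (xmon \<alpha> * ?h))" for a
    have "phi (Suc k) r (xmon \<alpha> * ?h) \<in> filt (k + r)"
      using Suc.IH[of "Suc k" \<alpha>] Suc.prems by (simp add: filt_below_def)
    then have "Gm j (phi (Suc k) r (xmon \<alpha> * ?h)) \<in> filt (k + r)" by (rule filt_Gm)
    from subspace_diff[OF subspace_filt this Gm_phi[of j k r "xmon \<alpha> * ?h"]]
    have sumP: "(\<Sum>a\<in>{0..k}. P a) \<in> filt (k + r)"
      by (simp add: P_def phi_simps)
    have P: "P a = phi k (Suc r) (xmon (single k j + Poly_Mapping.map_key (Transposition.transpose a k) \<alpha>) * ?h)" if "a \<le> k" for a
    proof -
      have inj: "inj (Transposition.transpose a k)" by (simp add: bij_is_inj)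
      have "ren (Transposition.transpose a k) ?h = ?h"
        using that by (intro ren_csf transpose_image bij_transpose) auto
      then show ?thesis
        by (simp only: P_def ren_mult[OF inj] ren_xmon var_power mult.assoc[symmetric] xmon_mult)
    qed
    have exps: "lookup (single k j + Poly_Mapping.map_key (Transposition.transpose a k) \<alpha>) i
        = (if i = k then j + lookup \<alpha> a else if i = a then 0 else lookup \<beta> i)" for a i
    proof -
      have inj: "inj (Transposition.transpose a k)" by (simp add: bij_is_inj)
      show ?thesis
        by (auto simp: lookup_add lookup_single lookup_map_key[OF inj] transpose_def when_def la)
    qed
    let ?Z = "{a \<in> {0..k}. lookup \<alpha> a = 0}"
    have P1: "P a = phi k (Suc r) (xmon \<beta> * ?h)" if "a \<in> ?Z" for a
    proof -
      have "single k j + Poly_Mapping.map_key (Transposition.transpose a k) \<alpha> = \<beta>"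
        using that by (intro poly_mapping_eqI, unfold exps) (auto simp: la j_def split: if_splits)
      then show ?thesis using P[of a] that by simp
    qed
    have P2: "P a \<in> filt (k + r)" if a: "a \<in> {0..k} - ?Z" for a
    proof -
      have "a < k" "lookup \<beta> a \<noteq> 0" using a by (auto simp: la split: if_splits)
      then have "card {i. i < k \<and> lookup (single k j + Poly_Mapping.map_key (Transposition.transpose a k) \<alpha>) i \<noteq> 0}
          < card {i. i < k \<and> lookup \<beta> i \<noteq> 0}"
        by (intro psubset_card_mono) (auto simp: exps split: if_splits)
      from less[OF this] show ?thesis using P[of a] a by simp
    qed
    have "(\<Sum>a\<in>{0..k}. P a) = (\<Sum>a\<in>{0..k} - ?Z. P a) + (\<Sum>a\<in>?Z. P a)"
      by (rule sum.subset_diff) auto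
    then have split: "(\<Sum>a\<in>?Z. P a) = (\<Sum>a\<in>{0..k}. P a) - (\<Sum>a\<in>{0..k} - ?Z. P a)"
      by (simp only: add_diff_cancel_left')
    have "(\<Sum>a\<in>{0..k} - ?Z. P a) \<in> filt (k + r)"
      using P2 by (intro subspace_sum[OF subspace_filt])
    then have sumZ: "(\<Sum>a\<in>?Z. P a) \<in> filt (k + r)"
      unfolding split by (rule subspace_diff[OF subspace_filt sumP])
    moreover have "(\<Sum>a\<in>?Z. P a) = scale (of_nat (card ?Z)) (phi k (Suc r) (xmon \<beta> * ?h))"
    proof -
      have "(\<Sum>a\<in>?Z. P a) = (\<Sum>a\<in>?Z. phi k (Suc r) (xmon \<beta> * ?h))"
        by (intro sum.cong refl P1)
      then show ?thesis by (simp add: sum_constant_nat_scale)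
    qed
    ultimately have "scale (of_nat (card ?Z)) (phi k (Suc r) (xmon \<beta> * ?h)) \<in> filt (k + r)"
      using sumZ by (simp only:)
    from subspace_scale[OF subspace_filt this, of "inverse (of_nat (card ?Z))"]
    have "scale (inverse (of_nat (card ?Z))) (scale (of_nat (card ?Z)) (phi k (Suc r) (xmon \<beta> * ?h))) \<in> filt (k + r)" .
    moreover have "card ?Z \<noteq> 0" by (auto simp: la)
    ultimately show ?case by simp
  qed
  then show ?case by (simp add: filt_below_def)
qed

end

section \<open>Reduction of monomials to multiples of the staircase\<close>

lemma adjacent_swaps_move:
  assumes "\<And>xs a b ys. P (xs @ a # b # ys) \<Longrightarrow> P (xs @ b # a # ys)"
  shows "P (pre @ us @ y # vs) \<Longrightarrow> P (pre @ y # us @ vs)"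
proof (induction us arbitrary: vs rule: rev_induct)
  case (snoc u us)
  then have "P ((pre @ us) @ u # y # vs)" by simp
  then have "P ((pre @ us) @ y # u # vs)" by (rule assms)
  then show ?case using snoc.IH[of "u # vs"] by simp
qed simp

lemma adjacent_swaps_mset:
  assumes "\<And>xs a b ys. P (xs @ a # b # ys) \<Longrightarrow> P (xs @ b # a # ys)"
    and "mset xs = mset ys" "P xs"
  shows "P ys"
proof -
  have "mset xs = mset ys \<Longrightarrow> P (pre @ xs) \<Longrightarrow> P (pre @ ys)" for pre
  proof (induction ys arbitrary: xs pre)
    case (Cons y ys)
    then have "y \<in> set xs" by (metis list.set_intros(1) set_mset_mset)
    then obtain us vs where xs: "xs = us @ y # vs" by (meson split_list)
    have "P (pre @ y # us @ vs)" using Cons.prems(2) unfolding xs by (intro adjacent_swaps_move[of P, OF assms(1)]) auto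
    then show ?case using Cons.IH[of "us @ vs" "pre @ [y]"] Cons.prems(1) by (simp add: xs)
  qed simp
  from this[of "[]"] show ?thesis using assms by simp
qed

definition ind :: "nat set \<Rightarrow> (nat \<Rightarrow>\<^sub>0 nat)" where
  "ind S = (\<Sum>i\<in>S. single i 1)"

lemma lookup_ind: "finite S \<Longrightarrow> lookup (ind S) i = (if i \<in> S then 1 else 0)"
  by (simp add: ind_def lookup_sum lookup_single when_def)

lemma prod_var: "finite S \<Longrightarrow> (\<Prod>i\<in>S. var i) = xmon (ind S)"
  by (induction S rule: finite_induct) (auto simp: ind_def var_def mult_single single_one)

definition yexp :: "nat \<Rightarrow> nat list \<Rightarrow> (nat \<Rightarrow>\<^sub>0 nat)" where
  "yexp k gs = (\<Sum>i<length gs. single (k + i) (gs ! i))"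

lemma lookup_yexp: "lookup (yexp k gs) j = (if k \<le> j \<and> j < k + length gs then gs ! (j - k) else 0)"
proof (cases "k \<le> j \<and> j < k + length gs")
  case True
  then have "lookup (yexp k gs) j = (\<Sum>i<length gs. if i = j - k then gs ! i else 0)"
    unfolding yexp_def lookup_sum by (intro sum.cong) (auto simp: lookup_single when_def)
  then show ?thesis using True by auto
next
  case False
  then have "lookup (yexp k gs) j = 0"
    unfolding yexp_def lookup_sum by (intro sum.neutral) (auto simp: lookup_single when_def)
  then show ?thesis using False by auto
qed

text \<open>Exponents \<open>0, ..., r - 1\<close> on the odd variables, the diagonal term of a
  Vandermonde determinant: its antisymmetrization generates the antisymmetric polynomials over the
  symmetric ones.\<close>

definition ydelta :: "nat \<Rightarrow> nat \<Rightarrow> mpol" where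
  "ydelta k r = xmon (yexp k [0..<r])"

text \<open>By the fundamental theorem, the polynomials in the first \<open>k + r\<close> variables
  that are symmetric in each group. What enters below is closure under products and invariance under
  permutations within the groups.\<close>

definition symalg :: "nat \<Rightarrow> nat \<Rightarrow> mpol set" where
  "symalg k r = pm.span {cmon (esf {0..<k}) a * cmon (esf {k..<k + r}) b |a b. length a = k \<and> length b = r}"

lemma subspace_symalg: "pm.subspace (symalg k r)"
  by (simp add: symalg_def)

lemma symalg_cpol:
  assumes "p \<in> cpol (esf {0..<k}) k d" "q \<in> cpol (esf {k..<k + r}) r e"
  shows "p * q \<in> symalg k r"
  using assms(2) unfolding cpol_def[of _ r]
proof (rule pm_span_mult[OF _ subspace_symalg])
  fix s assume "s \<in> {cmon (esf {k..<k + r}) a |a. length a = r \<and> wsum a = e}"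
  then obtain b where b: "s = cmon (esf {k..<k + r}) b" "length b = r" by blast
  have "s * p \<in> symalg k r"
    using assms(1) unfolding cpol_def
  proof (rule pm_span_mult[OF _ subspace_symalg])
    fix t assume "t \<in> {cmon (esf {0..<k}) a |a. length a = k \<and> wsum a = d}"
    then obtain a where a: "t = cmon (esf {0..<k}) a" "length a = k" by blast
    show "s * t \<in> symalg k r"
      unfolding symalg_def a b using a b by (intro pm.span_base) (auto simp: mult.commute)
  qed
  then show "p * s \<in> symalg k r" by (simp add: mult.commute)
qed

lemma one_cpol: "1 \<in> cpol c k 0"
  using hseq_cpol[of c k 0] by simp

lemma symalg_1: "1 \<in> symalg k r"
  using symalg_cpol[OF one_cpol one_cpol] by simp

lemma esf_cpol: "finite A \<Longrightarrow> esf A j \<in> cpol (esf A) (card A) j"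
proof -
  assume A: "finite A"
  consider "j = 0" | "1 \<le> j" "j \<le> card A" | "card A < j" by linarith
  then show ?thesis
  proof cases
    case 1 then show ?thesis using A one_cpol by (simp add: esf_0)
  next
    case 2 then show ?thesis using cpol_mult_gen[OF one_cpol, of j "card A" "esf A"] by simp
  next
    case 3 then show ?thesis using A by (simp add: esf_eq_0 pm.subspace_0[OF subspace_cpol])
  qed
qed

lemma symalg_esf: "esf {0..<k} j \<in> symalg k r" "esf {k..<k + r} j \<in> symalg k r"
  using symalg_cpol[OF _ one_cpol, of "esf {0..<k} j" k j] symalg_cpol[OF one_cpol, of "esf {k..<k + r} j" k r j]
    esf_cpol[of "{0..<k}" j] esf_cpol[of "{k..<k + r}" j] by simp_all

lemma symalg_mult:
  assumes "p \<in> symalg k r" "q \<in> symalg k r"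
  shows "p * q \<in> symalg k r"
  using assms(2) unfolding symalg_def[of k r]
proof (rule pm_span_mult[OF _ subspace_symalg[unfolded symalg_def]], fold symalg_def)
  fix s assume "s \<in> {cmon (esf {0..<k}) a * cmon (esf {k..<k + r}) b |a b. length a = k \<and> length b = r}"
  then obtain a b where s: "s = cmon (esf {0..<k}) a * cmon (esf {k..<k + r}) b" "length a = k" "length b = r"
    by blast
  have "s * p \<in> symalg k r"
    using assms(1) unfolding symalg_def[of k r]
  proof (rule pm_span_mult[OF _ subspace_symalg[unfolded symalg_def]], fold symalg_def)
    fix t assume "t \<in> {cmon (esf {0..<k}) a * cmon (esf {k..<k + r}) b |a b. length a = k \<and> length b = r}"
    then obtain a' b' where t: "t = cmon (esf {0..<k}) a' * cmon (esf {k..<k + r}) b'" "length a' = k" "length b' = r"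
      by blast
    have "s * t = (cmon (esf {0..<k}) a * cmon (esf {0..<k}) a') * (cmon (esf {k..<k + r}) b * cmon (esf {k..<k + r}) b')"
      by (simp only: s t mult_ac)
    also have "\<dots> \<in> symalg k r"
      by (rule symalg_cpol[OF cpol_mult[OF cmon_cpol[OF s(2) refl] cmon_cpol[OF t(2) refl]]
            cpol_mult[OF cmon_cpol[OF s(3) refl] cmon_cpol[OF t(3) refl]]])
    finally show "s * t \<in> symalg k r" .
  qed
  then show "p * s \<in> symalg k r" by (simp add: mult.commute)
qed

lemma symalg_ren:
  assumes "s \<in> symalg k r" "bij \<sigma>" "\<sigma> ` {0..<k} = {0..<k}" "\<sigma> ` {k..<k + r} = {k..<k + r}"
  shows "ren \<sigma> s = s"
  using assms(1) unfolding symalg_def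
proof (induction rule: pm_span_induct)
  case (scale_add c b y)
  then obtain a b' where "b = cmon (esf {0..<k}) a * cmon (esf {k..<k + r}) b'" by blast
  moreover have "inj \<sigma>" using assms(2) by (rule bij_is_inj)
  ultimately show ?case using scale_add(2) assms(2-4)
    by (simp add: ren_simps ren_mult ren_cmon ren_esf)
qed (simp add: ren_simps)

lemma transpose_image_notin: "i \<notin> A \<Longrightarrow> j \<notin> A \<Longrightarrow> Transposition.transpose i j ` A = A"
proof -
  assume "i \<notin> A" "j \<notin> A"
  then have "Transposition.transpose i j ` A = (\<lambda>x. x) ` A"
    by (intro image_cong) (auto simp: Transposition.transpose_def)
  then show ?thesis by simp
qed

lemma map_key_eqI: "inj \<sigma> \<Longrightarrow> (\<And>i. lookup \<beta> i = lookup \<alpha> (\<sigma> i)) \<Longrightarrow> \<beta> = Poly_Mapping.map_key \<sigma> \<alpha>"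
  by (intro poly_mapping_eqI) (simp add: lookup_map_key)

text \<open>The right side depends on \<open>S\<close> only through \<open>card S\<close>: sets of
  equal size containing \<open>Y\<close> lead to the same multiset of exponents.\<close>

lemma image_mset_shifted_indicator:
  assumes "finite A" "S \<subseteq> A" "Y \<subseteq> S" "\<And>i. i \<in> A - Y \<Longrightarrow> f i = 0"
  shows "image_mset (\<lambda>i. (if i \<in> S then 1 else 0) + f i) (mset_set A)
    = image_mset (\<lambda>i. 1 + f i) (mset_set Y) + replicate_mset (card S - card Y) 1
      + replicate_mset (card A - card S) (0::nat)"
proof -
  have fin: "finite S" "finite Y" using assms by (auto intro: finite_subset)
  have "A = Y \<union> (S - Y) \<union> (A - S)" using assms by auto
  then have "mset_set A = mset_set (Y \<union> (S - Y) \<union> (A - S))" by metis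
  also have "\<dots> = mset_set Y + mset_set (S - Y) + mset_set (A - S)"
  proof -
    have "mset_set (Y \<union> (S - Y) \<union> (A - S)) = mset_set (Y \<union> (S - Y)) + mset_set (A - S)"
      by (rule mset_set_Union) (use assms fin in auto)
    moreover have "mset_set (Y \<union> (S - Y)) = mset_set Y + mset_set (S - Y)"
      by (rule mset_set_Union) (use fin in auto)
    ultimately show ?thesis by simp
  qed
  finally have A: "mset_set A = mset_set Y + mset_set (S - Y) + mset_set (A - S)" .
  have "image_mset (\<lambda>i. (if i \<in> S then 1 else 0) + f i) (mset_set Y) = image_mset (\<lambda>i. 1 + f i) (mset_set Y)"
    using assms fin by (intro image_mset_cong) auto
  moreover have "image_mset (\<lambda>i. (if i \<in> S then 1 else 0) + f i) (mset_set (S - Y)) = image_mset (\<lambda>i. 1) (mset_set (S - Y))"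
    using assms fin by (intro image_mset_cong) auto
  moreover have "image_mset (\<lambda>i. (if i \<in> S then 1 else 0) + f i) (mset_set (A - S)) = image_mset (\<lambda>i. 0) (mset_set (A - S))"
    using assms fin by (intro image_mset_cong) auto
  ultimately show ?thesis
    using assms fin by (simp add: A image_mset_const_eq card_Diff_subset)
qed

context weyl_rep
begin

text \<open>Modulo lower PBW degree, \<open>p\<close> acts as a multiple of the staircase monomial, compatibly with
  multiplication by partially symmetric polynomials.\<close>

definition reducible :: "nat \<Rightarrow> nat \<Rightarrow> mpol \<Rightarrow> bool" where
  "reducible k r p \<longleftrightarrow> (\<exists>s\<in>symalg k r. \<forall>s'\<in>symalg k r. phi k r (s' * (p - s * ydelta k r)) \<in> filt_below (k + r))"

lemma reducible_zeroI: "(\<And>s'. s' \<in> symalg k r \<Longrightarrow> phi k r (s' * p) \<in> filt_below (k + r)) \<Longrightarrow> reducible k r p"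
  unfolding reducible_def by (intro bexI[of _ 0]) (auto simp: pm.subspace_0[OF subspace_symalg])

lemma reducible_add: "reducible k r p \<Longrightarrow> reducible k r q \<Longrightarrow> reducible k r (p + q)"
  unfolding reducible_def
proof (elim bexE)
  fix s t assume s: "s \<in> symalg k r" "\<forall>s'\<in>symalg k r. phi k r (s' * (p - s * ydelta k r)) \<in> filt_below (k + r)"
    and t: "t \<in> symalg k r" "\<forall>s'\<in>symalg k r. phi k r (s' * (q - t * ydelta k r)) \<in> filt_below (k + r)"
  show "\<exists>s\<in>symalg k r. \<forall>s'\<in>symalg k r. phi k r (s' * (p + q - s * ydelta k r)) \<in> filt_below (k + r)"
  proof (intro bexI ballI)
    show "s + t \<in> symalg k r" by (rule pm.subspace_add[OF subspace_symalg s(1) t(1)])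
    fix s' assume s': "s' \<in> symalg k r"
    have "s' * (p + q - (s + t) * ydelta k r) = s' * (p - s * ydelta k r) + s' * (q - t * ydelta k r)"
      by (simp add: algebra_simps)
    then show "phi k r (s' * (p + q - (s + t) * ydelta k r)) \<in> filt_below (k + r)"
      using s(2) t(2) s' by (simp add: phi_simps subspace_add[OF subspace_filt_below])
  qed
qed

lemma reducible_mult: "reducible k r p \<Longrightarrow> t \<in> symalg k r \<Longrightarrow> reducible k r (t * p)"
  unfolding reducible_def
proof (elim bexE)
  fix s assume t: "t \<in> symalg k r"
    and s: "s \<in> symalg k r" "\<forall>s'\<in>symalg k r. phi k r (s' * (p - s * ydelta k r)) \<in> filt_below (k + r)"
  show "\<exists>s\<in>symalg k r. \<forall>s'\<in>symalg k r. phi k r (s' * (t * p - s * ydelta k r)) \<in> filt_below (k + r)"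
  proof (intro bexI ballI)
    show "t * s \<in> symalg k r" by (rule symalg_mult[OF t s(1)])
    fix s' assume "s' \<in> symalg k r"
    then have "s' * t \<in> symalg k r" by (rule symalg_mult[OF _ t])
    moreover have eq: "s' * (t * p - t * s * ydelta k r) = s' * t * (p - s * ydelta k r)"
      by (simp add: algebra_simps)
    ultimately show "phi k r (s' * (t * p - t * s * ydelta k r)) \<in> filt_below (k + r)"
      unfolding eq using s(2) by blast
  qed
qed

lemma reducible_cscale: "reducible k r p \<Longrightarrow> reducible k r (cscale c p)"
  using reducible_mult[of k r p "cscale c 1"] pm.subspace_scale[OF subspace_symalg symalg_1, of c] by simp

lemma reducible_uminus: "reducible k r p \<Longrightarrow> reducible k r (- p)"
  using reducible_cscale[of k r p "-1"] by simp

lemma reducible_sum: "(\<And>i. i \<in> I \<Longrightarrow> reducible k r (f i)) \<Longrightarrow> reducible k r (sum f I)"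
proof (induction I rule: infinite_finite_induct)
  case (insert i I) then show ?case by (simp add: reducible_add)
qed (auto intro!: reducible_zeroI simp: phi_simps subspace_0[OF subspace_filt_below])

lemma reducible_cong:
  assumes "reducible k r p" "\<And>s'. s' \<in> symalg k r \<Longrightarrow> phi k r (s' * (q - p)) \<in> filt_below (k + r)"
  shows "reducible k r q"
  using reducible_add[OF assms(1) reducible_zeroI[OF assms(2)]] by simp

lemma reducible_adjacent_swap:
  assumes "length xs + 2 + length ys = r"
    and "reducible k r (xmon (yexp k (xs @ a # b # ys)))"
  shows "reducible k r (xmon (yexp k (xs @ b # a # ys)))"
proof -
  let ?i = "k + length xs" let ?\<tau> = "Transposition.transpose ?i (Suc ?i)"
  have inj: "inj ?\<tau>" by (simp add: bij_is_inj)
  have key: "yexp k (xs @ b # a # ys) = Poly_Mapping.map_key ?\<tau> (yexp k (xs @ a # b # ys))"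
  proof (rule map_key_eqI[OF inj])
    fix i
    consider "i = ?i" | "i = Suc ?i" | "i \<noteq> ?i" "i \<noteq> Suc ?i" by blast
    then show "lookup (yexp k (xs @ b # a # ys)) i = lookup (yexp k (xs @ a # b # ys)) (?\<tau> i)"
    proof cases
      case 3
      then show ?thesis by (auto simp: lookup_yexp nth_append nth_Cons' Transposition.transpose_def)
    qed (simp_all add: lookup_yexp nth_append)
  qed
  have "reducible k r (- xmon (yexp k (xs @ a # b # ys)))" using assms(2) by (rule reducible_uminus)
  then show ?thesis
  proof (rule reducible_cong)
    fix s' assume s': "s' \<in> symalg k r"
    let ?p = "s' * xmon (yexp k (xs @ a # b # ys))"
    have "ren ?\<tau> s' = s'"
      by (rule symalg_ren[OF s' bij_transpose transpose_image_notin transpose_image]) (use assms(1) in auto)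
    then have "s' * (xmon (yexp k (xs @ b # a # ys)) - - xmon (yexp k (xs @ a # b # ys))) = ?p + ren ?\<tau> ?p"
      by (simp add: ren_mult[OF inj] ren_xmon key algebra_simps)
    then show "phi k r (s' * (xmon (yexp k (xs @ b # a # ys)) - - xmon (yexp k (xs @ a # b # ys)))) \<in> filt_below (k + r)"
      using phi_ren_adjacent[of k ?i r ?p] assms(1) by (simp add: phi_simps)
  qed
qed

text \<open>Antisymmetry makes the vector its own negative modulo lower PBW degree.\<close>

lemma reducible_repeated:
  assumes "length ys + 2 = r"
  shows "reducible k r (xmon (yexp k (a # a # ys)))"
proof (rule reducible_zeroI)
  fix s' assume s': "s' \<in> symalg k r"
  let ?\<tau> = "Transposition.transpose k (Suc k)"
  have inj: "inj ?\<tau>" by (simp add: bij_is_inj)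
  let ?p = "s' * xmon (yexp k (a # a # ys))"
  have key: "yexp k (a # a # ys) = Poly_Mapping.map_key ?\<tau> (yexp k (a # a # ys))"
  proof (rule map_key_eqI[OF inj])
    fix i
    consider "i = k" | "i = Suc k" | "i \<noteq> k" "i \<noteq> Suc k" by blast
    then show "lookup (yexp k (a # a # ys)) i = lookup (yexp k (a # a # ys)) (?\<tau> i)"
      by cases (simp_all add: lookup_yexp Transposition.transpose_def)
  qed
  have "ren ?\<tau> s' = s'"
    by (rule symalg_ren[OF s' bij_transpose transpose_image_notin transpose_image]) (use assms in auto)
  then have "ren ?\<tau> ?p = ?p" using key by (simp add: ren_mult[OF inj] ren_xmon)
  then have "phi k r ?p + phi k r ?p \<in> filt_below (k + r)"
    using phi_ren_adjacent[of k k r ?p] assms by simp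
  from subspace_scale[OF subspace_filt_below this, of "1/2"]
  show "phi k r ?p \<in> filt_below (k + r)"
    by (simp add: scale_right_distrib flip: scale_left_distrib)
qed

text \<open>Exponents of size at least \<open>r\<close> are lowered with \<open>esf_root\<close>,
  whose coefficients are symmetric. The remaining exponent vectors have a repetition, and then
  vanish modulo lower PBW degree, or are permutations of the staircase.\<close>

lemma reducible_yexp:
  assumes "length gs = r"
  shows "reducible k r (xmon (yexp k gs))"
  using assms
proof (induction "sum_list gs" arbitrary: gs rule: less_induct)
  case less
  show ?case
  proof (cases "\<forall>i<r. gs ! i < r")
    case False
    then obtain i where i: "i < r" "r \<le> gs ! i" by (auto simp: not_less)
    \<comment> \<open>The \<open>i\<close>-th exponent lowered by \<open>j\<close>:
      \<open>gs' 0\<close> is \<open>gs\<close>, and \<open>gs' r\<close> is the cofactor by which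
      the root equation is multiplied.\<close>
    define gs' where "gs' j = gs[i := gs ! i - j]" for j
    have yg': "xmon (yexp k (gs' j)) = var (k + i) ^ (r - j) * xmon (yexp k (gs' r))" if "j \<le> r" for j
    proof -
      have "yexp k (gs' j) = single (k + i) (r - j) + yexp k (gs' r)"
        using that i less.prems by (intro poly_mapping_eqI)
          (auto simp: lookup_add lookup_single lookup_yexp gs'_def nth_list_update when_def)
      then show ?thesis by (simp only: var_power xmon_mult)
    qed
    have "(\<Sum>j\<le>r. esf {k..<k + r} j * var (k + i) ^ (r - j)) = 0"
      using esf_root[of "{k..<k + r}" "k + i"] i by simp
    then have "(\<Sum>j\<le>r. esf {k..<k + r} j * var (k + i) ^ (r - j)) * xmon (yexp k (gs' r)) = 0" by simp
    moreover have "(\<Sum>j\<le>r. esf {k..<k + r} j * xmon (yexp k (gs' j)))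
        = (\<Sum>j\<le>r. esf {k..<k + r} j * var (k + i) ^ (r - j)) * xmon (yexp k (gs' r))"
      unfolding sum_distrib_right
      by (rule sum.cong[OF refl], subst yg') (simp_all only: atMost_iff mult.assoc)
    ultimately have "(\<Sum>j\<le>r. esf {k..<k + r} j * xmon (yexp k (gs' j))) = 0" by metis
    moreover have ins: "{..r} = insert 0 {1..r}" by auto
    ultimately have "xmon (yexp k (gs' 0)) + (\<Sum>j\<in>{1..r}. esf {k..<k + r} j * xmon (yexp k (gs' j))) = 0"
      by (simp add: esf_0)
    then have eq: "xmon (yexp k gs) = - (\<Sum>j\<in>{1..r}. esf {k..<k + r} j * xmon (yexp k (gs' j)))"
      by (simp add: gs'_def eq_neg_iff_add_eq_0)
    show ?thesis unfolding eq
    proof (intro reducible_uminus reducible_sum reducible_mult symalg_esf less.hyps)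
      fix j assume j: "j \<in> {1..r}"
      show "length (gs' j) = r" using less.prems by (simp add: gs'_def)
      have "sum_list gs = sum_list (gs' j) + j"
        using i j less.prems elem_le_sum_list[of i gs]
        by (simp add: gs'_def sum_list_update)
      then show "sum_list (gs' j) < sum_list gs" using j by simp
    qed
  next
    case True
    define P where "P l \<longleftrightarrow> length l = r \<longrightarrow> reducible k r (xmon (yexp k l))" for l
    have swap: "P (xs @ b # a # ys)" if "P (xs @ a # b # ys)" for xs a b ys
      using that reducible_adjacent_swap[of xs ys r k a b] by (simp add: P_def)
    show ?thesis
    proof (cases "distinct gs")
      case d: True
      have "set gs \<subseteq> {0..<r}" using True less.prems by (auto simp: in_set_conv_nth)
      then have "set gs = {0..<r}" using d less.prems by (intro card_subset_eq) (auto simp: distinct_card)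
      then have "mset [0..<r] = mset gs" using d by (metis mset_set_set atLeastLessThan_upt distinct_upt)
      moreover have "P [0..<r]"
        unfolding P_def reducible_def ydelta_def
        by (auto intro!: bexI[OF _ symalg_1] simp: phi_simps subspace_0[OF subspace_filt_below])
      ultimately have "P gs" using adjacent_swaps_mset[of P "[0..<r]" gs] swap by blast
      then show ?thesis using less.prems by (simp add: P_def)
    next
      case False
      then obtain us vs ws a where gs: "gs = us @ [a] @ vs @ [a] @ ws" using not_distinct_decomp by blast
      have "P (a # a # us @ vs @ ws)"
        unfolding P_def using reducible_repeated[of "us @ vs @ ws" r k a] by simp
      moreover have "mset (a # a # us @ vs @ ws) = mset gs" by (simp add: gs)
      ultimately have "P gs" using adjacent_swaps_mset[of P "a # a # us @ vs @ ws" gs] swap by blast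
      then show ?thesis using less.prems by (simp add: P_def)
    qed
  qed
qed

text \<open>One unit is taken off the exponent of every even variable that occurs, and the result is
  multiplied by the elementary symmetric function of as many variables. The product contains
  \<alpha> and permutations of it, which encode the same vector, and monomials in which more even
  variables occur. The measure compares the even degree and then the number of even variables that
  do not occur.\<close>

lemma reducible_xmon:
  assumes "keys \<alpha> \<subseteq> {0..<k + r}"
  shows "reducible k r (xmon \<alpha>)"
  using assms
proof (induction "(\<Sum>i\<in>{0..<k}. lookup \<alpha> i) * Suc k + (k - card {i\<in>{0..<k}. lookup \<alpha> i \<noteq> 0})"
    arbitrary: \<alpha> rule: less_induct)
  case less
  let ?A = "{0..<k}" let ?A1 = "{i\<in>?A. lookup \<alpha> i \<noteq> 0}" let ?j = "card ?A1"
  define \<alpha>' where "\<alpha>' = \<alpha> - ind ?A1"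
  have finA1: "finite ?A1" by simp
  have l': "lookup \<alpha>' i = (if i < k \<and> lookup \<alpha> i \<noteq> 0 then lookup \<alpha> i - 1 else lookup \<alpha> i)" for i
    by (simp add: \<alpha>'_def lookup_minus lookup_ind)
  show ?case
  proof (cases "?A1 = {}")
    case True
    have "\<alpha> = yexp k (map (lookup \<alpha>) [k..<k + r])"
    proof (rule poly_mapping_eqI)
      fix i
      have "i \<notin> keys \<alpha>" if "\<not> i < k + r" using that less.prems by auto
      then show "lookup \<alpha> i = lookup (yexp k (map (lookup \<alpha>) [k..<k + r])) i"
        using True by (auto simp: lookup_yexp in_keys_iff)
    qed
    then show ?thesis using reducible_yexp[of "map (lookup \<alpha>) [k..<k + r]" r k] by simp
  next
    case False
    let ?Y = "{i\<in>?A. lookup \<alpha>' i \<noteq> 0}"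
    let ?Ss = "{S. S \<subseteq> ?A \<and> card S = ?j}"
    have finSs: "finite ?Ss"
      by (rule finite_subset[of _ "Pow ?A"]) (blast, rule finite_Pow_iff[THEN iffD2], rule finite_atLeastLessThan)
    have jpos: "0 < ?j" using False finA1 card_gt_0_iff by metis
    have jk: "?j \<le> k"
    proof -
      have "?j \<le> card ?A" by (rule card_mono) blast+
      then show ?thesis by (simp only: card_atLeastLessThan diff_zero)
    qed
    have fS: "finite S" if "S \<in> ?Ss" for S
    proof -
      have "S \<subseteq> ?A" using that by blast
      then show ?thesis by (rule finite_subset) (rule finite_atLeastLessThan)
    qed
    have sumA1: "(\<Sum>i\<in>?A. lookup \<alpha> i) = (\<Sum>i\<in>?A. lookup \<alpha>' i) + ?j"
    proof -
      have "(\<Sum>i\<in>?A. lookup \<alpha> i) = (\<Sum>i\<in>?A. lookup \<alpha>' i + (if lookup \<alpha> i \<noteq> 0 then 1 else 0))"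
        by (rule sum.cong[OF refl]) (simp add: l')
      also have "\<dots> = (\<Sum>i\<in>?A. lookup \<alpha>' i) + (\<Sum>i\<in>?A1. 1)"
      proof -
        have "(\<Sum>i\<in>?A. if lookup \<alpha> i \<noteq> 0 then 1 else 0) = (\<Sum>i\<in>?A1. 1::nat)"
          by (rule sum.inter_filter[symmetric]) simp
        then show ?thesis by (simp only: sum.distrib)
      qed
      finally show ?thesis by simp
    qed
    have keys': "keys \<alpha>' \<subseteq> {0..<k + r}" using less.prems by (auto simp: in_keys_iff l' split: if_splits)
    have "reducible k r (xmon \<alpha>')"
    proof (rule less.hyps[OF _ keys'])
      have "(\<Sum>i\<in>?A. lookup \<alpha>' i) * Suc k + (k - card ?Y) < (\<Sum>i\<in>?A. lookup \<alpha>' i) * Suc k + Suc k" by simp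
      also have "\<dots> \<le> (\<Sum>i\<in>?A. lookup \<alpha> i) * Suc k"
      proof -
        have "1 \<le> ?j" using jpos by linarith
        then have "1 * Suc k \<le> ?j * Suc k" by (rule mult_le_mono1)
        then show ?thesis unfolding sumA1 distrib_right mult_1_left by (rule add_left_mono)
      qed
      finally show "(\<Sum>i\<in>?A. lookup \<alpha>' i) * Suc k + (k - card ?Y)
        < (\<Sum>i\<in>?A. lookup \<alpha> i) * Suc k + (k - ?j)" by simp
    qed
    then have "reducible k r (cscale ((- 1) ^ ?j) (esf ?A ?j * xmon \<alpha>'))"
      by (intro reducible_cscale reducible_mult symalg_esf)
    also have "cscale ((- 1) ^ ?j) (esf ?A ?j * xmon \<alpha>') = (\<Sum>S\<in>?Ss. xmon (ind S + \<alpha>'))"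
    proof -
      have "esf ?A ?j * xmon \<alpha>' = (- 1) ^ ?j * (\<Sum>S\<in>?Ss. xmon (ind S + \<alpha>'))"
        unfolding esf_def mult.assoc sum_distrib_right
        by (intro arg_cong2[where f = "(*)"] sum.cong refl) (simp only: prod_var[OF fS] xmon_mult)
      moreover have "cscale ((- 1) ^ m) p = (- 1) ^ m * p" for m and p :: mpol
        by (induction m) auto
      moreover have "(- 1) ^ m * ((- 1) ^ m * p) = p" for m and p :: mpol
        by (simp flip: mult.assoc power_mult_distrib)
      ultimately show ?thesis by (simp only:)
    qed
    finally have all: "reducible k r (\<Sum>S\<in>?Ss. xmon (ind S + \<alpha>'))" .
    \<comment> \<open>The sets containing the support of \<open>\<alpha>'\<close>, whose terms are
      permutations of \<alpha>; any other \<open>S\<close> yields a support strictly larger than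
      \<open>S\<close>.\<close>
    let ?T = "{S \<in> ?Ss. ?Y \<subseteq> S}"
    have rest: "reducible k r (xmon (ind S + \<alpha>'))" if S: "S \<in> ?Ss - ?T" for S
    proof (rule less.hyps)
      have fin: "finite S" using S fS by blast
      have le: "lookup (ind S + \<alpha>') i = (if i \<in> S then 1 else 0) + lookup \<alpha>' i" for i
        by (simp add: lookup_add lookup_ind[OF fin])
      have "(\<Sum>i\<in>?A. if i \<in> S then 1 else 0) = (\<Sum>i\<in>{i\<in>?A. i \<in> S}. 1::nat)"
        by (rule sum.inter_filter[symmetric]) simp
      also have "{i\<in>?A. i \<in> S} = S" using S by auto
      finally have "(\<Sum>i\<in>?A. if i \<in> S then 1 else 0) = card S" by simp
      then have d: "(\<Sum>i\<in>?A. lookup (ind S + \<alpha>') i) = (\<Sum>i\<in>?A. lookup \<alpha> i)"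
        using S unfolding le sum.distrib sumA1 by auto
      have "S \<subset> {i\<in>?A. lookup (ind S + \<alpha>') i \<noteq> 0}" using S by (auto simp: le)
      then have "card S < card {i\<in>?A. lookup (ind S + \<alpha>') i \<noteq> 0}" by (intro psubset_card_mono) auto
      moreover have "card {i\<in>?A. lookup (ind S + \<alpha>') i \<noteq> 0} \<le> k"
      proof -
        have "card {i\<in>?A. lookup (ind S + \<alpha>') i \<noteq> 0} \<le> card ?A" by (rule card_mono) blast+
        then show ?thesis by (simp only: card_atLeastLessThan diff_zero)
      qed
      ultimately show "(\<Sum>i\<in>?A. lookup (ind S + \<alpha>') i) * Suc k + (k - card {i\<in>?A. lookup (ind S + \<alpha>') i \<noteq> 0})
          < (\<Sum>i\<in>?A. lookup \<alpha> i) * Suc k + (k - ?j)"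
        using S unfolding d by auto
      show "keys (ind S + \<alpha>') \<subseteq> {0..<k + r}"
      proof
        fix i assume i: "i \<in> keys (ind S + \<alpha>')"
        show "i \<in> {0..<k + r}"
        proof (cases "i \<in> S")
          case True then show ?thesis using S by fastforce
        next
          case False
          then have "i \<in> keys \<alpha>'" using i by (simp add: in_keys_iff le)
          then show ?thesis using keys' by blast
        qed
      qed
    qed
    have same: "phi k r (s' * (xmon (ind S + \<alpha>') - xmon \<alpha>)) = 0" if S: "S \<in> ?T" and s': "s' \<in> symalg k r" for S s'
    proof -
      have fin: "finite S" using S fS by blast
      have le: "lookup (ind S + \<alpha>') i = (if i \<in> S then 1 else 0) + lookup \<alpha>' i" for i
        by (simp add: lookup_add lookup_ind[OF fin])
      have le1: "lookup \<alpha> i = (if i \<in> ?A1 then 1 else 0) + lookup \<alpha>' i" for i by (simp add: l')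
      have "mset (map (lookup (ind S + \<alpha>')) [0..<k]) = mset (map (lookup \<alpha>) [0..<k])"
      proof -
        have "image_mset (\<lambda>i. (if i \<in> S then 1 else 0) + lookup \<alpha>' i) (mset_set ?A)
            = image_mset (\<lambda>i. (if i \<in> ?A1 then 1 else 0) + lookup \<alpha>' i) (mset_set ?A)"
          using S by (subst (1 2) image_mset_shifted_indicator[where Y = ?Y]) (auto simp: l')
        then show ?thesis unfolding mset_map_upt le[abs_def] le1[abs_def, symmetric] by simp
      qed
      then obtain \<sigma> where \<sigma>: "\<sigma> permutes {..<length (map (lookup \<alpha>) [0..<k])}"
          "permute_list \<sigma> (map (lookup \<alpha>) [0..<k]) = map (lookup (ind S + \<alpha>')) [0..<k]"
        by (rule mset_eq_permutation)
      then have perm: "\<sigma> permutes {0..<k}" by (simp add: lessThan_atLeast0)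
      have inj: "inj \<sigma>" using perm by (rule permutes_inj)
      have key: "ind S + \<alpha>' = Poly_Mapping.map_key \<sigma> \<alpha>"
      proof (rule map_key_eqI[OF inj])
        fix i
        show "lookup (ind S + \<alpha>') i = lookup \<alpha> (\<sigma> i)"
        proof (cases "i < k")
          case True
          then have "\<sigma> i < k" using permutes_in_image[OF perm, of i] by simp
          have "map (lookup (ind S + \<alpha>')) [0..<k] ! i = permute_list \<sigma> (map (lookup \<alpha>) [0..<k]) ! i"
            by (simp only: \<sigma>(2))
          then show ?thesis using True \<open>\<sigma> i < k\<close> \<sigma>(1) by (simp add: permute_list_nth del: map_eq_conv)
        next
          case False
          then have "\<sigma> i = i" using perm by (intro permutes_not_in) auto
          moreover have "i \<notin> S" using False S by auto
          ultimately show ?thesis using False by (simp add: le l')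
        qed
      qed
      have "ren \<sigma> s' = s'"
      proof (rule symalg_ren[OF s' permutes_bij[OF perm] permutes_image[OF perm]])
        have "\<sigma> ` {k..<k + r} = (\<lambda>x. x) ` {k..<k + r}"
          by (intro image_cong refl permutes_not_in[OF perm]) auto
        then show "\<sigma> ` {k..<k + r} = {k..<k + r}" by simp
      qed
      then have "s' * xmon (ind S + \<alpha>') = ren \<sigma> (s' * xmon \<alpha>)"
        by (simp add: key ren_mult[OF inj] ren_xmon)
      then show ?thesis by (simp add: right_diff_distrib phi_simps phi_ren[OF perm])
    qed
    have split: "(\<Sum>S\<in>?Ss. xmon (ind S + \<alpha>')) = (\<Sum>S\<in>?Ss - ?T. xmon (ind S + \<alpha>')) + (\<Sum>S\<in>?T. xmon (ind S + \<alpha>'))"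
      by (rule sum.subset_diff) (auto simp: finSs)
    have "reducible k r ((\<Sum>S\<in>?Ss. xmon (ind S + \<alpha>')) + - (\<Sum>S\<in>?Ss - ?T. xmon (ind S + \<alpha>')))"
      by (intro reducible_add all reducible_uminus reducible_sum rest)
    then have T: "reducible k r (\<Sum>S\<in>?T. xmon (ind S + \<alpha>'))" unfolding split by simp
    have "reducible k r (cscale (of_nat (card ?T)) (xmon \<alpha>))"
    proof (rule reducible_cong[OF T])
      fix s' assume s': "s' \<in> symalg k r"
      have "cscale (of_nat (card ?T)) (xmon \<alpha>) = (\<Sum>S\<in>?T. xmon \<alpha>)"
        using pm.sum_constant_scale[of "xmon \<alpha>" ?T] by simp
      then have "s' * (cscale (of_nat (card ?T)) (xmon \<alpha>) - (\<Sum>S\<in>?T. xmon (ind S + \<alpha>')))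
        = (\<Sum>S\<in>?T. - (s' * (xmon (ind S + \<alpha>') - xmon \<alpha>)))"
        by (simp only: sum_subtractf[symmetric] sum_distrib_left minus_diff_eq mult_minus_right[symmetric])
      then show "phi k r (s' * (cscale (of_nat (card ?T)) (xmon \<alpha>) - (\<Sum>S\<in>?T. xmon (ind S + \<alpha>')))) \<in> filt_below (k + r)"
        using same[OF _ s'] by (simp only: phi_simps) (simp add: subspace_0[OF subspace_filt_below])
    qed
    then have "reducible k r (cscale (inverse (of_nat (card ?T))) (cscale (of_nat (card ?T)) (xmon \<alpha>)))"
      by (rule reducible_cscale)
    then have red: "reducible k r (cscale (inverse (of_nat (card ?T)) * of_nat (card ?T)) (xmon \<alpha>))"
      by (simp only: pm.scale_scale)
    \<comment> \<open>The term of \<open>?A1\<close> is \<alpha> itself, so the number of coinciding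
      terms is positive and can be divided out.\<close>
    have "?A1 \<in> ?T" by (auto simp: l')
    moreover have "finite ?T" by (rule finite_subset[OF _ finSs]) auto
    ultimately have "card ?T \<noteq> 0" using card_0_eq by blast
    then have "inverse (of_nat (card ?T)) * of_nat (card ?T) = (1 :: complex)"
      by (intro left_inverse) simp
    then show ?thesis using red by (simp only: pm.scale_one)
  qed
qed

end

text \<open>A vector of the box spanning set is indexed by $(k, r, a, b)$, where $k$ and $r$ count the even and
  odd generators and $a$, $b$ are exponent vectors of elementary symmetric functions.\<close>

type_synonym box_index = "nat \<times> nat \<times> nat list \<times> nat list"

definition box_indices :: "nat \<Rightarrow> box_index set" where
  "box_indices n = {(k, r, a, b). k + r \<le> n \<and> length a = k \<and> length b = r
     \<and> sum_list a \<le> n - (k + r) \<and> sum_list b \<le> n - r}"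

definition box_poly :: "box_index \<Rightarrow> mpol" where
  "box_poly = (\<lambda>(k, r, a, b). cmon (esf {0..<k}) a * cmon (esf {k..<k + r}) b * ydelta k r)"

definition pbw_deg :: "box_index \<Rightarrow> nat" where
  "pbw_deg = (\<lambda>(k, r, a, b). k + r)"

section \<open>Spanning of the filtration by box vectors\<close>

context weyl_rep
begin

definition box_vec :: "box_index \<Rightarrow> 'a" where
  "box_vec x = (case x of (k, r, a, b) \<Rightarrow> phi k r (box_poly x))"

lemma gmon_box_span:
  assumes "keys \<alpha> \<subseteq> {0..<k + r}"
  shows "gmon k r \<alpha> \<in> span (box_vec ` {x \<in> box_indices n. pbw_deg x = k + r} \<union> filt_below (k + r))"
    (is "_ \<in> span (?B \<union> ?F)")
proof -
  have F: "v \<in> span (?B \<union> ?F)" if "v \<in> ?F" for v using that by (intro span_base) simp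
  obtain s where s: "s \<in> symalg k r"
      "\<And>s'. s' \<in> symalg k r \<Longrightarrow> phi k r (s' * (xmon \<alpha> - s * ydelta k r)) \<in> ?F"
    using reducible_xmon[OF assms] unfolding reducible_def by blast
  \<comment> \<open>The polynomials sending the staircase to lower PBW degree take the place of the
    ideal of relations in \<open>box_span_two_sets\<close>.\<close>
  define K where "K = {p. phi k r (p * ydelta k r) \<in> ?F}"
  have K: "pm.subspace K"
    unfolding K_def pm.subspace_def
    by (auto simp: phi_simps distrib_right subspace_0[OF subspace_filt_below]
        intro: subspace_add[OF subspace_filt_below] subspace_scale[OF subspace_filt_below])
  have csf: "phi k r (p * csf {0..<k + r} m) \<in> ?F" if "Suc n \<le> m + (k + r)" for p m
  proof (induction p rule: pm_induct)
    case (single \<beta> c)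
    have "single \<beta> c = cscale c (xmon \<beta>)" by simp
    then show ?case using phi_csf_filt_below[OF that, of \<beta>]
      by (simp only: cscale_mult_left phi_simps subspace_scale[OF subspace_filt_below])
  qed (auto simp: phi_simps distrib_right subspace_0[OF subspace_filt_below]
      intro: subspace_add[OF subspace_filt_below])
  have un: "{0..<k} \<union> {k..<k + r} = {0..<k + r}" by auto
  \<comment> \<open>The first degree in which \<open>csf\<close> acts by zero modulo lower PBW
    degree. The strict bounds \<open>?L\<close> and \<open>?L + k\<close> become
    \<open>n - (k + r)\<close> and \<open>n - r\<close> in \<open>box_indices\<close>.\<close>
  let ?L = "Suc n - (k + r)"
  have rel: "p * csf ({0..<k} \<union> {k..<k + r}) m \<in> K" if "?L \<le> m" for p m
  proof -
    have "Suc n \<le> m + (k + r)" using that by simp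
    from csf[OF this, of "p * ydelta k r"] show ?thesis
      unfolding K_def un by (simp add: mult_ac)
  qed
  have "phi k r (s * ydelta k r) \<in> span (?B \<union> ?F)"
    using s(1) unfolding symalg_def
  proof (induction rule: pm_span_induct)
    case zero then show ?case by (simp add: phi_simps span_zero)
  next
    case (scale_add c t y)
    then obtain a b where t: "t = cmon (esf {0..<k}) a * cmon (esf {k..<k + r}) b" "length a = k" "length b = r"
      by blast
    have "t \<in> pm.span ({cmon (esf {0..<k}) a' * cmon (esf {k..<k + r}) b' |a' b'.
      length a' = card {0..<k} \<and> sum_list a' < ?L \<and> length b' = card {k..<k + r} \<and> sum_list b' < ?L + card {0..<k}} \<union> K)"
      unfolding t(1) by (rule box_span_two_sets[OF _ _ _ K]) (use t rel in auto)
    then have "phi k r (t * ydelta k r) \<in> span (?B \<union> ?F)"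
    proof (induction rule: pm_span_induct)
      case zero then show ?case by (simp add: phi_simps span_zero)
    next
      case (scale_add c u y)
      have "phi k r (u * ydelta k r) \<in> span (?B \<union> ?F)"
      proof (cases "u \<in> K")
        case True then show ?thesis by (intro F) (simp add: K_def)
      next
        case False
        then obtain a' b' where u: "u = cmon (esf {0..<k}) a' * cmon (esf {k..<k + r}) b'"
          "length a' = k" "sum_list a' < ?L" "length b' = r" "sum_list b' < ?L + k"
          using scale_add(1) by auto
        then have "(k, r, a', b') \<in> {x \<in> box_indices n. pbw_deg x = k + r}"
          by (auto simp: box_indices_def pbw_deg_def)
        then have "box_vec (k, r, a', b') \<in> ?B" by blast
        then show ?thesis by (intro span_base UnI1) (simp add: box_vec_def box_poly_def u)
      qed
      then show ?case using scale_add(2)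
        by (simp add: distrib_right phi_simps span_add span_scale)
    qed
    then show ?case using scale_add(2)
      by (simp add: distrib_right phi_simps span_add span_scale)
  qed
  moreover have "gmon k r \<alpha> - phi k r (s * ydelta k r) \<in> span (?B \<union> ?F)"
    using s(2)[OF symalg_1] by (intro F) (simp add: phi_simps)
  ultimately have "gmon k r \<alpha> - phi k r (s * ydelta k r) + phi k r (s * ydelta k r) \<in> span (?B \<union> ?F)"
    by (rule span_add[rotated])
  then show ?thesis by simp
qed

lemma mon_eq_gmon: "mon w es gs = gmon (length es) (length gs) (Poly_Mapping.nth (es @ gs))"
proof -
  have "map (lookup (Poly_Mapping.nth (es @ gs))) [0..<length es] = es"
    by (intro nth_equalityI) (auto simp: nth_default_def nth_append)
  moreover have "map (lookup (Poly_Mapping.nth (es @ gs))) [length es..<length es + length gs] = gs"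
    by (intro nth_equalityI) (auto simp: nth_default_def nth_append)
  ultimately show ?thesis by (simp add: gmon_def)
qed

text \<open>The operators \<open>g^+_i\<close> and \<open>e_j\<close> commute, so the even ones can
  be moved to the front without correction terms.\<close>

lemma filt_mon_span: "filt s \<subseteq> span {mon w es gs |es gs. length es + length gs \<le> s}"
proof (induction s)
  case 0
  have "w = mon w [] []" by (simp add: mon_def)
  then show ?case unfolding filt.simps(1) by (intro span_mono) auto
next
  case (Suc s)
  let ?M = "\<lambda>s. {mon w es gs |es gs. length es + length gs \<le> s}"
  have gen: "act y i (mon w es gs) \<in> ?M (Suc s)"
    if "y \<in> {Osp_e, Osp_gp}" "length es + length gs \<le> s" for y i es gs
  proof -
    have "E i (mon w es gs) = mon w (i # es) gs" "G i (mon w es gs) = mon w es (i # gs)"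
      by (simp_all add: mon_def G_foldr_E)
    moreover have "length (i # es) + length gs \<le> Suc s" "length es + length (i # gs) \<le> Suc s"
      using that(2) by simp_all
    then have "mon w (i # es) gs \<in> ?M (Suc s)" "mon w es (i # gs) \<in> ?M (Suc s)" by blast+
    ultimately show ?thesis using that(1) by (elim insertE emptyE) (simp_all only:)
  qed
  have "act y i v \<in> span (?M (Suc s))" if y: "y \<in> {Osp_e, Osp_gp}" and "v \<in> filt s" for y i v
  proof -
    have "v \<in> span (?M s)" using that(2) Suc by blast
    then show ?thesis
    proof (induction rule: span_induct_alt)
      case base then show ?case by (simp add: span_zero)
    next
      case (step c u z)
      then obtain es gs where "u = mon w es gs" "length es + length gs \<le> s" by blast
      then have "act y i u \<in> span (?M (Suc s))" using gen[OF y] by (intro span_base) simp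
      then show ?case using step(2) by (simp add: act_add act_scale span_add span_scale)
    qed
  qed
  moreover have "filt s \<subseteq> span (?M (Suc s))"
    using Suc by (rule order_trans) (intro span_mono; auto intro: le_SucI)
  ultimately show ?case unfolding filt.simps(2)[of s] by (intro span_minimal) auto
qed

theorem filt_box_span: "filt s \<subseteq> span (box_vec ` {x \<in> box_indices n. pbw_deg x \<le> s})"
proof (induction s rule: less_induct)
  case (less s)
  let ?B = "\<lambda>s. box_vec ` {x \<in> box_indices n. pbw_deg x \<le> s}"
  have "mon w es gs \<in> span (?B s)" if le: "length es + length gs \<le> s" for es gs
  proof -
    let ?t = "length es + length gs"
    have "keys (Poly_Mapping.nth (es @ gs)) \<subseteq> {0..<?t}"
      by (auto simp: in_keys_iff nth_default_def simp del: keys_nth split: if_splits)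
    from gmon_box_span[OF this]
    have "mon w es gs \<in> span (box_vec ` {x \<in> box_indices n. pbw_deg x = ?t} \<union> filt_below ?t)"
      unfolding mon_eq_gmon .
    also have "\<dots> \<subseteq> span (?B s)"
    proof (intro span_minimal Un_least)
      show "box_vec ` {x \<in> box_indices n. pbw_deg x = ?t} \<subseteq> span (?B s)"
        using le by (intro subset_trans[OF _ span_superset]) auto
      show "filt_below ?t \<subseteq> span (?B s)"
      proof (cases ?t)
        case 0 then show ?thesis by (simp add: filt_below_def span_zero)
      next
        case (Suc u)
        then have "filt u \<subseteq> span (?B u)" using le by (intro less) simp
        also have "\<dots> \<subseteq> span (?B s)" using Suc le by (intro span_mono) auto
        finally show ?thesis using Suc by (simp add: filt_below_def)
      qed
    qed simp
    finally show ?thesis .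
  qed
  then show ?case using filt_mon_span[of s] by (intro subset_trans[OF filt_mon_span] span_minimal) auto
qed

end

section \<open>Tensor products of evaluation modules\<close>

text \<open>The three-dimensional module with lowest weight vector \<open>v\<^sub>0\<close> and $v_1 = g^+ v_0$, $v_2 = e v_0$:
  \<open>site_act y g\<close> is the coordinate function of $y \sum_c g(c) v_c$.\<close>

fun site_act :: "osp12 \<Rightarrow> (nat \<Rightarrow> complex) \<Rightarrow> nat \<Rightarrow> complex" where
  "site_act Osp_e g c = (if c = 2 then g 0 else 0)"
| "site_act Osp_gp g c = (if c = 1 then g 0 else if c = 2 then g 1 else 0)"
| "site_act Osp_h g c = (if c = 0 then - g 0 else if c = 2 then g 2 else 0)"
| "site_act Osp_gm g c = (if c = 0 then - g 1 else if c = 1 then g 2 else 0)"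
| "site_act Osp_f g c = (if c = 0 then g 2 else 0)"

text \<open>The Koszul sign for moving \<open>y\<close> past \<open>v_c\<close>, where only
  \<open>v_1\<close> is odd.\<close>

definition site_sign :: "osp12 \<Rightarrow> nat \<Rightarrow> complex" where
  "site_sign y c = (if c = 1 then (-1) ^ osp_parity y else 1)"

lemma site_act_super:
  "site_act y (site_act z g) c = (-1) ^ (osp_parity y * osp_parity z) * site_act z (site_act y g) c
    + (\<Sum>x\<in>keys (osp_bracket y z). lookup (osp_bracket y z) x * site_act x g c)"
  by (cases y; cases z; simp)

lemma site_act_sign:
  "site_act y (\<lambda>c'. site_sign z c' * A c') c = (-1) ^ (osp_parity y * osp_parity z) * site_sign z c * site_act y A c"
  by (cases y; cases z; simp add: site_sign_def)

lemma bracket_sign: "x \<in> keys (osp_bracket y z) \<Longrightarrow> site_sign x c = site_sign y c * site_sign z c"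
  by (cases y; cases z; simp add: site_sign_def)

lemma site_act_add: "site_act y (\<lambda>c. g c + h c) c = site_act y g c + site_act y h c"
  by (cases y) auto

lemma site_act_mult: "site_act y (\<lambda>c. a * g c) c = a * site_act y g c"
  by (cases y) auto

text \<open>A vector of the tensor product is its coordinate function on the words indexing the product basis; the
  generator acts on the tensor factor number \<open>i\<close> with the weight \<open>ws ! i\<close>.\<close>

primrec weighted_act :: "complex list \<Rightarrow> osp12 \<Rightarrow> (nat list \<Rightarrow> complex) \<Rightarrow> nat list \<Rightarrow> complex" where
  "weighted_act [] y \<psi> = (\<lambda>l. 0)"
| "weighted_act (a # ws) y \<psi> = (\<lambda>l. case l of [] \<Rightarrow> 0 | c # r \<Rightarrow>
     a * site_act y (\<lambda>c'. \<psi> (c' # r)) c + site_sign y c * weighted_act ws y (\<lambda>r. \<psi> (c # r)) r)"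

lemma weighted_act_add: "weighted_act ws y (\<lambda>l. \<psi> l + \<phi> l) l = weighted_act ws y \<psi> l + weighted_act ws y \<phi> l"
  by (induction ws arbitrary: \<psi> \<phi> l) (auto simp: site_act_add algebra_simps split: list.split)

lemma weighted_act_mult: "weighted_act ws y (\<lambda>l. a * \<psi> l) l = a * weighted_act ws y \<psi> l"
  by (induction ws arbitrary: \<psi> l) (auto simp: site_act_mult algebra_simps split: list.split)

lemma weighted_act_zero: "weighted_act ws y (\<lambda>l. 0) l = 0"
  using weighted_act_mult[of ws y 0 "\<lambda>l. 0" l] by simp

lemma weighted_act_uminus: "weighted_act ws y (\<lambda>l. - \<psi> l) l = - weighted_act ws y \<psi> l"
  using weighted_act_mult[of ws y "-1" \<psi> l] by simp

lemma weighted_act_site_act: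
  "weighted_act ws y (\<lambda>r. site_act z (\<lambda>c'. \<psi> (c' # r)) c) r
    = site_act z (\<lambda>c'. weighted_act ws y (\<lambda>r. \<psi> (c' # r)) r) c"
  by (cases z) (auto simp: weighted_act_zero weighted_act_uminus)

lemma weighted_act_weights_add:
  "weighted_act (map (\<lambda>z. f z + g z) zs) y \<psi> l = weighted_act (map f zs) y \<psi> l + weighted_act (map g zs) y \<psi> l"
  by (induction zs arbitrary: \<psi> l) (auto simp: algebra_simps split: list.split)

lemma weighted_act_weights_mult:
  "weighted_act (map (\<lambda>z. c * f z) zs) y \<psi> l = c * weighted_act (map f zs) y \<psi> l"
  by (induction zs arbitrary: \<psi> l) (auto simp: algebra_simps split: list.split)

lemma weighted_act_weights_zero: "weighted_act (replicate m 0) y \<psi> l = 0"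
  by (induction m arbitrary: \<psi> l) (auto split: list.split)

text \<open>Weights are functions on the points and multiply pointwise, \<open>t ^ i\<close> being
  the function \<open>z ^ i\<close>. The terms in which the two operators act on different tensor
  factors match by the Koszul signs.\<close>

lemma weighted_act_super:
  "weighted_act (map f zs) y (weighted_act (map g zs) z \<psi>) l
    = (-1) ^ (osp_parity y * osp_parity z) * weighted_act (map g zs) z (weighted_act (map f zs) y \<psi>) l
      + (\<Sum>x\<in>keys (osp_bracket y z). lookup (osp_bracket y z) x * weighted_act (map (\<lambda>z. f z * g z) zs) x \<psi> l)"
proof (induction zs arbitrary: \<psi> l)
  case Nil
  then show ?case by simp
next
  case (Cons z0 zs)
  show ?case
  proof (cases l)
    case Nil then show ?thesis by simp
  next
    case l: (Cons c r)
    let ?s = "(-1) ^ (osp_parity y * osp_parity z) :: complex"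
    let ?K = "keys (osp_bracket y z)" and ?b = "lookup (osp_bracket y z)"
    let ?p = "\<lambda>c'. \<psi> (c' # r)"
    let ?A = "\<lambda>c'. weighted_act (map g zs) z (\<lambda>r. \<psi> (c' # r)) r"
    let ?B = "\<lambda>c'. weighted_act (map f zs) y (\<lambda>r. \<psi> (c' # r)) r"
    have ss: "?s * ?s = 1" by (simp flip: power_mult_distrib)
    have L: "weighted_act (map f (z0 # zs)) y (weighted_act (map g (z0 # zs)) z \<psi>) l
       = f z0 * (g z0 * site_act y (site_act z ?p) c + ?s * site_sign z c * site_act y ?A c)
         + site_sign y c * (g z0 * site_act z ?B c
            + site_sign z c * weighted_act (map f zs) y (weighted_act (map g zs) z (\<lambda>r. \<psi> (c # r))) r)"
      by (simp add: l site_act_add site_act_mult site_act_sign weighted_act_add weighted_act_mult weighted_act_site_act)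
    have R: "weighted_act (map g (z0 # zs)) z (weighted_act (map f (z0 # zs)) y \<psi>) l
       = g z0 * (f z0 * site_act z (site_act y ?p) c + ?s * site_sign y c * site_act z ?B c)
         + site_sign z c * (f z0 * site_act y ?A c
            + site_sign y c * weighted_act (map g zs) z (weighted_act (map f zs) y (\<lambda>r. \<psi> (c # r))) r)"
      by (simp add: l site_act_add site_act_mult site_act_sign weighted_act_add weighted_act_mult
           weighted_act_site_act mult.commute[of "osp_parity z"])
    have B: "(\<Sum>x\<in>?K. ?b x * weighted_act (map (\<lambda>z. f z * g z) (z0 # zs)) x \<psi> l)
       = f z0 * g z0 * (\<Sum>x\<in>?K. ?b x * site_act x ?p c)
         + site_sign y c * site_sign z c * (\<Sum>x\<in>?K. ?b x * weighted_act (map (\<lambda>z. f z * g z) zs) x (\<lambda>r. \<psi> (c # r)) r)"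
      by (simp add: l bracket_sign distrib_left sum.distrib sum_distrib_left mult_ac)
    show ?thesis
      unfolding L R B site_act_super[of y z ?p c] Cons.IH[of "\<lambda>r. \<psi> (c # r)" r]
      using ss by (simp add: algebra_simps)
  qed
qed

definition fun_scale :: "complex \<Rightarrow> (nat list \<Rightarrow> complex) \<Rightarrow> nat list \<Rightarrow> complex" where
  "fun_scale c \<psi> = (\<lambda>l. c * \<psi> l)"

definition tensor_act :: "complex list \<Rightarrow> osp12 \<Rightarrow> nat \<Rightarrow> (nat list \<Rightarrow> complex) \<Rightarrow> nat list \<Rightarrow> complex" where
  "tensor_act zs y i = weighted_act (map (\<lambda>z. z ^ i) zs) y"

lemma sum_fun_apply: "(sum f A) x = (\<Sum>a\<in>A. f a x)" for f :: "'a \<Rightarrow> 'b \<Rightarrow> complex"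
  by (induction A rule: infinite_finite_induct) auto

interpretation tensor: osp_module fun_scale "tensor_act zs"
proof
  show "tensor_act zs y i (tensor_act zs z j v)
    = fun_scale ((-1) ^ (osp_parity y * osp_parity z)) (tensor_act zs z j (tensor_act zs y i v))
      + (\<Sum>x\<in>keys (osp_bracket y z). fun_scale (lookup (osp_bracket y z) x) (tensor_act zs x (i + j) v))" for y i z j v
  proof (rule ext)
    fix l
    show "tensor_act zs y i (tensor_act zs z j v) l
      = (fun_scale ((-1) ^ (osp_parity y * osp_parity z)) (tensor_act zs z j (tensor_act zs y i v))
      + (\<Sum>x\<in>keys (osp_bracket y z). fun_scale (lookup (osp_bracket y z) x) (tensor_act zs x (i + j) v))) l"
      using weighted_act_super[of "\<lambda>z. z ^ i" zs y "\<lambda>z. z ^ j" z v l]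
      by (simp add: tensor_act_def fun_scale_def sum_fun_apply power_add)
  qed
  show "tensor_act zs y i (u + v) = tensor_act zs y i u + tensor_act zs y i v" for y i u v
    by (rule ext) (simp add: tensor_act_def plus_fun_def weighted_act_add)
  show "tensor_act zs y i (fun_scale c v) = fun_scale c (tensor_act zs y i v)" for y i c v
    by (rule ext) (simp add: tensor_act_def fun_scale_def weighted_act_mult)
qed (simp_all add: fun_scale_def fun_eq_iff distrib_left distrib_right)

definition basis_fun :: "nat list \<Rightarrow> nat list \<Rightarrow> complex" where
  "basis_fun l0 = (\<lambda>l. if l = l0 then 1 else 0)"

lemma basis_fun_Cons: "(\<lambda>r. basis_fun (c0 # l0) (c # r)) = (if c = c0 then basis_fun l0 else (\<lambda>r. 0))"
  by (auto simp: basis_fun_def)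

abbreviation "ground n \<equiv> basis_fun (replicate n 0)"

lemma weighted_act_lowering:
  assumes "y \<in> {Osp_f, Osp_gm}"
  shows "weighted_act ws y (ground (length ws)) l = 0"
proof (induction ws arbitrary: l)
  case (Cons a ws)
  show ?case
  proof (cases l)
    case l: (Cons c r)
    show ?thesis using assms Cons
      by (auto simp: l basis_fun_Cons weighted_act_zero) (auto simp: basis_fun_def split: if_splits)
  qed simp
qed simp

lemma weighted_act_h: "weighted_act ws Osp_h (ground (length ws)) l = - sum_list ws * ground (length ws) l"
proof (induction ws arbitrary: l)
  case (Cons a ws)
  show ?case
  proof (cases l)
    case l: (Cons c r)
    show ?thesis using Cons
      by (auto simp: l basis_fun_Cons weighted_act_zero site_sign_def algebra_simps) (auto simp: basis_fun_def)
  qed (simp add: basis_fun_def)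
qed simp

text \<open>Each application of \<open>e\<close> creates one more letter 2, and a word of length
  \<open>n\<close> has room for \<open>n\<close> of them; this yields the relation for the power
  \<open>n + 1\<close> of \<open>e_0\<close>.\<close>

lemma weighted_act_e_support:
  "weighted_act ws Osp_e \<psi> l \<noteq> 0 \<Longrightarrow>
    \<exists>l'. \<psi> l' \<noteq> 0 \<and> length l' = length l \<and> count_list l 2 = Suc (count_list l' 2)"
proof (induction ws arbitrary: \<psi> l)
  case (Cons a ws)
  then obtain c r where l: "l = c # r" by (cases l) auto
  from Cons.prems consider "c = 2" "\<psi> (0 # r) \<noteq> 0" | "weighted_act ws Osp_e (\<lambda>r. \<psi> (c # r)) r \<noteq> 0"
    by (cases "weighted_act ws Osp_e (\<lambda>r. \<psi> (c # r)) r = 0") (auto simp: l split: if_splits)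
  then show ?case
  proof cases
    case 1 then show ?thesis by (intro exI[of _ "0 # r"]) (simp add: l)
  next
    case 2
    from Cons.IH[OF this] obtain r' where "\<psi> (c # r') \<noteq> 0" "length r' = length r"
      "count_list r 2 = Suc (count_list r' 2)" by auto
    then show ?thesis by (intro exI[of _ "c # r'"]) (simp add: l)
  qed
qed simp

lemma tensor_e_power:
  assumes "(tensor_act zs Osp_e 0 ^^ m) (ground n) l \<noteq> 0"
  shows "length l = n \<and> m \<le> count_list l 2"
  using assms
proof (induction m arbitrary: l)
  case 0
  then show ?case by (auto simp: basis_fun_def split: if_splits)
next
  case (Suc m)
  then have "weighted_act (map (\<lambda>z. z ^ 0) zs) Osp_e ((tensor_act zs Osp_e 0 ^^ m) (ground n)) l \<noteq> 0"
    by (simp add: tensor_act_def)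
  from weighted_act_e_support[OF this] Suc.IH show ?case by fastforce
qed

text \<open>The weights single out one tensor factor. All letters to its left are 0, hence even, and
  no sign appears.\<close>

lemma weighted_act_raise:
  assumes "(y, c) \<in> {(Osp_gp, 1), (Osp_e, 2)}"
  shows "weighted_act (replicate m 0 @ 1 # replicate (length t) 0) y (basis_fun (replicate m 0 @ 0 # t))
    = basis_fun (replicate m 0 @ c # t)"
proof (induction m)
  case 0
  show ?case using assms
    by (intro ext) (auto simp: weighted_act_weights_zero basis_fun_def split: list.split)
next
  case (Suc m)
  show ?case
  proof (rule ext)
    fix l
    show "weighted_act (replicate (Suc m) 0 @ 1 # replicate (length t) 0) y (basis_fun (replicate (Suc m) 0 @ 0 # t)) l
      = basis_fun (replicate (Suc m) 0 @ c # t) l"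
    proof (cases l)
      case Nil then show ?thesis by (simp add: basis_fun_def)
    next
      case l: (Cons d r)
      show ?thesis
        by (auto simp: l basis_fun_Cons weighted_act_zero Suc site_sign_def) (auto simp: basis_fun_def)
    qed
  qed
qed

section \<open>Cyclicity of the tensor product\<close>

lemma interpolation_poly:
  fixes zs :: "complex list"
  assumes "distinct zs" "length ws = length zs"
  obtains p where "map (poly p) zs = ws"
proof -
  have "\<exists>p. map (poly p) zs = ws"
    using assms
  proof (induction zs arbitrary: ws)
    case (Cons z zs)
    then obtain a ws' where ws: "ws = a # ws'" by (cases ws) auto
    then obtain p where p: "map (poly p) zs = ws'" using Cons by auto
    define q where "q = (\<Prod>x\<in>set zs. [:- x, 1:])"
    have q0: "poly q x = 0" if "x \<in> set zs" for x using that by (auto simp: q_def poly_prod)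
    have qz: "poly q z \<noteq> 0" using Cons.prems by (auto simp: q_def poly_prod)
    let ?p = "p + smult ((a - poly p z) / poly q z) q"
    have "map (poly ?p) zs = map (poly p) zs"
      by (rule map_cong[OF refl]) (simp add: q0)
    moreover have "poly ?p z = a" using qz by simp
    ultimately have "map (poly ?p) (z # zs) = ws" by (simp only: list.map p ws)
    then show ?case by blast
  qed simp
  then show ?thesis using that by blast
qed

text \<open>By interpolation every vector of weights is a combination of the vectors of powers
  \<open>z ^ i\<close>. In particular a submodule is stable under operators acting on a single
  tensor factor.\<close>

lemma weighted_act_mem:
  assumes U: "tensor.subspace U" and act: "\<And>y i \<psi>. \<psi> \<in> U \<Longrightarrow> tensor_act zs y i \<psi> \<in> U"
    and "distinct zs" "length ws = length zs" "\<psi> \<in> U"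
  shows "weighted_act ws y \<psi> \<in> U"
proof -
  obtain p where p: "map (poly p) zs = ws" using interpolation_poly assms by blast
  have "weighted_act (map (\<lambda>z. \<Sum>i\<in>I. coeff p i * z ^ i) zs) y \<psi> \<in> U" if "finite I" for I
    using that
  proof (induction I rule: finite_induct)
    case empty
    have "weighted_act (map (\<lambda>z. 0) zs) y \<psi> = 0"
      by (rule ext) (simp add: map_replicate_const weighted_act_weights_zero)
    then show ?case using tensor.subspace_0[OF U] by (simp add: zero_fun_def)
  next
    case (insert i I)
    have eq: "weighted_act (map (\<lambda>z. coeff p i * z ^ i + (\<Sum>i\<in>I. coeff p i * z ^ i)) zs) y \<psi>
      = fun_scale (coeff p i) (tensor_act zs y i \<psi>) + weighted_act (map (\<lambda>z. \<Sum>i\<in>I. coeff p i * z ^ i) zs) y \<psi>"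
      by (rule ext) (simp add: weighted_act_weights_add weighted_act_weights_mult fun_scale_def tensor_act_def)
    show ?case
      unfolding sum.insert[OF insert.hyps] eq
      by (intro tensor.subspace_add[OF U] tensor.subspace_scale[OF U] act[OF assms(5)] insert.IH)
  qed
  moreover have "ws = map (\<lambda>z. \<Sum>i\<in>{..degree p}. coeff p i * z ^ i) zs"
    unfolding p[symmetric] by (simp add: poly_altdef)
  ultimately show ?thesis by (simp only: finite_atMost)
qed

definition words3 :: "nat \<Rightarrow> nat list set" where
  "words3 n = {l. set l \<subseteq> {0, 1, 2} \<and> length l = n}"

lemma card_words3: "card (words3 n) = 3 ^ n" and finite_words3: "finite (words3 n)"
  using card_lists_length_eq[of "{0, 1, 2::nat}" n] finite_lists_length_eq[of "{0, 1, 2::nat}" n]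
  by (simp_all add: words3_def numeral_3_eq_3)

text \<open>The word is built up from its last letter backwards: the letters to the left of the
  active position are then still 0, as \<open>weighted_act_raise\<close> requires.\<close>

lemma basis_fun_mem:
  assumes U: "tensor.subspace U" and act: "\<And>y i \<psi>. \<psi> \<in> U \<Longrightarrow> tensor_act zs y i \<psi> \<in> U"
    and zs: "distinct zs" "length zs = n" and w: "ground n \<in> U" and l: "l \<in> words3 n"
  shows "basis_fun l \<in> U"
proof -
  have "basis_fun (replicate (n - k) 0 @ drop (n - k) l) \<in> U" if "k \<le> n" for k
    using that
  proof (induction k)
    case 0 then show ?case using w l by (simp add: words3_def)
  next
    case (Suc k)
    define m t where "m = n - Suc k" and "t = drop (n - k) l"
    have m: "n - k = Suc m" "m < length l" using Suc.prems l by (auto simp: m_def words3_def)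
    have d: "drop m l = l ! m # t" using m by (simp add: t_def Cons_nth_drop_Suc)
    have IH: "basis_fun (replicate m 0 @ 0 # t) \<in> U"
      using Suc by (simp add: m t_def replicate_append_same[symmetric])
    have len: "length (replicate m 0 @ 1 # replicate (length t) (0::complex)) = length zs"
      using m l zs by (simp add: t_def words3_def)
    have "l ! m \<in> {0, 1, 2}" using m l nth_mem[of m l] unfolding words3_def by blast
    moreover have "basis_fun (replicate m 0 @ c # t) \<in> U" if "(y, c) \<in> {(Osp_gp, 1), (Osp_e, 2)}" for y c
      using weighted_act_mem[OF U act zs(1) len IH, of y] weighted_act_raise[OF that, of m t] by simp
    ultimately have "basis_fun (replicate m 0 @ l ! m # t) \<in> U" using IH by auto
    then show ?case by (simp add: d flip: m_def)
  qed
  from this[of n] show ?thesis by simp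
qed

lemma independent_basis_fun: "tensor.independent (basis_fun ` L)"
proof -
  have inj: "inj_on basis_fun L"
    by (auto simp: inj_on_def basis_fun_def fun_eq_iff split: if_splits)
  show ?thesis
  proof (subst tensor.dependent_explicit, clarify)
    fix S u v
    assume S: "finite S" "S \<subseteq> basis_fun ` L" "(\<Sum>v\<in>S. fun_scale (u v) v) = 0" and v: "v \<in> S" "u v \<noteq> 0"
    obtain l where l: "v = basis_fun l" using v S by blast
    have "(\<Sum>v\<in>S. fun_scale (u v) v) l = (\<Sum>v'\<in>S. if v' = v then u v' else 0)"
      unfolding sum_fun_apply
    proof (intro sum.cong refl)
      fix v' assume "v' \<in> S"
      then obtain l' where "v' = basis_fun l'" using S by blast
      then show "fun_scale (u v') v' l = (if v' = v then u v' else 0)"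
        by (auto simp: fun_scale_def l basis_fun_def fun_eq_iff)
    qed
    also have "\<dots> = u v" using S v by simp
    finally show False using S(3) v by simp
  qed
qed

section \<open>A basis of the Weyl module\<close>

definition fword :: "nat \<Rightarrow> nat \<Rightarrow> (nat \<Rightarrow>\<^sub>0 nat) \<Rightarrow> osp_word" where
  "fword k r \<alpha> = Osp_Word (map (Pair Osp_e) (map (lookup \<alpha>) [0..<k]) @ map (Pair Osp_gp) (map (lookup \<alpha>) [k..<k + r]))"

text \<open>A lift of the encoding to the free algebra, so that the same elements can be evaluated
  in W_{-n} and in the tensor product.\<close>

definition fphi :: "nat \<Rightarrow> nat \<Rightarrow> mpol \<Rightarrow> free_alg" where
  "fphi k r = pm.linext (\<lambda>\<alpha>. single (fword k r \<alpha>) 1)"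

definition box_elem :: "box_index \<Rightarrow> free_alg" where
  "box_elem x = (case x of (k, r, a, b) \<Rightarrow> fphi k r (box_poly x))"

lemma (in weyl_rep) ev_fphi: "ev w (fphi k r p) = phi k r p"
proof (induction p rule: pm_induct)
  case (single \<alpha> c)
  have E: "foldr (\<lambda>(y, i). act y i) (map (Pair Osp_e) es) v = foldr E es v" for es v
    by (induction es) auto
  have G: "foldr (\<lambda>(y, i). act y i) (map (Pair Osp_gp) gs) v = foldr G gs v" for gs v
    by (induction gs) auto
  show ?case
    by (simp add: fphi_def phi_def ev_def wact_def fword_def gmon_def mon_def E G del: map_map)
qed (auto simp: fphi_def pm.linext_add ev_simps phi_simps)

lemma (in weyl_rep) ev_box_elem: "ev w (box_elem x) = box_vec x"
  by (cases x) (simp add: box_elem_def box_vec_def ev_fphi)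

subsection \<open>Gradings\<close>

lemma tdeg_add: "tdeg (a + b) = tdeg a + tdeg b"
  by (simp add: tdeg_def plus_osp_word_def)

definition homog :: "nat \<Rightarrow> free_alg \<Rightarrow> bool" where
  "homog d p \<longleftrightarrow> (\<forall>x\<in>keys p. tdeg x = d)"

lemma homog_single: "tdeg a = d \<Longrightarrow> homog d (single a c)"
  by (simp add: homog_def)

lemma homog_0: "homog d 0"
  by (simp add: homog_def)

lemma homog_add: "homog d p \<Longrightarrow> homog d q \<Longrightarrow> homog d (p + q)"
  using Poly_Mapping.keys_add[of p q] by (auto simp: homog_def)

lemma homog_cscale: "homog d p \<Longrightarrow> homog d (cscale c p)"
  unfolding homog_def using keys_cscale_subset by blast

lemma subspace_homog: "pm.subspace (Collect (homog d))"
  by (simp add: pm.subspace_def homog_0 homog_add homog_cscale)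

lemma homog_diff: "homog d p \<Longrightarrow> homog d q \<Longrightarrow> homog d (p - q)"
  by (rule pm.subspace_diff[OF subspace_homog[of d], simplified])

lemma homog_sum: "(\<And>i. i \<in> I \<Longrightarrow> homog d (f i)) \<Longrightarrow> homog d (sum f I)"
  by (rule pm.subspace_sum[OF subspace_homog[of d], simplified])

lemma homog_mult: "homog d p \<Longrightarrow> homog e q \<Longrightarrow> homog (d + e) (p * q)"
  unfolding homog_def
proof
  fix x assume p: "\<forall>x\<in>keys p. tdeg x = d" and q: "\<forall>x\<in>keys q. tdeg x = e" and x: "x \<in> keys (p * q)"
  obtain a b where "x = a + b" "a \<in> keys p" "b \<in> keys q" using x keys_mult[of p q] by blast
  then show "tdeg x = d + e" using p q by (simp add: tdeg_add)
qed

lemma homog_cur: "homog i (cur y i)"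
  by (simp add: cur_def homog_single tdeg_def)

lemma homog_1: "homog 0 1"
  unfolding single_one[symmetric] by (rule homog_single) (simp add: tdeg_def zero_osp_word_def)

definition hpart :: "nat \<Rightarrow> free_alg \<Rightarrow> free_alg" where
  "hpart d = pm.linext (\<lambda>x. if tdeg x = d then single x 1 else 0)"

lemma hpart_simps: "hpart d (p + q) = hpart d p + hpart d q" "hpart d (p - q) = hpart d p - hpart d q"
  "hpart d (cscale c p) = cscale c (hpart d p)" "hpart d (sum f I) = (\<Sum>i\<in>I. hpart d (f i))" "hpart d 0 = 0"
  by (simp_all add: hpart_def pm.linext_add pm.linext_diff pm.linext_cscale pm.linext_sum)

lemma hpart_homog: "homog e p \<Longrightarrow> hpart d p = (if d = e then p else 0)"
proof -
  assume p: "homog e p"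
  have "hpart d p = (\<Sum>x\<in>keys p. cscale (lookup p x) (if d = e then single x 1 else 0))"
    unfolding hpart_def pm.linext_def using p by (intro sum.cong) (auto simp: homog_def)
  then show ?thesis by (simp add: sum_single_keys)
qed

text \<open>Exponents encode t-indices, so polynomial degree becomes t-degree under
  \<open>fphi\<close>.\<close>

definition phomog :: "nat \<Rightarrow> nat \<Rightarrow> mpol \<Rightarrow> bool" where
  "phomog N d p \<longleftrightarrow> (\<forall>\<alpha>\<in>keys p. (\<Sum>i<N. lookup \<alpha> i) = d)"

lemma phomog_xmon: "(\<Sum>i<N. lookup \<alpha> i) = d \<Longrightarrow> phomog N d (xmon \<alpha>)"
  by (simp add: phomog_def)

lemma phomog_mult: "phomog N d p \<Longrightarrow> phomog N e q \<Longrightarrow> phomog N (d + e) (p * q)"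
  unfolding phomog_def
proof
  fix \<alpha> assume p: "\<forall>\<alpha>\<in>keys p. (\<Sum>i<N. lookup \<alpha> i) = d" and q: "\<forall>\<alpha>\<in>keys q. (\<Sum>i<N. lookup \<alpha> i) = e"
    and \<alpha>: "\<alpha> \<in> keys (p * q)"
  obtain a b where "\<alpha> = a + b" "a \<in> keys p" "b \<in> keys q" using \<alpha> keys_mult[of p q] by blast
  then show "(\<Sum>i<N. lookup \<alpha> i) = d + e" using p q by (simp add: lookup_add sum.distrib)
qed

lemma phomog_1: "phomog N 0 1"
  unfolding single_one[symmetric] by (rule phomog_xmon) simp

lemma phomog_sum: "(\<And>i. i \<in> I \<Longrightarrow> phomog N d (f i)) \<Longrightarrow> phomog N d (sum f I)"
  unfolding phomog_def using keys_sum[of f I] by blast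

lemma phomog_minus_one_power: "phomog N d p \<Longrightarrow> phomog N d ((- 1) ^ j * p)"
  by (induction j) (auto simp: phomog_def)

lemma phomog_esf:
  assumes "A \<subseteq> {0..<N}"
  shows "phomog N j (esf A j)"
  unfolding esf_def
proof (intro phomog_minus_one_power phomog_sum)
  fix S assume S: "S \<in> {S. S \<subseteq> A \<and> card S = j}"
  then have fin: "finite S" and sub: "S \<subseteq> {..<N}" using assms by (auto intro: finite_subset)
  have "(\<Sum>i<N. lookup (ind S) i) = (\<Sum>i\<in>{i\<in>{..<N}. i \<in> S}. 1)"
    unfolding lookup_ind[OF fin] by (rule sum.inter_filter[symmetric]) simp
  also have "{i\<in>{..<N}. i \<in> S} = S" using sub by auto
  finally show "phomog N j (\<Prod>i\<in>S. var i)"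
    using S by (simp add: prod_var[OF fin] phomog_xmon)
qed

lemma phomog_cmon:
  assumes "\<And>j. phomog N j (c j)"
  shows "phomog N (wsum a) (cmon c a)"
proof (induction a)
  case (Cons x xs)
  have "phomog N (Suc (length xs) * m) (c (Suc (length xs)) ^ m)" for m
  proof (induction m)
    case (Suc m)
    from phomog_mult[OF assms[of "Suc (length xs)"] Suc] show ?case by (simp add: ac_simps)
  qed (simp add: phomog_1)
  from phomog_mult[OF this Cons] show ?case by simp
qed (simp add: phomog_1)

lemma homog_fphi: "phomog (k + r) d p \<Longrightarrow> homog d (fphi k r p)"
  unfolding fphi_def pm.linext_def
proof (intro homog_sum homog_cscale homog_single)
  fix \<alpha> assume p: "phomog (k + r) d p" and \<alpha>: "\<alpha> \<in> keys p"
  have "tdeg (fword k r \<alpha>) = sum_list (map (lookup \<alpha>) ([0..<k] @ [k..<k + r]))"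
    by (simp add: tdeg_def fword_def o_def)
  also have "[0..<k] @ [k..<k + r] = [0..<k + r]" by (rule upt_add_eq_append[symmetric]) simp
  also have "sum_list (map (lookup \<alpha>) [0..<k + r]) = (\<Sum>i<k + r. lookup \<alpha> i)"
    by (simp add: interv_sum_list_conv_sum_set_nat lessThan_atLeast0)
  finally show "tdeg (fword k r \<alpha>) = d" using p \<alpha> by (simp add: phomog_def)
qed

definition box_tdeg :: "box_index \<Rightarrow> nat" where
  "box_tdeg = (\<lambda>(k, r, a, b). wsum a + wsum b + \<Sum>{..<r})"

lemma phomog_ydelta: "phomog (k + r) (\<Sum>{..<r}) (ydelta k r)"
  unfolding ydelta_def
proof (rule phomog_xmon)
  have "(\<Sum>i<k + r. lookup (yexp k [0..<r]) i) = (\<Sum>i\<in>{k..<k + r}. i - k)"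
    by (intro sum.mono_neutral_cong_right) (auto simp: lookup_yexp)
  also have "\<dots> = \<Sum>{..<r}"
    by (rule sum.reindex_bij_witness[of _ "\<lambda>i. i + k" "\<lambda>i. i - k"]) auto
  finally show "(\<Sum>i<k + r. lookup (yexp k [0..<r]) i) = \<Sum>{..<r}" .
qed

lemma homog_box_elem: "homog (box_tdeg x) (box_elem x)"
proof -
  obtain k r a b where x: "x = (k, r, a, b)" by (cases x)
  show ?thesis
    unfolding x box_elem_def box_tdeg_def box_poly_def prod.case
    by (intro homog_fphi phomog_mult phomog_cmon phomog_esf phomog_ydelta) auto
qed

subsection \<open>The left ideal of the Weyl module\<close>

lemma enveloping_ideal_span:
  "enveloping_ideal = pm.span {a * super_rel y i z j * b |a y i z j b. True}"
  by (simp add: enveloping_ideal_def fscale_eq_cscale)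

lemma weyl_ideal_span:
  "weyl_ideal n = pm.span (enveloping_ideal \<union> {a * r |a r. r \<in> weyl_rels n})"
  by (simp add: weyl_ideal_def fscale_eq_cscale)

lemma subspace_weyl_ideal: "pm.subspace (weyl_ideal n)"
  by (simp add: weyl_ideal_span)

lemma weyl_ideal_rel: "r \<in> weyl_rels n \<Longrightarrow> a * r \<in> weyl_ideal n"
  unfolding weyl_ideal_span by (intro pm.span_base) blast

lemma weyl_ideal_super_rel: "a * super_rel y i z j * b \<in> weyl_ideal n"
  unfolding weyl_ideal_span enveloping_ideal_span
  by (rule pm.span_base, rule UnI1, rule pm.span_base, rule CollectI)
    (rule exI[of _ a], rule exI[of _ y], rule exI[of _ i], rule exI[of _ z], rule exI[of _ j],
      rule exI[of _ b], simp)

lemma pm_span_left_mult: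
  fixes S :: "'b::monoid_add alg set"
  assumes "p \<in> pm.span S" "pm.subspace U" "\<And>s. s \<in> S \<Longrightarrow> q * s \<in> U"
  shows "q * p \<in> U"
  using assms(1)
  by (induction rule: pm_span_induct)
    (auto simp: distrib_left pm.subspace_0[OF assms(2)]
      intro!: pm.subspace_add[OF assms(2)] pm.subspace_scale[OF assms(2)] assms(3))

lemma weyl_ideal_mult:
  assumes "p \<in> weyl_ideal n"
  shows "q * p \<in> weyl_ideal n"
  using assms unfolding weyl_ideal_span[of n]
proof (rule pm_span_left_mult[OF _ pm.subspace_span], fold weyl_ideal_span, elim UnE)
  fix s assume "s \<in> enveloping_ideal"
  then show "q * s \<in> weyl_ideal n"
    unfolding enveloping_ideal_span
  proof (rule pm_span_left_mult[OF _ subspace_weyl_ideal], clarify)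
    fix a y i z j b
    show "q * (a * super_rel y i z j * b) \<in> weyl_ideal n"
      using weyl_ideal_super_rel[of "q * a" y i z j b n] by (simp add: mult.assoc)
  qed
next
  fix s assume "s \<in> {a * r |a r. r \<in> weyl_rels n}"
  then show "q * s \<in> weyl_ideal n"
    using weyl_ideal_rel by (auto simp flip: mult.assoc)
qed

text \<open>Multiplication by single words instead of arbitrary elements keeps every generator
  homogeneous in t-degree; this shows that the ideal is graded.\<close>

definition weyl_gens :: "nat \<Rightarrow> free_alg set" where
  "weyl_gens n = {single x 1 * super_rel y i z j * single x' 1 |x y i z j x'. True}
     \<union> {single x 1 * r |x r. r \<in> weyl_rels n}"

lemma weyl_ideal_gens: "weyl_ideal n = pm.span (weyl_gens n)"
proof (rule antisym)
  have 1: "a * super_rel y i z j * b \<in> pm.span (weyl_gens n)" for a y i z j b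
  proof (induction a rule: pm_induct)
    case (single x c)
    show ?case
    proof (induction b rule: pm_induct)
      case (single x' d)
      have "single x c * super_rel y i z j * single x' d
          = cscale (c * d) (single x 1 * super_rel y i z j * single x' 1)"
      proof -
        have "single x c = cscale c (single x 1)" "single x' d = cscale d (single x' 1)" by simp_all
        then show ?thesis by (simp only: cscale_mult_left cscale_mult_right pm.scale_scale mult.commute)
      qed
      also have "\<dots> \<in> pm.span (weyl_gens n)"
        unfolding weyl_gens_def
        by (rule pm.span_scale, rule pm.span_base, rule UnI1, rule CollectI)
          (rule exI[of _ x], rule exI[of _ y], rule exI[of _ i], rule exI[of _ z], rule exI[of _ j],
            rule exI[of _ x'], simp)
      finally show ?case .
    qed (auto simp: distrib_left pm.span_zero pm.span_add)
  qed (auto simp: distrib_right pm.span_zero pm.span_add)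
  have 2: "a * r \<in> pm.span (weyl_gens n)" if "r \<in> weyl_rels n" for a r
  proof (induction a rule: pm_induct)
    case (single x c)
    have "single x c = cscale c (single x 1)" by simp
    then have "single x c * r = cscale c (single x 1 * r)" by (simp only: cscale_mult_left)
    also have "\<dots> \<in> pm.span (weyl_gens n)"
      using that by (intro pm.span_scale pm.span_base) (auto simp: weyl_gens_def)
    finally show ?case .
  qed (auto simp: distrib_right pm.span_zero pm.span_add)
  have "enveloping_ideal \<subseteq> pm.span (weyl_gens n)"
    unfolding enveloping_ideal_span by (intro pm.span_minimal pm.subspace_span) (use 1 in blast)
  then show "weyl_ideal n \<subseteq> pm.span (weyl_gens n)"
    unfolding weyl_ideal_span by (intro pm.span_minimal pm.subspace_span) (use 2 in blast)
  show "pm.span (weyl_gens n) \<subseteq> weyl_ideal n"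
    unfolding weyl_gens_def
    by (intro pm.span_minimal subspace_weyl_ideal) (auto intro: weyl_ideal_rel weyl_ideal_super_rel)
qed

lemma homog_super_rel: "homog (i + j) (super_rel y i z j)"
  unfolding super_rel_def fscale_eq_cscale
proof -
  have 1: "homog (i + j) (cur y i * cur z j)" by (intro homog_mult homog_cur)
  have 2: "homog (i + j) (cur z j * cur y i)"
    using homog_mult[OF homog_cur[of j z] homog_cur[of i y]] by (simp add: add.commute)
  show "homog (i + j) (cur y i * cur z j - cscale ((- 1) ^ (osp_parity y * osp_parity z)) (cur z j * cur y i)
     - (\<Sum>x\<in>keys (osp_bracket y z). cscale (lookup (osp_bracket y z) x) (cur x (i + j))))"
    by (intro homog_diff 1 homog_cscale 2 homog_sum homog_cur)
qed

lemma homog_weyl_rels: "r \<in> weyl_rels n \<Longrightarrow> \<exists>d. homog d r"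
proof -
  have "homog 0 (cur Osp_e 0 ^ m)" for m
    using homog_mult[OF homog_cur, of 0] by (induction m) (auto simp: homog_1)
  moreover have "homog 0 (cur Osp_h 0 + fscale (of_nat n) 1)"
    unfolding fscale_eq_cscale by (intro homog_add homog_cur homog_cscale homog_1)
  ultimately show "r \<in> weyl_rels n \<Longrightarrow> \<exists>d. homog d r"
    unfolding weyl_rels_def using homog_cur by blast
qed

lemma homog_weyl_gens:
  assumes "g \<in> weyl_gens n"
  shows "\<exists>d. homog d g"
proof -
  consider x y i z j x' where "g = single x 1 * super_rel y i z j * single x' 1"
    | x r where "g = single x 1 * r" "r \<in> weyl_rels n"
    using assms unfolding weyl_gens_def by blast
  then show ?thesis
  proof cases
    case 1
    then show ?thesis
      using homog_mult[OF homog_mult[OF homog_single[OF refl] homog_super_rel] homog_single[OF refl]] by blast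
  next
    case 2
    then show ?thesis using homog_mult[OF homog_single[OF refl]] homog_weyl_rels by blast
  qed
qed

lemma hpart_weyl_ideal: "p \<in> weyl_ideal n \<Longrightarrow> hpart d p \<in> weyl_ideal n"
  unfolding weyl_ideal_gens
proof (induction rule: pm_span_induct)
  case (scale_add c g y)
  obtain e where "homog e g" using homog_weyl_gens scale_add(1) by blast
  then have "hpart d g \<in> pm.span (weyl_gens n)"
    using scale_add(1) by (auto simp: hpart_homog pm.span_zero intro: pm.span_base)
  then show ?case using scale_add(2) by (simp add: hpart_simps pm.span_add pm.span_scale)
qed (simp add: hpart_simps pm.span_zero)

subsection \<open>Spanning\<close>

text \<open>A basis of \<open>I\<close> is extended to the whole space and then sent to zero. The
  image of \<pi> serves as a model of the quotient within the same type.\<close>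

lemma (in cvector_space) exists_projection:
  assumes I: "subspace I"
  obtains \<pi> where "\<And>u v. \<pi> (u + v) = \<pi> u + \<pi> v" "\<And>c v. \<pi> (scale c v) = scale c (\<pi> v)"
    "\<And>v. v \<in> I \<longleftrightarrow> \<pi> v = 0" "\<And>v. \<pi> v - v \<in> I"
proof -
  interpret vp: vector_space_pair scale scale ..
  obtain B where B: "B \<subseteq> I" "independent B" "I \<subseteq> span B"
    using maximal_independent_subset by blast
  define B' where "B' = extend_basis B"
  have B': "B \<subseteq> B'" "independent B'" "span B' = UNIV"
    using B(2) by (simp_all add: B'_def extend_basis_superset independent_extend_basis span_extend_basis)
  define \<pi> where "\<pi> = vp.construct B' (\<lambda>b. if b \<in> B then 0 else b)"
  have lin: "Vector_Spaces.linear scale scale \<pi>" unfolding \<pi>_def by (rule vp.linear_construct[OF B'(2)])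
  have \<pi>: "\<pi> b = (if b \<in> B then 0 else b)" if "b \<in> B'" for b
    unfolding \<pi>_def using vp.construct_basis[OF B'(2) that] .
  have add: "\<pi> (u + v) = \<pi> u + \<pi> v" and scl: "\<pi> (scale c v) = scale c (\<pi> v)" for u v c
    using vp.linear_add[OF lin] vp.linear_scale[OF lin] by auto
  have \<pi>0: "\<pi> 0 = 0" using scl[of 0 0] by simp
  have zero: "\<pi> v = 0" if "v \<in> I" for v
  proof -
    have "v \<in> span B" using that B(3) by blast
    then show ?thesis
      by (induction rule: span_induct_alt) (use \<pi> B'(1) in \<open>auto simp: add scl \<pi>0\<close>)
  qed
  have diff: "\<pi> v - v \<in> I" for v
  proof -
    have "v \<in> span B'" using B'(3) by blast
    then show ?thesis
    proof (induction rule: span_induct_alt)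
      case base then show ?case using subspace_0[OF I] by (simp add: \<pi>0)
    next
      case (step c b y)
      have "\<pi> b - b \<in> I" using \<pi>[OF step(1)] B(1) subspace_neg[OF I] subspace_0[OF I] by auto
      from subspace_add[OF I subspace_scale[OF I this, of c] step(2)]
      show ?case by (simp add: add scl scale_right_diff_distrib algebra_simps)
    qed
  qed
  have "v \<in> I" if "\<pi> v = 0" for v
    using subspace_neg[OF I diff[of v]] that by simp
  then show ?thesis using that[of \<pi>] add scl zero diff by blast
qed

lemma (in weyl_rep) Fo_G: "Fo i (G j v) = G j (Fo i v) - Gm (i + j) v"
  using act_super[of Osp_f i Osp_gp j v] by simp

lemma (in weyl_rep) filt_Fo: "v \<in> filt s \<Longrightarrow> Fo j v \<in> filt s"
proof (induction s arbitrary: v)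
  case 0
  \<comment> \<open>Since \<open>[g^-, g^-] = -2 f\<close>, the vanishing of \<open>g^-_0 w\<close>
    forces that of \<open>f_0 w\<close>.\<close>
  have "scale 2 (Fo 0 w) = 0"
    using act_super[of Osp_gm 0 Osp_gm 0 w] by (simp add: Gm_w)
  then have "Fo j w = 0" using Fo_w[of j] by (cases "j = 0") auto
  from 0 show ?case unfolding filt.simps(1)
    by (induction rule: span_induct_alt)
      (auto simp: act_add act_scale span_zero \<open>Fo j w = 0\<close> intro!: span_add span_scale)
next
  case (Suc s)
  show ?case
  proof (rule filt_stable_aux[OF _ Suc.IH Suc.prems])
    fix y i v assume y: "y \<in> {Osp_e, Osp_gp}" and v: "v \<in> filt s"
    show "Fo j (act y i v) \<in> filt (Suc s)"
      using y filt_E[OF Suc.IH[OF v]] filt_Suc[OF filt_H[OF v]] filt_G[OF Suc.IH[OF v]]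
        filt_Suc[OF filt_Gm[OF v]]
      by (auto simp: Fo_E Fo_G intro!: subspace_diff[OF subspace_filt])
  qed
qed

text \<open>No reordering is necessary: the lowering operators and the \<open>h_j\<close> preserve
  each member of the filtration, and a raising operator moves it up by one.\<close>

lemma (in weyl_rep) ev_filt: "\<exists>s. ev w p \<in> filt s"
proof (induction p rule: pm_induct)
  case zero then show ?case using subspace_0[OF subspace_filt] by (auto simp: ev_simps)
next
  case (single x c)
  have "\<exists>s. foldr (\<lambda>(y, i). act y i) ys w \<in> filt s" for ys
  proof (induction ys)
    case Nil then show ?case using w_filt by (auto simp del: filt.simps)
  next
    case (Cons yi ys)
    then obtain s where "foldr (\<lambda>(y, i). act y i) ys w \<in> filt s" by blast
    moreover obtain y i where "yi = (y, i)" by (cases yi)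
    moreover have "act y i v \<in> filt s \<or> act y i v \<in> filt (Suc s)" if "v \<in> filt s" for v
      using filt_E[OF that] filt_G[OF that] filt_H[OF that] filt_Gm[OF that] filt_Fo[OF that] by (cases y) auto
    ultimately show ?case by auto
  qed
  from this[of "letters x"] obtain s where "wact x w \<in> filt s" by (auto simp: wact_def)
  then have "ev w (single x c) \<in> filt s"
    by (simp add: ev_def subspace_scale[OF subspace_filt])
  then show ?case by blast
next
  case (add p q)
  then obtain s t where "ev w p \<in> filt s" "ev w q \<in> filt t" by blast
  then have "ev w p \<in> filt (max s t)" "ev w q \<in> filt (max s t)"
    by (auto intro: filt_mono[rotated])
  then show ?case using subspace_add[OF subspace_filt] by (auto simp: ev_simps)
qed

text \<open>\<open>\<pi>\<close> is a linear projection with kernel the ideal, so its image is a copy of the quotient \<open>W\<^sub>-\<^sub>n\<close>.\<close>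

locale weyl_projection =
  fixes \<pi> :: "free_alg \<Rightarrow> free_alg" and n :: nat
  assumes pi_add: "\<pi> (u + v) = \<pi> u + \<pi> v"
    and pi_scale: "\<pi> (cscale c v) = cscale c (\<pi> v)"
    and pi_zero_iff: "v \<in> weyl_ideal n \<longleftrightarrow> \<pi> v = 0"
    and pi_diff: "\<pi> v - v \<in> weyl_ideal n"
begin

lemma pi_zero: "\<pi> 0 = 0"
  using pi_scale[of 0 0] by simp

lemma pi_uminus: "\<pi> (- v) = - \<pi> v"
  using pi_add[of v "- v"] by (simp add: pi_zero eq_neg_iff_add_eq_0 add.commute)

lemma pi_minus: "\<pi> (u - v) = \<pi> u - \<pi> v"
  using pi_add[of u "- v"] by (simp add: pi_uminus)

lemma pi_sum: "\<pi> (sum f A) = (\<Sum>a\<in>A. \<pi> (f a))"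
  by (induction A rule: infinite_finite_induct) (auto simp: pi_add pi_zero)

lemma pi_mult: "\<pi> (q * \<pi> p) = \<pi> (q * p)"
proof -
  have "\<pi> (q * (\<pi> p - p)) = 0"
    using weyl_ideal_mult[OF pi_diff] pi_zero_iff by blast
  then show ?thesis by (simp add: right_diff_distrib pi_minus)
qed

lemma pi_rel: "r \<in> weyl_rels n \<Longrightarrow> \<pi> r = 0"
  using weyl_ideal_rel[of r n 1] pi_zero_iff by simp

sublocale osp_module cscale "\<lambda>y i v. \<pi> (cur y i * v)"
proof
  fix y i z j v
  have "\<pi> (super_rel y i z j * v) = 0"
    using weyl_ideal_super_rel[of 1 y i z j v n] pi_zero_iff by simp
  then show "\<pi> (cur y i * \<pi> (cur z j * v))
      = cscale ((-1) ^ (osp_parity y * osp_parity z)) (\<pi> (cur z j * \<pi> (cur y i * v)))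
        + (\<Sum>x\<in>keys (osp_bracket y z). cscale (lookup (osp_bracket y z) x) (\<pi> (cur x (i + j) * v)))"
    unfolding super_rel_def fscale_eq_cscale
    by (simp add: pi_mult left_diff_distrib pi_minus pi_scale pi_sum sum_distrib_right mult.assoc
        diff_eq_eq add.commute)
qed (simp_all add: pi_add pi_scale distrib_left)

sublocale weyl_rep cscale "\<lambda>y i v. \<pi> (cur y i * v)" "\<pi> 1" n
proof
  fix i :: nat and y assume "1 \<le> i" "y \<in> {Osp_f, Osp_gm, Osp_h}"
  then have "cur y i \<in> weyl_rels n" unfolding weyl_rels_def by blast
  then show "\<pi> (cur y i * \<pi> 1) = 0" by (simp add: pi_mult pi_rel)
next
  have "cur Osp_gm 0 \<in> weyl_rels n" unfolding weyl_rels_def by blast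
  then show "\<pi> (cur Osp_gm 0 * \<pi> 1) = 0" by (simp add: pi_mult pi_rel)
next
  have "cur Osp_h 0 + cscale (of_nat n) 1 \<in> weyl_rels n"
    unfolding weyl_rels_def fscale_eq_cscale by blast
  from pi_rel[OF this] show "\<pi> (cur Osp_h 0 * \<pi> 1) = - cscale (of_nat n) (\<pi> 1)"
    by (simp add: pi_mult pi_add pi_scale eq_neg_iff_add_eq_0)
next
  have "foldr (\<lambda>i v. \<pi> (cur Osp_e i * v)) (replicate m 0) (\<pi> 1) = \<pi> (cur Osp_e 0 ^ m)" for m
    by (induction m) (auto simp: pi_mult)
  moreover have "cur Osp_e 0 ^ Suc n \<in> weyl_rels n"
    unfolding weyl_rels_def by simp
  ultimately show "foldr (\<lambda>i v. \<pi> (cur Osp_e i * v)) (replicate (Suc n) 0) (\<pi> 1) = 0"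
    by (simp only: pi_rel)
qed

lemma ev_pi: "ev (\<pi> 1) p = \<pi> p"
proof (induction p rule: pm_induct)
  case (single x c)
  have "foldr (\<lambda>(y, i) v. \<pi> (cur y i * v)) ys (\<pi> 1) = \<pi> (single (Osp_Word ys) 1)" for ys
  proof (induction ys)
    case Nil
    have "single (Osp_Word []) 1 = (1 :: free_alg)"
      unfolding zero_osp_word_def[symmetric] by simp
    then show ?case by simp
  next
    case (Cons yi ys)
    obtain y i where yi: "yi = (y, i)" by (cases yi)
    have "cur y i * single (Osp_Word ys) 1 = single (Osp_Word (yi # ys)) 1"
      by (simp add: yi cur_def mult_single plus_osp_word_def)
    then show ?case using Cons by (simp add: yi pi_mult)
  qed
  from this[of "letters x"] have "\<pi> (cscale c (single x 1)) = cscale c (wact x (\<pi> 1))"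
    by (simp only: pi_scale wact_def osp_word.collapse)
  then show ?case by (simp add: ev_def)
qed (auto simp: ev_simps pi_add pi_zero)

lemma span_pi: "u \<in> pm.span (\<pi> ` X) \<Longrightarrow> u \<in> pm.span (X \<union> weyl_ideal n)"
proof (induction rule: pm_span_induct)
  case (scale_add c b y)
  then obtain x where x: "b = \<pi> x" "x \<in> X" by blast
  have "x + (\<pi> x - x) \<in> pm.span (X \<union> weyl_ideal n)"
    using x pi_diff by (intro pm.span_add pm.span_base) auto
  then show ?case using scale_add(2) x by (simp add: pm.span_add pm.span_scale)
qed (simp add: pm.span_zero)

lemma filt_pi_span:
  assumes "\<pi> v \<in> filt s"
  shows "v \<in> pm.span (box_elem ` {x \<in> box_indices n. pbw_deg x \<le> s} \<union> weyl_ideal n)"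
proof -
  have "box_vec = (\<lambda>x. \<pi> (box_elem x))"
    using ev_box_elem ev_pi by (intro ext) simp
  then have "filt s \<subseteq> pm.span (\<pi> ` box_elem ` {x \<in> box_indices n. pbw_deg x \<le> s})"
    using filt_box_span[of s] by (simp add: image_image)
  then have "\<pi> v \<in> pm.span (box_elem ` {x \<in> box_indices n. pbw_deg x \<le> s} \<union> weyl_ideal n)"
    using assms span_pi by blast
  moreover have "\<pi> v - v \<in> pm.span (box_elem ` {x \<in> box_indices n. pbw_deg x \<le> s} \<union> weyl_ideal n)"
    using pi_diff by (intro pm.span_base) simp
  ultimately have "\<pi> v - (\<pi> v - v) \<in> pm.span (box_elem ` {x \<in> box_indices n. pbw_deg x \<le> s} \<union> weyl_ideal n)"
    by (rule pm.span_diff)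
  then show ?thesis by simp
qed

lemma pbw_filtration_filt: "v \<in> pbw_filtration n s \<Longrightarrow> \<pi> v \<in> filt s"
proof (induction s arbitrary: v)
  case 0
  then have "v \<in> pm.span (weyl_ideal n \<union> {1})" by (simp add: fscale_eq_cscale)
  then show ?case
  proof (induction rule: pm_span_induct)
    case (scale_add c b y)
    have "\<pi> b \<in> filt 0"
    proof (cases "b = 1")
      case True then show ?thesis using w_filt by simp
    next
      case False
      then have "\<pi> b = 0" using scale_add(1) pi_zero_iff by blast
      then show ?thesis using pm.subspace_0[OF subspace_filt] by metis
    qed
    then show ?case using scale_add(2)
      by (simp add: pi_add pi_scale pm.subspace_add[OF subspace_filt] pm.subspace_scale[OF subspace_filt]
          del: filt.simps)
  qed (simp add: pi_zero pm.subspace_0[OF subspace_filt] del: filt.simps)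
next
  case (Suc s)
  from Suc.prems have "v \<in> pm.span (pbw_filtration n s
       \<union> {cur y i * v |y i v. y \<in> {Osp_e, Osp_gp} \<and> v \<in> pbw_filtration n s})"
    by (simp add: fscale_eq_cscale)
  then show ?case
  proof (induction rule: pm_span_induct)
    case (scale_add c b z)
    have "\<pi> b \<in> filt (Suc s)"
    proof (cases "b \<in> pbw_filtration n s")
      case True then show ?thesis using Suc.IH filt_Suc by blast
    next
      case False
      then obtain y i u where b: "b = cur y i * u" "y \<in> {Osp_e, Osp_gp}" "u \<in> pbw_filtration n s"
        using scale_add(1) by blast
      have "\<pi> b = \<pi> (cur y i * \<pi> u)" by (simp add: b pi_mult)
      then show ?thesis using b(2) filt_E[OF Suc.IH[OF b(3)], of i] filt_G[OF Suc.IH[OF b(3)], of i] by auto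
    qed
    then show ?case using scale_add(2)
      by (simp add: pi_add pi_scale pm.subspace_add[OF subspace_filt] pm.subspace_scale[OF subspace_filt])
  qed (simp add: pi_zero pm.subspace_0[OF subspace_filt])
qed

end

lemma weyl_projection_exists: obtains \<pi> where "weyl_projection \<pi> n"
  by (rule pm.exists_projection[OF subspace_weyl_ideal[of n]]) (rule that, unfold_locales)

lemma pbw_filtration_span:
  assumes "v \<in> pbw_filtration n s"
  shows "v \<in> pm.span (box_elem ` {x \<in> box_indices n. pbw_deg x \<le> s} \<union> weyl_ideal n)"
proof -
  obtain \<pi> where "weyl_projection \<pi> n" by (rule weyl_projection_exists)
  then interpret weyl_projection \<pi> n .
  show ?thesis by (rule filt_pi_span[OF pbw_filtration_filt[OF assms]])
qed

lemma box_elem_span: "p \<in> pm.span (box_elem ` box_indices n \<union> weyl_ideal n)"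
proof -
  obtain \<pi> where "weyl_projection \<pi> n" by (rule weyl_projection_exists)
  then interpret weyl_projection \<pi> n .
  obtain s where "\<pi> p \<in> filt s" using ev_filt[of p] by (auto simp: ev_pi)
  then have "p \<in> pm.span (box_elem ` {x \<in> box_indices n. pbw_deg x \<le> s} \<union> weyl_ideal n)"
    by (rule filt_pi_span)
  also have "\<dots> \<subseteq> pm.span (box_elem ` box_indices n \<union> weyl_ideal n)"
    by (intro pm.span_mono) auto
  finally show ?thesis .
qed

subsection \<open>Counting\<close>

definition boxes :: "nat \<Rightarrow> nat \<Rightarrow> nat list set" where
  "boxes k M = {a. length a = k \<and> sum_list a \<le> M}"

lemma boxes_0: "boxes 0 M = {[]}"
  by (auto simp: boxes_def)

lemma boxes_Suc_0: "boxes (Suc k) 0 = Cons 0 ` boxes k 0"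
  by (auto simp: boxes_def length_Suc_conv image_iff)

lemma boxes_Suc_Suc:
  "boxes (Suc k) (Suc M) = Cons 0 ` boxes k (Suc M) \<union> (\<lambda>a. Suc (hd a) # tl a) ` boxes (Suc k) M"
  (is "?L = ?R1 \<union> ?R2")
proof (intro equalityI subsetI)
  fix a assume "a \<in> ?L"
  then obtain x xs where a: "a = x # xs" "length xs = k" "x + sum_list xs \<le> Suc M"
    by (auto simp: boxes_def length_Suc_conv)
  show "a \<in> ?R1 \<union> ?R2"
  proof (cases x)
    case 0 then show ?thesis using a by (auto simp: boxes_def)
  next
    case (Suc y)
    then have "a = (\<lambda>a. Suc (hd a) # tl a) (y # xs)" "y # xs \<in> boxes (Suc k) M"
      using a by (auto simp: boxes_def)
    then show ?thesis by blast
  qed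
qed (auto simp: boxes_def length_Suc_conv)

lemma finite_boxes [simp]: "finite (boxes k M)"
proof (induction k arbitrary: M)
  case (Suc k)
  note k = Suc
  show ?case
  proof (induction M)
    case 0 then show ?case using k by (simp add: boxes_Suc_0)
  next
    case (Suc M) then show ?case using k by (simp add: boxes_Suc_Suc)
  qed
qed (simp add: boxes_0)

lemma sum_boxes: "(\<Sum>a\<in>boxes k M. p ^ wsum a) = qbin p k M" for p :: complex
proof (induction p k M rule: qbin.induct)
  case (1 p M) then show ?case by (simp add: boxes_0)
next
  case (2 p k)
  have "(\<Sum>a\<in>boxes k 0. p ^ wsum a) = 1"
    by (induction k) (auto simp: boxes_0 boxes_Suc_0 sum.reindex)
  then show ?case by (simp add: boxes_Suc_0 sum.reindex o_def)
next
  case (3 p k M)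
  have inj: "inj_on (\<lambda>a. Suc (hd a) # tl a) (boxes (Suc k) M)"
  proof (rule inj_onI)
    fix a b assume "a \<in> boxes (Suc k) M" "b \<in> boxes (Suc k) M" "Suc (hd a) # tl a = Suc (hd b) # tl b"
    then show "a = b" by (cases a; cases b; simp add: boxes_def)
  qed
  have "(\<Sum>a\<in>boxes (Suc k) (Suc M). p ^ wsum a) = (\<Sum>a\<in>Cons 0 ` boxes k (Suc M). p ^ wsum a)
      + (\<Sum>a\<in>(\<lambda>a. Suc (hd a) # tl a) ` boxes (Suc k) M. p ^ wsum a)"
    unfolding boxes_Suc_Suc by (rule sum.union_disjoint) auto
  also have "(\<Sum>a\<in>Cons 0 ` boxes k (Suc M). p ^ wsum a) = qbin p k (Suc M)"
    using 3(1) by (subst sum.reindex) auto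
  also have "(\<Sum>a\<in>(\<lambda>a. Suc (hd a) # tl a) ` boxes (Suc k) M. p ^ wsum a)
      = (\<Sum>a\<in>boxes (Suc k) M. p ^ Suc k * p ^ wsum a)"
    by (subst sum.reindex[OF inj], intro sum.cong refl)
      (auto simp: boxes_def length_Suc_conv power_add algebra_simps)
  also have "\<dots> = p ^ Suc k * qbin p (Suc k) M"
    by (simp only: 3(2) flip: sum_distrib_left)
  finally show ?case by simp
qed

text \<open>With \<open>M = n - (k + r)\<close> the bounds on the exponent sums are \<open>M\<close>
  and \<open>M + k\<close>, the sides of the boxes in \<open>qtri\<close>.\<close>

lemma box_indices_Sigma:
  "box_indices n = (\<lambda>((M, r, k), a, b). (k, r, a, b)) `
     (SIGMA (M, r, k):triples n. boxes k M \<times> boxes r (M + k))"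
proof (intro equalityI subsetI)
  fix x assume "x \<in> box_indices n"
  then obtain k r a b where x: "x = (k, r, a, b)" "k + r \<le> n" "length a = k" "length b = r"
    "sum_list a \<le> n - (k + r)" "sum_list b \<le> n - r"
    by (auto simp: box_indices_def)
  then have "((n - (k + r), r, k), a, b) \<in> (SIGMA (M, r, k):triples n. boxes k M \<times> boxes r (M + k))"
    by (auto simp: triples_def boxes_def)
  then show "x \<in> (\<lambda>((M, r, k), a, b). (k, r, a, b)) `
     (SIGMA (M, r, k):triples n. boxes k M \<times> boxes r (M + k))"
    unfolding x(1) by (rule rev_image_eqI) simp
qed (auto simp: box_indices_def triples_def boxes_def)

lemma finite_box_indices [simp]: "finite (box_indices n)"
  unfolding box_indices_Sigma by (intro finite_imageI finite_SigmaI) auto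

lemma sum_box_indices:
  fixes F :: "box_index \<Rightarrow> complex"
  shows "(\<Sum>x\<in>box_indices n. F x)
    = (\<Sum>(M, r, k)\<in>triples n. \<Sum>a\<in>boxes k M. \<Sum>b\<in>boxes r (M + k). F (k, r, a, b))"
proof -
  have inj: "inj_on (\<lambda>((M, r, k), a, b). (k, r, a, b)) (SIGMA (M, r, k):triples n. boxes k M \<times> boxes r (M + k))"
    by (auto simp: inj_on_def triples_def)
  have "(\<Sum>x\<in>box_indices n. F x)
    = (\<Sum>((M, r, k), a, b)\<in>(SIGMA (M, r, k):triples n. boxes k M \<times> boxes r (M + k)). F (k, r, a, b))"
    unfolding box_indices_Sigma by (subst sum.reindex[OF inj]) (auto simp: split_def)
  also have "\<dots> = (\<Sum>(M, r, k)\<in>triples n. \<Sum>(a, b)\<in>boxes k M \<times> boxes r (M + k). F (k, r, a, b))"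
    by (subst sum.Sigma[symmetric]) (auto simp: split_def)
  also have "\<dots> = (\<Sum>(M, r, k)\<in>triples n. \<Sum>a\<in>boxes k M. \<Sum>b\<in>boxes r (M + k). F (k, r, a, b))"
    by (auto simp: sum.cartesian_product intro!: sum.cong)
  finally show ?thesis .
qed

definition box_weight :: "nat \<Rightarrow> box_index \<Rightarrow> int" where
  "box_weight n = (\<lambda>(k, r, a, b). 2 * int k + int r - int n)"

lemma sum_lessThan_triangle: "\<Sum>{..<r} = triangle r"
  by (induction r) auto

lemma sum_box_trisum:
  "(\<Sum>y\<in>box_indices n. u ^ pbw_deg y * p ^ box_tdeg y * x powi box_weight n y)
    = trisum (\<lambda>M r k. u ^ (k + r) * p ^ triangle r) p x n"
proof -
  have "(\<Sum>a\<in>boxes k M. \<Sum>b\<in>boxes r (M + k). u ^ pbw_deg (k, r, a, b) * p ^ box_tdeg (k, r, a, b) * x powi box_weight n (k, r, a, b))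
     = u ^ (k + r) * p ^ triangle r * qtri p M r k * x powi (int k - int M)" if "M + r + k = n" for M r k
  proof -
    have w: "2 * int k + int r - int n = int k - int M" using that by auto
    have "(\<Sum>a\<in>boxes k M. \<Sum>b\<in>boxes r (M + k). u ^ pbw_deg (k, r, a, b) * p ^ box_tdeg (k, r, a, b) * x powi box_weight n (k, r, a, b))
      = (\<Sum>a\<in>boxes k M. \<Sum>b\<in>boxes r (M + k). (u ^ (k + r) * p ^ triangle r * x powi (int k - int M)) * (p ^ wsum a * p ^ wsum b))"
      by (intro sum.cong refl)
        (simp add: pbw_deg_def box_tdeg_def box_weight_def w sum_lessThan_triangle power_add)
    also have "\<dots> = (u ^ (k + r) * p ^ triangle r * x powi (int k - int M))
        * ((\<Sum>a\<in>boxes k M. p ^ wsum a) * (\<Sum>b\<in>boxes r (M + k). p ^ wsum b))"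
      unfolding sum_product by (simp only: sum_distrib_left)
    finally show ?thesis by (simp add: sum_boxes qtri_def)
  qed
  then show ?thesis
    unfolding sum_box_indices trisum_def by (intro sum.cong) (auto simp: triples_def)
qed

text \<open>With all parameters equal to 1 the recursion of \<open>trisum_zero_rec\<close> triples
  both components.\<close>

lemma card_box_indices: "card (box_indices n) = 3 ^ n"
proof -
  have "(of_nat (card (box_indices n)) :: complex)
      = (\<Sum>y\<in>box_indices n. 1 ^ pbw_deg y * 1 ^ box_tdeg y * 1 powi box_weight n y)" by simp
  also have "\<dots> = trisum (\<lambda>M r k. 1 ^ triangle r) 1 1 n"
    unfolding sum_box_trisum by simp
  also have "\<dots> = 3 ^ n"
  proof -
    have "trisum (\<lambda>M r k. 1 ^ triangle r) 1 1 N = 3 ^ N \<and>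
        trisum (\<lambda>M r k. 1 ^ (triangle r + (M + r))) 1 1 N = (3 :: complex) ^ N" for N
    proof (induction N)
      case 0 then show ?case using trisum_zero_rec(1,2)[of 1 1] by simp
    next
      case (Suc N)
      have "(1::complex) \<noteq> 0" by simp
      note r = trisum_zero_rec(3,4)[OF this, of 1 N]
      show ?case unfolding r using Suc by simp
    qed
    then show ?thesis by blast
  qed
  finally have "(of_nat (card (box_indices n)) :: complex) = of_nat (3 ^ n)" by simp
  then show ?thesis by (simp only: of_nat_eq_iff)
qed

lemma (in cvector_space) span_image_Un_coeffs:
  assumes "finite A" "subspace I" "p \<in> span (f ` A \<union> I)"
  obtains c where "p - (\<Sum>x\<in>A. scale (c x) (f x)) \<in> I"
proof -
  have "\<exists>c. p - (\<Sum>x\<in>A. scale (c x) (f x)) \<in> I"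
    using assms(3)
  proof (induction rule: span_induct_alt)
    case base
    have "0 - (\<Sum>x\<in>A. scale 0 (f x)) \<in> I" using subspace_0[OF assms(2)] by simp
    then show ?case by (rule exI[of _ "\<lambda>x. 0"])
  next
    case (step a b y)
    then obtain c where c: "y - (\<Sum>x\<in>A. scale (c x) (f x)) \<in> I" by blast
    show ?case
    proof (cases "b \<in> I")
      case True
      have "scale a b + (y - (\<Sum>x\<in>A. scale (c x) (f x))) \<in> I"
        by (intro subspace_add[OF assms(2)] subspace_scale[OF assms(2)] True c)
      then show ?thesis by (intro exI[of _ c]) (simp add: algebra_simps)
    next
      case False
      then obtain x0 where x0: "x0 \<in> A" "b = f x0" using step(1) by blast
      define c' where "c' = (\<lambda>x. c x + (if x = x0 then a else 0))"
      have "(\<Sum>x\<in>A. scale (c' x) (f x)) = (\<Sum>x\<in>A. scale (c x) (f x)) + (\<Sum>x\<in>A. if x = x0 then scale a (f x) else 0)"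
        unfolding sum.distrib[symmetric] c'_def by (intro sum.cong refl) (simp add: scale_left_distrib)
      also have "(\<Sum>x\<in>A. if x = x0 then scale a (f x) else 0) = scale a b"
        using x0 assms(1) by simp
      finally have eq: "scale a b + y - (\<Sum>x\<in>A. scale (c' x) (f x)) = y - (\<Sum>x\<in>A. scale (c x) (f x))" by simp
      then show ?thesis using c by (intro exI[of _ c']) (simp only: eq)
    qed
  qed
  then show ?thesis using that by blast
qed

lemma homog_box_expansion:
  assumes "homog d p"
  obtains c where "p - (\<Sum>x\<in>{x \<in> box_indices n. box_tdeg x = d}. cscale (c x) (box_elem x)) \<in> weyl_ideal n"
proof -
  obtain c where c: "p - (\<Sum>x\<in>box_indices n. cscale (c x) (box_elem x)) \<in> weyl_ideal n"
    by (rule pm.span_image_Un_coeffs[OF finite_box_indices subspace_weyl_ideal box_elem_span])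
  have "hpart d (\<Sum>x\<in>box_indices n. cscale (c x) (box_elem x))
      = (\<Sum>x\<in>box_indices n. if box_tdeg x = d then cscale (c x) (box_elem x) else 0)"
    unfolding hpart_simps by (intro sum.cong refl) (simp add: hpart_homog[OF homog_box_elem])
  also have "\<dots> = (\<Sum>x\<in>{x \<in> box_indices n. box_tdeg x = d}. cscale (c x) (box_elem x))"
    by (rule sum.inter_filter[symmetric]) simp
  finally have eq: "hpart d (p - (\<Sum>x\<in>box_indices n. cscale (c x) (box_elem x)))
     = p - (\<Sum>x\<in>{x \<in> box_indices n. box_tdeg x = d}. cscale (c x) (box_elem x))"
    using hpart_homog[OF assms, of d] by (simp add: hpart_simps(2))
  show ?thesis by (rule that) (rule hpart_weyl_ideal[OF c, of d, unfolded eq])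
qed

subsection \<open>Linear independence\<close>

context
  fixes n :: nat
begin

text \<open>Distinct numbers, so that interpolation makes the ground vector cyclic.\<close>

definition points :: "complex list" where
  "points = map of_nat [0..<n]"

lemma length_points: "length points = n" and distinct_points: "distinct points"
  by (simp_all add: points_def distinct_map inj_on_def)

abbreviation "tensor_ev \<equiv> osp_module.ev fun_scale (tensor_act points)"

abbreviation "tev \<equiv> tensor_ev (ground n)"

text \<open>The relations of $W_{-n}$ are not satisfied by the generator of the tensor product, on which $h_i$
  acts by a power sum; of their homogeneous components of degree \<open>d\<close> only the membership in \<open>tlow d\<close> is
  true, and this is all that is needed.\<close>

definition tlow :: "nat \<Rightarrow> (nat list \<Rightarrow> complex) set" where
  "tlow d = tensor.span {tev (single x 1) |x. tdeg x < d}"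

lemma tensor_lowering: "y \<in> {Osp_f, Osp_gm} \<Longrightarrow> tensor_act points y i (ground n) = 0"
  using weighted_act_lowering[of y "map (\<lambda>z. z ^ i) points"]
  by (intro ext) (simp add: tensor_act_def length_points)

lemma tensor_h: "tensor_act points Osp_h i (ground n) = fun_scale (- (\<Sum>z\<leftarrow>points. z ^ i)) (ground n)"
  using weighted_act_h[of "map (\<lambda>z. z ^ i) points"]
  by (intro ext) (simp add: tensor_act_def fun_scale_def length_points)

lemma tensor_e: "tev (cur Osp_e 0 ^ Suc n) = 0"
proof -
  have pow: "tev (cur Osp_e 0 ^ m) = (tensor_act points Osp_e 0 ^^ m) (ground n)" for m
    by (induction m) (simp_all add: tensor.ev_mult power_commutes tensor.ev_cur del: power_Suc flip: power_Suc2
        , simp add: power_Suc tensor.ev_mult)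
  have "(tensor_act points Osp_e 0 ^^ Suc n) (ground n) l = 0" for l
  proof (rule ccontr)
    assume "(tensor_act points Osp_e 0 ^^ Suc n) (ground n) l \<noteq> 0"
    from tensor_e_power[OF this] have "Suc n \<le> count_list l 2" "length l = n" by simp_all
    moreover have "count_list l 2 \<le> length l" by (rule count_le_length)
    ultimately show False by simp
  qed
  then show ?thesis unfolding pow by (intro ext) (simp only: zero_fun_apply)
qed

text \<open>The generators map to zero, except possibly those from \<open>h_i\<close> with
  \<open>i \<ge> 1\<close>. There the image is a multiple of that of a word whose t-degree is
  smaller by \<open>i\<close>.\<close>

lemma tev_hpart_gen:
  assumes "g \<in> weyl_gens n"
  shows "tev (hpart d g) \<in> tlow d"
proof -
  have sub: "tensor.subspace (tlow d)" by (simp add: tlow_def)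
  note zero = tensor.subspace_0[OF sub]
  have hp: "tev (hpart d g) \<in> tlow d" if "homog e g" "tev g \<in> tlow e" for e
  proof (cases "d = e")
    case True then show ?thesis using that by (simp add: hpart_homog)
  next
    case False
    then have "hpart d g = 0" using that(1) by (simp add: hpart_homog)
    then show ?thesis using zero by (simp only: tensor.ev_simps(5))
  qed
  have z: "0 \<in> tlow e" for e unfolding tlow_def by (rule tensor.span_zero)
  consider x y i z j x' where "g = single x 1 * super_rel y i z j * single x' 1"
    | x r where "g = single x 1 * r" "r \<in> weyl_rels n"
    using assms unfolding weyl_gens_def by blast
  then show ?thesis
  proof cases
    case 1
    have "homog (tdeg x + (i + j) + tdeg x') g"
      unfolding 1 by (intro homog_mult homog_single homog_super_rel refl)
    moreover have "tev g = 0" unfolding 1 by (simp add: tensor.ev_mult tensor.ev_super_rel tensor.ev_simps(5))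
    ultimately show ?thesis using hp z by metis
  next
    case 2
    have g: "tev g = tensor_ev (tev r) (single x 1)" unfolding 2 by (rule tensor.ev_mult)
    obtain e where e: "homog e r" using homog_weyl_rels[OF 2(2)] by blast
    have he: "homog (tdeg x + e) g" if "homog e r" for e
      unfolding 2 by (intro homog_mult homog_single refl that)
    consider "tev r = 0" | i where "r = cur Osp_h i" "1 \<le> i"
    proof -
      from 2(2) consider y i where "r = cur y i" "y \<in> {Osp_f, Osp_gm, Osp_h}" "i \<ge> 1"
        | "r = cur Osp_f 0" | "r = cur Osp_gm 0"
        | "r = cur Osp_h 0 + fscale (of_nat n) 1" | "r = cur Osp_e 0 ^ Suc n"
        unfolding weyl_rels_def by auto
      then show ?thesis
      proof cases
        case 1
        then show ?thesis using that tensor_lowering[of y i] by (cases "y = Osp_h") (auto simp: tensor.ev_cur)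
      next
        case 4
        have "(\<Sum>z\<leftarrow>points. z ^ 0) = (of_nat n :: complex)"
          by (simp add: points_def o_def sum_list_triv)
        then have "tev r = 0"
          unfolding 4 fscale_eq_cscale
          by (intro ext) (simp add: tensor.ev_simps tensor.ev_cur tensor_h fun_scale_def del: power_0)
        then show ?thesis by (rule that(1))
      qed (use that tensor_lowering tensor_e in \<open>auto simp: tensor.ev_cur\<close>)
    qed
    then show ?thesis
    proof cases
      case 1
      then show ?thesis using hp[OF he[OF e]] z g by simp
    next
      case (2 i)
      define k where "k = - (\<Sum>z\<leftarrow>points. z ^ i)"
      have "tev r = fun_scale k (ground n)"
        unfolding 2 k_def by (rule trans[OF tensor.ev_cur tensor_h])
      then have "tev g = fun_scale k (tev (single x 1))"
        unfolding g by (simp only: tensor.ev_def tensor.linext_single tensor.wact_scale tensor.scale_one)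
      moreover have "tev (single x 1) \<in> tlow (tdeg x + i)"
        unfolding tlow_def using 2 by (intro tensor.span_base) auto
      ultimately have "tev g \<in> tlow (tdeg x + i)"
        unfolding tlow_def by (simp add: tensor.span_scale)
      then show ?thesis using hp[OF he[of i]] homog_cur 2 by simp
    qed
  qed
qed

lemma tev_hpart_ideal:
  assumes "p \<in> weyl_ideal n"
  shows "tev (hpart d p) \<in> tlow d"
proof -
  have sub: "tensor.subspace (tlow d)" by (simp add: tlow_def)
  show ?thesis
    using assms unfolding weyl_ideal_gens
  proof (induction rule: pm_span_induct)
    case zero show ?case unfolding hpart_simps tensor.ev_simps(5) by (rule tensor.subspace_0[OF sub])
  next
    case (scale_add c g y)
    show ?case
      unfolding hpart_simps tensor.ev_simps
      by (rule tensor.subspace_add[OF sub tensor.subspace_scale[OF sub tev_hpart_gen[OF scale_add(1)]] scale_add(2)])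
  qed
qed

text \<open>A word of degree below \<open>d\<close> is, modulo the ideal, a combination of box
  elements of its own degree. The discarded element of the ideal is homogeneous of that degree and
  maps to a smaller \<open>tlow\<close>, which the induction covers.\<close>

lemma tlow_box_span: "tlow d \<subseteq> tensor.span ((\<lambda>x. tev (box_elem x)) ` {x \<in> box_indices n. box_tdeg x < d})"
proof (induction d rule: less_induct)
  case (less d)
  let ?B = "\<lambda>d. (\<lambda>x. tev (box_elem x)) ` {x \<in> box_indices n. box_tdeg x < d}"
  have "tev (single x 1) \<in> tensor.span (?B d)" if x: "tdeg x < d" for x
  proof -
    let ?e = "tdeg x"
    let ?I = "{y \<in> box_indices n. box_tdeg y = ?e}"
    have hx: "homog ?e (single x 1)" by (rule homog_single) simp
    obtain c where c: "single x 1 - (\<Sum>y\<in>?I. cscale (c y) (box_elem y)) \<in> weyl_ideal n"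
      by (rule homog_box_expansion[OF hx])
    let ?q = "single x 1 - (\<Sum>y\<in>?I. cscale (c y) (box_elem y))"
    have "homog ?e ?q"
      using homog_box_elem by (intro homog_diff hx homog_sum homog_cscale) (metis (mono_tags, lifting) mem_Collect_eq)
    then have "hpart ?e ?q = ?q" by (simp add: hpart_homog)
    then have "tev ?q \<in> tlow ?e" using tev_hpart_ideal[OF c, of ?e] by simp
    also have "\<dots> \<subseteq> tensor.span (?B ?e)" by (rule less[OF x])
    also have "\<dots> \<subseteq> tensor.span (?B d)" using x by (intro tensor.span_mono) auto
    finally have q: "tev ?q \<in> tensor.span (?B d)" .
    have s: "(\<Sum>y\<in>?I. fun_scale (c y) (tev (box_elem y))) \<in> tensor.span (?B d)"
      using x by (intro tensor.span_sum tensor.span_scale tensor.span_base) auto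
    have "tev (single x 1) = tev ?q + (\<Sum>y\<in>?I. fun_scale (c y) (tev (box_elem y)))"
      by (simp only: tensor.ev_simps diff_add_cancel)
    then show ?thesis using tensor.span_add[OF q s] by simp
  qed
  then show ?case unfolding tlow_def by (intro tensor.span_minimal) auto
qed

lemma tev_box_span: "tev p \<in> tensor.span ((\<lambda>x. tev (box_elem x)) ` box_indices n)"
proof (induction p rule: pm_induct)
  case zero then show ?case by (simp only: tensor.ev_simps tensor.span_zero)
next
  case (single x c)
  have "tev (single x 1) \<in> tlow (Suc (tdeg x))"
    unfolding tlow_def by (intro tensor.span_base) auto
  then have "tev (single x 1) \<in> tensor.span ((\<lambda>x. tev (box_elem x)) ` {y \<in> box_indices n. box_tdeg y < Suc (tdeg x)})"
    using tlow_box_span by blast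
  also have "\<dots> \<subseteq> tensor.span ((\<lambda>x. tev (box_elem x)) ` box_indices n)"
    by (intro tensor.span_mono) auto
  finally have "tev (cscale c (single x 1)) \<in> tensor.span ((\<lambda>x. tev (box_elem x)) ` box_indices n)"
    unfolding tensor.ev_simps by (rule tensor.span_scale)
  then show ?case by simp
next
  case (add p q)
  then show ?case unfolding tensor.ev_simps by (rule tensor.span_add)
qed

text \<open>The image of \<open>tev\<close> is a submodule containing the ground vector, hence
  contains \<open>3 ^ n\<close> independent basis functions. It is spanned by the images of
  \<open>3 ^ n\<close> box elements, so these must be distinct and independent.\<close>

lemma tev_box_basis:
  "tensor.independent ((\<lambda>x. tev (box_elem x)) ` box_indices n)" (is "tensor.independent ?B")
  "inj_on (\<lambda>x. tev (box_elem x)) (box_indices n)"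
proof -
  define U where "U = range tev"
  have sub: "tensor.subspace U"
    unfolding tensor.subspace_def U_def
    using tensor.ev_simps(1,3,5)[symmetric] by (auto simp: image_def) metis+
  have act: "tensor_act points y i \<psi> \<in> U" if "\<psi> \<in> U" for y i \<psi>
    using that tensor.ev_mult[of points "ground n" "cur y i"] unfolding U_def by (auto simp: tensor.ev_cur image_def) metis
  have w: "ground n \<in> U" unfolding U_def using tensor.ev_one[of points "ground n"] by (metis rangeI)
  have mem: "basis_fun l \<in> U" if "l \<in> words3 n" for l
    by (rule basis_fun_mem[OF sub act distinct_points length_points w that])
  have words: "basis_fun ` words3 n \<subseteq> tensor.span ?B"
  proof (rule image_subsetI)
    fix l assume "l \<in> words3 n"
    from mem[OF this] obtain p where "basis_fun l = tev p" unfolding U_def by blast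
    then show "basis_fun l \<in> tensor.span ?B" by (simp only: tev_box_span)
  qed
  have inj: "inj_on basis_fun (words3 n)"
    by (auto simp: inj_on_def basis_fun_def fun_eq_iff split: if_splits)
  have lower: "3 ^ n \<le> card B" if "finite B" "basis_fun ` words3 n \<subseteq> tensor.span B" for B
    using tensor.independent_span_bound[OF that(1) independent_basis_fun that(2)] card_image[OF inj] card_words3[of n]
    by simp
  have fin: "finite ?B" by simp
  have le: "card ?B \<le> 3 ^ n" using card_image_le[OF finite_box_indices] card_box_indices by metis
  have card: "card ?B = 3 ^ n" using lower[OF fin words] le by simp
  show "inj_on (\<lambda>x. tev (box_elem x)) (box_indices n)"
    using card card_box_indices[of n] by (intro eq_card_imp_inj_on) auto
  show "tensor.independent ?B"
  proof
    assume "tensor.dependent ?B"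
    then obtain b where b: "b \<in> ?B" "b \<in> tensor.span (?B - {b})" unfolding tensor.dependent_def by blast
    have "tensor.span ?B \<subseteq> tensor.span (?B - {b})"
    proof (rule tensor.span_minimal[OF subsetI tensor.subspace_span])
      fix v assume "v \<in> ?B"
      then show "v \<in> tensor.span (?B - {b})"
        using b(2) by (cases "v = b") (blast intro: tensor.span_base)+
    qed
    then have "3 ^ n \<le> card (?B - {b})" using words fin by (intro lower) auto
    moreover have "card (?B - {b}) < card ?B" using b fin by (intro psubset_card_mono) auto
    ultimately show False using card by simp
  qed
qed

lemma tev_box_family:
  assumes "(\<Sum>x\<in>box_indices n. fun_scale (c x) (tev (box_elem x))) = 0" "x \<in> box_indices n"
  shows "c x = 0"
proof -
  let ?f = "\<lambda>x. tev (box_elem x)"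
  define g where "g = the_inv_into (box_indices n) ?f"
  have g: "g (?f y) = y" if "y \<in> box_indices n" for y
    unfolding g_def using tev_box_basis(2) that by (rule the_inv_into_f_f)
  have "(\<Sum>v\<in>?f ` box_indices n. fun_scale (c (g v)) v) = (\<Sum>x\<in>box_indices n. fun_scale (c x) (?f x))"
    by (subst sum.reindex[OF tev_box_basis(2)]) (simp add: g)
  then have "(\<Sum>v\<in>?f ` box_indices n. fun_scale (c (g v)) v) = 0" using assms(1) by simp
  from tensor.independentD[OF tev_box_basis(1) _ subset_refl this, of "?f x"]
  show ?thesis using assms(2) by (simp add: g)
qed

text \<open>The component of t-degree \<open>d\<close> of a relation shows that a combination of
  images of box elements of degree \<open>d\<close> is one of images of box elements of lower
  degree. Independence in the tensor product then removes all coefficients.\<close>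

theorem box_elem_independent:
  assumes "(\<Sum>x\<in>box_indices n. cscale (c x) (box_elem x)) \<in> weyl_ideal n" "x0 \<in> box_indices n"
  shows "c x0 = 0"
proof -
  define d where "d = box_tdeg x0"
  let ?I = "{x \<in> box_indices n. box_tdeg x = d}" and ?J = "{x \<in> box_indices n. box_tdeg x < d}"
  have "hpart d (\<Sum>x\<in>box_indices n. cscale (c x) (box_elem x))
      = (\<Sum>x\<in>box_indices n. if box_tdeg x = d then cscale (c x) (box_elem x) else 0)"
    unfolding hpart_simps by (intro sum.cong refl) (simp add: hpart_homog[OF homog_box_elem])
  also have "\<dots> = (\<Sum>x\<in>?I. cscale (c x) (box_elem x))"
    by (rule sum.inter_filter[symmetric]) simp
  finally have "tev (\<Sum>x\<in>?I. cscale (c x) (box_elem x)) \<in> tlow d"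
    using tev_hpart_ideal[OF assms(1), of d] by simp
  then have "tev (\<Sum>x\<in>?I. cscale (c x) (box_elem x)) \<in> tensor.span ((\<lambda>x. tev (box_elem x)) ` ?J \<union> {0})"
    using tlow_box_span tensor.span_mono[of "(\<lambda>x. tev (box_elem x)) ` ?J" "(\<lambda>x. tev (box_elem x)) ` ?J \<union> {0}"] by blast
  then obtain c' where "tev (\<Sum>x\<in>?I. cscale (c x) (box_elem x)) - (\<Sum>x\<in>?J. fun_scale (c' x) (tev (box_elem x))) \<in> {0}"
    by (rule tensor.span_image_Un_coeffs[rotated 2]) (auto simp: tensor.subspace_def)
  then have 0: "(\<Sum>x\<in>?I. fun_scale (c x) (tev (box_elem x))) - (\<Sum>x\<in>?J. fun_scale (c' x) (tev (box_elem x))) = 0"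
    by (simp only: tensor.ev_simps singleton_iff)
  define c2 where "c2 x = (if box_tdeg x = d then c x else if box_tdeg x < d then - c' x else 0)" for x
  have "(\<Sum>x\<in>box_indices n. fun_scale (c2 x) (tev (box_elem x)))
     = (\<Sum>x\<in>box_indices n. (if box_tdeg x = d then fun_scale (c x) (tev (box_elem x)) else 0)
          - (if box_tdeg x < d then fun_scale (c' x) (tev (box_elem x)) else 0))"
    by (intro sum.cong refl) (auto simp: c2_def)
  also have "\<dots> = (\<Sum>x\<in>?I. fun_scale (c x) (tev (box_elem x))) - (\<Sum>x\<in>?J. fun_scale (c' x) (tev (box_elem x)))"
    unfolding sum_subtractf sum.inter_filter[OF finite_box_indices] ..
  also have "\<dots> = 0" by (rule 0)
  finally have "c2 x0 = 0" by (rule tev_box_family[OF _ assms(2)])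
  then show ?thesis by (simp add: c2_def d_def)
qed

end

section \<open>Characters\<close>

subsection \<open>Dimensions of quotients\<close>

lemma basis_modI:
  assumes "finite X" "inj_on f X" "f ` X \<subseteq> A" "A \<subseteq> pm.span (f ` X \<union> B)"
    and indep: "\<And>c x. (\<Sum>x\<in>X. cscale (c x) (f x)) \<in> B \<Longrightarrow> x \<in> X \<Longrightarrow> c x = 0"
  shows "basis_mod A B (f ` X)"
  unfolding basis_mod_def fscale_eq_cscale
proof (intro conjI allI impI ballI)
  show "f ` X \<subseteq> A" "A \<subseteq> pm.span (f ` X \<union> B)" by (rule assms)+
next
  fix T c v assume T: "finite T \<and> T \<subseteq> f ` X \<and> (\<Sum>v\<in>T. cscale (c v) v) \<in> B" and v: "v \<in> T"
  obtain x where x: "x \<in> X" "v = f x" using T v by blast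
  have fT: "f ` {x \<in> X. f x \<in> T} = T" using T by blast
  have "(\<Sum>x\<in>X. cscale (if f x \<in> T then c (f x) else 0) (f x))
      = (\<Sum>x\<in>X. if f x \<in> T then cscale (c (f x)) (f x) else 0)"
    by (intro sum.cong) auto
  also have "\<dots> = (\<Sum>x\<in>{x \<in> X. f x \<in> T}. cscale (c (f x)) (f x))"
    by (rule sum.inter_filter[symmetric]) (rule assms(1))
  also have "\<dots> = (\<Sum>v\<in>f ` {x \<in> X. f x \<in> T}. cscale (c v) v)"
    by (subst sum.reindex) (auto intro: inj_on_subset[OF assms(2)])
  also have "\<dots> = (\<Sum>v\<in>T. cscale (c v) v)" unfolding fT ..
  finally have "(\<Sum>x\<in>X. cscale (if f x \<in> T then c (f x) else 0) (f x)) \<in> B" using T by simp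
  from indep[OF this x(1)] show "c v = 0" using x v by simp
qed

text \<open>Steinitz exchange modulo \<open>B\<close>: each element of \<open>S\<close> is replaced
  by a representative in the span of \<open>T\<close>.\<close>

lemma card_le_mod_subspace:
  fixes S T B :: "free_alg set"
  assumes B: "pm.subspace B" and T: "finite T" and span: "S \<subseteq> pm.span (T \<union> B)"
    and indep: "\<And>R c v. finite R \<Longrightarrow> R \<subseteq> S \<Longrightarrow> (\<Sum>v\<in>R. cscale (c v) v) \<in> B \<Longrightarrow> v \<in> R \<Longrightarrow> c v = 0"
  shows "finite S \<and> card S \<le> card T"
proof (rule finite_if_finite_subsets_card_bdd)
  fix R assume R: "R \<subseteq> S" "finite R"
  have "\<exists>u. u \<in> pm.span T \<and> s - u \<in> B" if "s \<in> R" for s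
  proof -
    have "s \<in> pm.span ((\<lambda>t. t) ` T \<union> B)" using that R span by auto
    then obtain c where "s - (\<Sum>t\<in>T. cscale (c t) t) \<in> B"
      by (rule pm.span_image_Un_coeffs[OF T B])
    then show ?thesis by (intro exI[of _ "\<Sum>t\<in>T. cscale (c t) t"]) (auto intro: pm.span_sum pm.span_scale pm.span_base)
  qed
  then obtain u where u: "\<And>s. s \<in> R \<Longrightarrow> u s \<in> pm.span T" "\<And>s. s \<in> R \<Longrightarrow> s - u s \<in> B" by metis
  have rel: "a s = 0" if "(\<Sum>s\<in>R. cscale (a s) (u s)) = 0" "s \<in> R" for a s
  proof -
    have "(\<Sum>s\<in>R. cscale (a s) s) = (\<Sum>s\<in>R. cscale (a s) (s - u s))"
      using that(1) by (simp add: pm.scale_right_diff_distrib sum_subtractf)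
    also have "\<dots> \<in> B" using u(2) by (intro pm.subspace_sum[OF B] pm.subspace_scale[OF B])
    finally show ?thesis using indep[OF R(2,1)] that(2) by blast
  qed
  have inj: "inj_on u R"
  proof (rule inj_onI, rule ccontr)
    fix s s' assume s: "s \<in> R" "s' \<in> R" "u s = u s'" "s \<noteq> s'"
    let ?a = "\<lambda>x. if x = s then 1 else if x = s' then -1 else (0::complex)"
    have "(\<Sum>x\<in>R. cscale (?a x) (u x)) = (\<Sum>x\<in>R. (if x = s then u s else 0) - (if x = s' then u s' else 0))"
      using s(4) by (intro sum.cong) auto
    also have "\<dots> = 0" using s R(2) by (simp add: sum_subtractf)
    finally show False using rel[of ?a s] s by simp
  qed
  have "pm.independent (u ` R)"
  proof
    assume "pm.dependent (u ` R)"
    then obtain b v where b: "v \<in> u ` R" "b v \<noteq> 0" "(\<Sum>v\<in>u ` R. cscale (b v) v) = 0"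
      using R(2) by (auto simp: pm.dependent_finite)
    then have "(\<Sum>s\<in>R. cscale (b (u s)) (u s)) = 0" by (simp add: sum.reindex[OF inj])
    then show False using rel[of "\<lambda>s. b (u s)"] b by blast
  qed
  moreover have "u ` R \<subseteq> pm.span T" using u(1) by blast
  ultimately have "card (u ` R) \<le> card T" using pm.independent_span_bound[OF T] by blast
  then show "card R \<le> card T" using card_image[OF inj] by simp
qed

text \<open>A finite basis bounds the size of every other one, so the choice made in
  \<open>quot_dim\<close> is immaterial.\<close>

lemma quot_dim_eq:
  assumes "pm.subspace B" "basis_mod A B S" "finite S"
  shows "quot_dim A B = card S"
proof -
  define S' where "S' = (SOME S. basis_mod A B S)"
  have S': "basis_mod A B S'" unfolding S'_def using assms(2) by (rule someI)
  have le: "finite S1 \<and> card S1 \<le> card S2" if S1: "basis_mod A B S1" and S2: "basis_mod A B S2" "finite S2" for S1 S2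
  proof (rule card_le_mod_subspace[OF assms(1) S2(2)])
    have "S1 \<subseteq> A" using S1 by (simp add: basis_mod_def)
    also have "A \<subseteq> pm.span (S2 \<union> B)" using S2(1) by (simp add: basis_mod_def fscale_eq_cscale)
    finally show "S1 \<subseteq> pm.span (S2 \<union> B)" .
    fix R c v assume "finite R" "R \<subseteq> S1" "(\<Sum>v\<in>R. cscale (c v) v) \<in> B" "v \<in> R"
    then show "c v = 0" using S1 unfolding basis_mod_def fscale_eq_cscale by simp
  qed
  have "finite S' \<and> card S' \<le> card S" by (rule le[OF S' assms(2,3)])
  moreover from this have "card S \<le> card S'" using le[OF assms(2) S'] by simp
  ultimately show ?thesis by (simp add: quot_dim_def flip: S'_def)
qed

lemma infsum_fibers:
  fixes g h :: "_ \<Rightarrow> complex"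
  assumes "finite X"
  shows "(\<Sum>\<^sub>\<infinity>\<kappa>. g \<kappa> * (\<Sum>y\<in>{y \<in> X. f y = \<kappa>}. h y)) = (\<Sum>y\<in>X. g (f y) * h y)"
proof -
  have "(\<Sum>\<^sub>\<infinity>\<kappa>. g \<kappa> * (\<Sum>y\<in>{y \<in> X. f y = \<kappa>}. h y)) = (\<Sum>\<^sub>\<infinity>\<kappa>\<in>f ` X. g \<kappa> * (\<Sum>y\<in>{y \<in> X. f y = \<kappa>}. h y))"
  proof (rule infsum_cong_neutral)
    fix \<kappa> assume "\<kappa> \<in> UNIV - f ` X"
    then have "{y \<in> X. f y = \<kappa>} = {}" by blast
    then show "g \<kappa> * (\<Sum>y\<in>{y \<in> X. f y = \<kappa>}. h y) = 0" by (simp only: sum.empty mult_zero_right)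
  qed auto
  also have "\<dots> = (\<Sum>\<kappa>\<in>f ` X. g \<kappa> * (\<Sum>y\<in>{y \<in> X. f y = \<kappa>}. h y))"
    using assms by (intro infsum_finite) simp
  also have "\<dots> = (\<Sum>\<kappa>\<in>f ` X. \<Sum>y\<in>{y \<in> X. f y = \<kappa>}. g (f y) * h y)"
    unfolding sum_distrib_left by (intro sum.cong refl) auto
  also have "\<dots> = (\<Sum>y\<in>X. g (f y) * h y)"
    by (rule sum.image_gen[OF assms, symmetric])
  finally show ?thesis .
qed

subsection \<open>Weights\<close>

lemma (in weyl_rep) H_0_foldr_G: "H 0 (foldr G gs w) = scale (of_nat (length gs) - of_nat n) (foldr G gs w)"
proof (induction gs)
  case Nil then show ?case by (simp add: H_0_w scale_left_diff_distrib)
next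
  case (Cons g gs)
  have "H 0 (foldr G (g # gs) w) = scale (of_nat (length gs) - of_nat n) (foldr G (g # gs) w) + foldr G (g # gs) w"
    using Cons by (simp add: H_G act_scale)
  also have "\<dots> = scale (of_nat (length gs) - of_nat n + 1) (foldr G (g # gs) w)"
    by (simp only: scale_left_distrib scale_one)
  finally show ?case by (simp add: algebra_simps)
qed

lemma (in weyl_rep) H_0_phi: "H 0 (phi k r p) = scale (2 * of_nat k + of_nat r - of_nat n) (phi k r p)"
proof -
  have "H 0 (gmon k r \<alpha>) = scale (2 * of_nat k + of_nat r - of_nat n) (gmon k r \<alpha>)" for \<alpha>
  proof -
    let ?es = "map (lookup \<alpha>) [0..<k]" and ?v = "foldr G (map (lookup \<alpha>) [k..<k + r]) w"
    have "H 0 (foldr E ?es ?v) = scale (of_nat r - of_nat n) (foldr E ?es ?v) + (\<Sum>i<k. scale 2 (foldr E ?es ?v))"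
    proof -
      have "(\<Sum>i<k. scale 2 (foldr E (?es[i := ?es ! i + 0]) ?v)) = (\<Sum>i<k. scale 2 (foldr E ?es ?v))"
        by (intro sum.cong refl) (simp only: add_0_right list_update_id)
      then show ?thesis
        by (simp add: H_foldr_E H_0_foldr_G foldr_E_scale del: nth_map)
    qed
    also have "(\<Sum>i<k. scale 2 (foldr E ?es ?v)) = scale (of_nat k * 2) (foldr E ?es ?v)"
      by (simp add: sum_constant_nat_scale)
    also have "scale (of_nat r - of_nat n) (foldr E ?es ?v) + scale (of_nat k * 2) (foldr E ?es ?v)
        = scale (2 * of_nat k + of_nat r - of_nat n) (foldr E ?es ?v)"
      unfolding scale_left_distrib[symmetric] by (simp add: algebra_simps)
    finally show ?thesis by (simp add: gmon_def mon_def)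
  qed
  then have "H 0 (phi k r p) = linext (\<lambda>\<alpha>. scale (2 * of_nat k + of_nat r - of_nat n) (gmon k r \<alpha>)) p"
    unfolding phi_def by (subst linear_map_linext[where A = "H 0"]) (auto simp: act_add act_scale)
  also have "\<dots> = scale (2 * of_nat k + of_nat r - of_nat n) (phi k r p)"
    unfolding phi_def linext_def scale_sum_right by (intro sum.cong refl) (rule scale_left_commute)
  finally show ?thesis .
qed

lemma box_elem_weight:
  "cur Osp_h 0 * box_elem x - cscale (of_int (box_weight n x)) (box_elem x) \<in> weyl_ideal n"
proof -
  obtain \<pi> where "weyl_projection \<pi> n" by (rule weyl_projection_exists)
  then interpret weyl_projection \<pi> n .
  obtain k r a b where x: "x = (k, r, a, b)" by (cases x)
  have "\<pi> (cur Osp_h 0 * \<pi> (box_elem x)) = cscale (of_int (box_weight n x)) (\<pi> (box_elem x))"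
    using H_0_phi[of k r "box_poly x"] ev_box_elem[of x] ev_pi[of "box_elem x"]
    by (simp add: x box_vec_def box_weight_def)
  then have "\<pi> (cur Osp_h 0 * box_elem x - cscale (of_int (box_weight n x)) (box_elem x)) = 0"
    by (simp add: pi_minus pi_scale pi_mult)
  then show ?thesis using pi_zero_iff by blast
qed

lemma box_elem_inj: "inj_on box_elem (box_indices n)"
proof (rule inj_onI, rule ccontr)
  fix x y assume x: "x \<in> box_indices n" "y \<in> box_indices n" "box_elem x = box_elem y" "x \<noteq> y"
  let ?c = "\<lambda>z. if z = x then 1 else if z = y then -1 else (0::complex)"
  have "(\<Sum>z\<in>box_indices n. cscale (?c z) (box_elem z))
      = (\<Sum>z\<in>box_indices n. (if z = x then box_elem x else 0) - (if z = y then box_elem y else 0))"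
    using x(4) by (intro sum.cong) auto
  also have "\<dots> = 0" using x by (simp add: sum_subtractf)
  finally have "(\<Sum>z\<in>box_indices n. cscale (?c z) (box_elem z)) \<in> weyl_ideal n"
    using pm.subspace_0[OF subspace_weyl_ideal] by simp
  from box_elem_independent[OF this x(1)] show False by simp
qed

text \<open>Serves both characters. The box elements indexed by \<open>X\<close> represent a basis
  of the quotient of \<open>A\<close> by \<open>B\<close> and are eigenvectors of \<open>h_0\<close>
  modulo the ideal.\<close>

lemma weight_trace_box:
  assumes X: "X \<subseteq> box_indices n" and B: "pm.subspace B" "weyl_ideal n \<subseteq> B"
    and hB: "\<And>b. b \<in> B \<Longrightarrow> cur Osp_h 0 * b \<in> B"
    and A: "box_elem ` X \<subseteq> A" "A \<subseteq> pm.span (box_elem ` X \<union> B)"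
    and indep: "\<And>c x. (\<Sum>x\<in>X. cscale (c x) (box_elem x)) \<in> B \<Longrightarrow> x \<in> X \<Longrightarrow> c x = 0"
  shows "weight_trace A B x = (\<Sum>y\<in>X. x powi box_weight n y)"
proof -
  let ?w = "box_weight n"
  have fin: "finite X" using X by (rule finite_subset) simp
  have hw: "cur Osp_h 0 * box_elem y - cscale (of_int (?w y)) (box_elem y) \<in> B" for y
    using box_elem_weight B(2) by blast
  have "quot_dim (weight_space A B \<kappa>) B = card {y \<in> X. ?w y = \<kappa>}" for \<kappa>
  proof -
    let ?X = "{y \<in> X. ?w y = \<kappa>}"
    have inj: "inj_on box_elem ?X" using X by (intro inj_on_subset[OF box_elem_inj]) auto
    have "basis_mod (weight_space A B \<kappa>) B (box_elem ` ?X)"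
    proof (rule basis_modI[OF _ inj])
      show "finite ?X" using fin by simp
      show "box_elem ` ?X \<subseteq> weight_space A B \<kappa>"
        using A(1) hw by (auto simp: weight_space_def fscale_eq_cscale)
      show "weight_space A B \<kappa> \<subseteq> pm.span (box_elem ` ?X \<union> B)"
      proof
        fix p assume "p \<in> weight_space A B \<kappa>"
        then have p: "p \<in> A" "cur Osp_h 0 * p - cscale (of_int \<kappa>) p \<in> B"
          by (auto simp: weight_space_def fscale_eq_cscale)
        then have "p \<in> pm.span (box_elem ` X \<union> B)" using A(2) by blast
        then obtain c where c: "p - (\<Sum>y\<in>X. cscale (c y) (box_elem y)) \<in> B"
          by (rule pm.span_image_Un_coeffs[OF fin B(1)])
        define b where "b = p - (\<Sum>y\<in>X. cscale (c y) (box_elem y))"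
        have pb: "p = (\<Sum>y\<in>X. cscale (c y) (box_elem y)) + b" by (simp add: b_def)
        let ?d = "\<lambda>y. cur Osp_h 0 * box_elem y - cscale (of_int (?w y)) (box_elem y)"
        \<comment> \<open>Applying \<open>h_0 - \<kappa>\<close> to the expansion of
          \<open>p\<close> multiplies its coefficients by \<open>?w y - \<kappa>\<close>;
          independence modulo \<open>B\<close> then removes the terms of other weights.\<close>
        have "(\<Sum>y\<in>X. cscale (c y * of_int (?w y - \<kappa>)) (box_elem y))
          = (cur Osp_h 0 * p - cscale (of_int \<kappa>) p) - (cur Osp_h 0 * b - cscale (of_int \<kappa>) b)
            - (\<Sum>y\<in>X. cscale (c y) (?d y))"
        proof -
          have "cur Osp_h 0 * p = (\<Sum>y\<in>X. cscale (c y) (cur Osp_h 0 * box_elem y)) + cur Osp_h 0 * b"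
            unfolding pb by (simp add: distrib_left sum_distrib_left)
          moreover have "cscale (of_int \<kappa>) p = (\<Sum>y\<in>X. cscale (c y * of_int \<kappa>) (box_elem y)) + cscale (of_int \<kappa>) b"
            unfolding pb by (simp add: pm.scale_right_distrib pm.scale_sum_right mult.commute)
          moreover have "(\<Sum>y\<in>X. cscale (c y) (?d y))
            = (\<Sum>y\<in>X. cscale (c y) (cur Osp_h 0 * box_elem y)) - (\<Sum>y\<in>X. cscale (c y * of_int (?w y)) (box_elem y))"
            by (simp add: pm.scale_right_diff_distrib sum_subtractf)
          moreover have "(\<Sum>y\<in>X. cscale (c y * of_int (?w y - \<kappa>)) (box_elem y))
            = (\<Sum>y\<in>X. cscale (c y * of_int (?w y)) (box_elem y)) - (\<Sum>y\<in>X. cscale (c y * of_int \<kappa>) (box_elem y))"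
            by (simp add: right_diff_distrib pm.scale_left_diff_distrib sum_subtractf)
          ultimately show ?thesis by simp
        qed
        also have "\<dots> \<in> B"
        proof -
          have b: "b \<in> B" using c by (simp add: b_def)
          have 1: "cur Osp_h 0 * b - cscale (of_int \<kappa>) b \<in> B"
            by (rule pm.subspace_diff[OF B(1) hB[OF b] pm.subspace_scale[OF B(1) b]])
          have 2: "(\<Sum>y\<in>X. cscale (c y) (?d y)) \<in> B"
            by (rule pm.subspace_sum[OF B(1)]) (rule pm.subspace_scale[OF B(1) hw])
          show ?thesis by (rule pm.subspace_diff[OF B(1) pm.subspace_diff[OF B(1) p(2) 1] 2])
        qed
        finally have "c y * of_int (?w y - \<kappa>) = 0" if "y \<in> X" for y
          using indep[of "\<lambda>y. c y * of_int (?w y - \<kappa>)"] that by blast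
        then have c0: "c y = 0" if "y \<in> X" "?w y \<noteq> \<kappa>" for y using that by fastforce
        have "(\<Sum>y\<in>X. cscale (c y) (box_elem y)) \<in> pm.span (box_elem ` ?X \<union> B)"
        proof (intro pm.span_sum)
          fix y assume y: "y \<in> X"
          show "cscale (c y) (box_elem y) \<in> pm.span (box_elem ` ?X \<union> B)"
          proof (cases "?w y = \<kappa>")
            case True then show ?thesis using y by (intro pm.span_scale pm.span_base) blast
          next
            case False then show ?thesis using c0[OF y] by (simp add: pm.span_zero)
          qed
        qed
        moreover have "b \<in> pm.span (box_elem ` ?X \<union> B)" using c by (intro pm.span_base) (simp add: b_def)
        ultimately show "p \<in> pm.span (box_elem ` ?X \<union> B)" unfolding pb by (rule pm.span_add)
      qed
      fix c y assume c: "(\<Sum>y\<in>?X. cscale (c y) (box_elem y)) \<in> B" and y: "y \<in> ?X"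
      have "(\<Sum>y\<in>?X. cscale (c y) (box_elem y)) = (\<Sum>y\<in>X. if ?w y = \<kappa> then cscale (c y) (box_elem y) else 0)"
        by (rule sum.inter_filter) (rule fin)
      also have "\<dots> = (\<Sum>y\<in>X. cscale (if ?w y = \<kappa> then c y else 0) (box_elem y))"
        by (intro sum.cong) auto
      finally have "(\<Sum>y\<in>X. cscale (if ?w y = \<kappa> then c y else 0) (box_elem y)) \<in> B" using c by simp
      from indep[OF this, of y] show "c y = 0" using y by simp
    qed
    from quot_dim_eq[OF B(1) this] show ?thesis using fin card_image[OF inj] by simp
  qed
  then have "weight_trace A B x = (\<Sum>\<^sub>\<infinity>\<kappa>. x powi \<kappa> * (\<Sum>y\<in>{y \<in> X. ?w y = \<kappa>}. 1))"
    unfolding weight_trace_def by (simp add: mult.commute)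
  also have "\<dots> = (\<Sum>y\<in>X. x powi ?w y)"
    unfolding infsum_fibers[OF fin] by simp
  finally show ?thesis .
qed

lemma weyl_component_span: "weyl_component n m = pm.span (weyl_ideal n \<union> Collect (homog m))"
  by (simp add: weyl_component_def fscale_eq_cscale homog_def[abs_def])

lemma weyl_component_homog:
  assumes "p \<in> weyl_component n m"
  obtains h where "homog m h" "p - h \<in> weyl_ideal n"
proof -
  have "\<exists>h. homog m h \<and> p - h \<in> weyl_ideal n"
    using assms unfolding weyl_component_span
  proof (induction rule: pm_span_induct)
    case zero
    then show ?case using homog_0 pm.subspace_0[OF subspace_weyl_ideal] by (intro exI[of _ 0]) simp
  next
    case (scale_add c b y)
    then obtain h where h: "homog m h" "y - h \<in> weyl_ideal n" by blast
    show ?case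
    proof (cases "b \<in> weyl_ideal n")
      case True
      have "cscale c b + (y - h) \<in> weyl_ideal n"
        by (intro pm.subspace_add[OF subspace_weyl_ideal] pm.subspace_scale[OF subspace_weyl_ideal] True h(2))
      then show ?thesis using h(1) by (intro exI[of _ h]) (simp add: algebra_simps)
    next
      case False
      then have "homog m b" using scale_add(1) by blast
      then have "homog m (cscale c b + h)" using h(1) by (intro homog_add homog_cscale)
      then show ?thesis using h(2) by (intro exI[of _ "cscale c b + h"]) simp
    qed
  qed
  then show ?thesis using that by blast
qed

lemma subspace_weyl_component: "pm.subspace (weyl_component n m)"
  by (simp add: weyl_component_span)

lemma weyl_ideal_component: "p \<in> weyl_ideal n \<Longrightarrow> p \<in> weyl_component n m"
  unfolding weyl_component_span by (intro pm.span_base) simp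

lemma homog_component: "homog m p \<Longrightarrow> p \<in> weyl_component n m"
  unfolding weyl_component_span by (intro pm.span_base) simp

lemma weyl_component_h: "p \<in> weyl_component n m \<Longrightarrow> cur Osp_h 0 * p \<in> weyl_component n m"
proof -
  assume "p \<in> weyl_component n m"
  then obtain h where h: "homog m h" "p - h \<in> weyl_ideal n" by (rule weyl_component_homog)
  have "homog (0 + m) (cur Osp_h 0 * h)" by (intro homog_mult homog_cur h)
  then have "cur Osp_h 0 * h \<in> weyl_component n m" by (intro homog_component) simp
  moreover have "cur Osp_h 0 * (p - h) \<in> weyl_component n m"
    by (intro weyl_ideal_component weyl_ideal_mult h)
  ultimately have "cur Osp_h 0 * h + cur Osp_h 0 * (p - h) \<in> weyl_component n m"
    by (rule pm.subspace_add[OF subspace_weyl_component])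
  then show ?thesis by (simp flip: distrib_left)
qed

lemma weyl_char_eq_trisum: "weyl_char n x p = trisum (\<lambda>M r k. p ^ triangle r) p x n"
proof -
  have "weight_trace (weyl_component n m) (weyl_ideal n) x
      = (\<Sum>y\<in>{y \<in> box_indices n. box_tdeg y = m}. x powi box_weight n y)" for m
  proof (rule weight_trace_box[OF _ subspace_weyl_ideal subset_refl weyl_ideal_mult])
    let ?X = "{y \<in> box_indices n. box_tdeg y = m}"
    show "?X \<subseteq> box_indices n" by blast
    show "box_elem ` ?X \<subseteq> weyl_component n m"
      using homog_box_elem by (auto intro: homog_component)
    show "weyl_component n m \<subseteq> pm.span (box_elem ` ?X \<union> weyl_ideal n)"
    proof
      fix p assume "p \<in> weyl_component n m"
      then obtain h where h: "homog m h" "p - h \<in> weyl_ideal n" by (rule weyl_component_homog)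
      obtain c where c: "h - (\<Sum>y\<in>?X. cscale (c y) (box_elem y)) \<in> weyl_ideal n"
        by (rule homog_box_expansion[OF h(1)])
      have "(p - h) + (h - (\<Sum>y\<in>?X. cscale (c y) (box_elem y))) + (\<Sum>y\<in>?X. cscale (c y) (box_elem y))
          \<in> pm.span (box_elem ` ?X \<union> weyl_ideal n)"
        using h(2) c by (intro pm.span_add pm.span_sum pm.span_scale) (auto intro: pm.span_base)
      then show "p \<in> pm.span (box_elem ` ?X \<union> weyl_ideal n)" by simp
    qed
    fix c y assume c: "(\<Sum>y\<in>?X. cscale (c y) (box_elem y)) \<in> weyl_ideal n" and y: "y \<in> ?X"
    have "(\<Sum>y\<in>?X. cscale (c y) (box_elem y))
        = (\<Sum>y\<in>box_indices n. if box_tdeg y = m then cscale (c y) (box_elem y) else 0)"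
      by (rule sum.inter_filter) simp
    also have "\<dots> = (\<Sum>y\<in>box_indices n. cscale (if box_tdeg y = m then c y else 0) (box_elem y))"
      by (intro sum.cong) auto
    finally have "(\<Sum>y\<in>box_indices n. cscale (if box_tdeg y = m then c y else 0) (box_elem y)) \<in> weyl_ideal n"
      using c by simp
    from box_elem_independent[OF this, of y] show "c y = 0" using y by simp
  qed
  then have "weyl_char n x p = (\<Sum>y\<in>box_indices n. p ^ box_tdeg y * x powi box_weight n y)"
    unfolding weyl_char_def using infsum_fibers[OF finite_box_indices, where f = box_tdeg and g = "\<lambda>m. p ^ m"] by simp
  then show ?thesis using sum_box_trisum[where u = 1 and p = p and x = x and n = n] by simp
qed

subsection \<open>The PBW filtration\<close>

lemma subspace_pbw_filtration: "pm.subspace (pbw_filtration n s)"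
  by (cases s) (simp_all add: fscale_eq_cscale)

lemma pbw_filtration_Suc: "v \<in> pbw_filtration n s \<Longrightarrow> v \<in> pbw_filtration n (Suc s)"
  unfolding pbw_filtration.simps fscale_eq_cscale by (intro pm.span_base) simp

lemma pbw_filtration_mono: "s \<le> t \<Longrightarrow> v \<in> pbw_filtration n s \<Longrightarrow> v \<in> pbw_filtration n t"
  by (induction t rule: dec_induct) (auto intro: pbw_filtration_Suc simp del: pbw_filtration.simps)

lemma pbw_filtration_cur:
  "y \<in> {Osp_e, Osp_gp} \<Longrightarrow> v \<in> pbw_filtration n s \<Longrightarrow> cur y i * v \<in> pbw_filtration n (Suc s)"
  unfolding pbw_filtration.simps(2) fscale_eq_cscale by (intro pm.span_base) blast

lemma weyl_ideal_pbw_filtration: "v \<in> weyl_ideal n \<Longrightarrow> v \<in> pbw_filtration n s"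
proof (rule pbw_filtration_mono[of 0])
  assume "v \<in> weyl_ideal n"
  then show "v \<in> pbw_filtration n 0"
    unfolding pbw_filtration.simps fscale_eq_cscale by (intro pm.span_base) simp
qed simp

lemma word_pbw_filtration:
  "fst ` set ys \<subseteq> {Osp_e, Osp_gp} \<Longrightarrow> single (Osp_Word ys) 1 \<in> pbw_filtration n (length ys)"
proof (induction ys)
  case Nil
  have "single (Osp_Word []) 1 = (1 :: free_alg)" unfolding zero_osp_word_def[symmetric] by simp
  then show ?case by (simp add: fscale_eq_cscale pm.span_base)
next
  case (Cons yi ys)
  obtain y i where yi: "yi = (y, i)" by (cases yi)
  have "cur y i * single (Osp_Word ys) 1 = single (Osp_Word (yi # ys)) 1"
    by (simp add: yi cur_def mult_single plus_osp_word_def)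
  moreover have "cur y i * single (Osp_Word ys) 1 \<in> pbw_filtration n (Suc (length ys))"
    using Cons yi by (intro pbw_filtration_cur) auto
  ultimately show ?case by simp
qed

lemma box_elem_pbw_filtration: "box_elem x \<in> pbw_filtration n (pbw_deg x)"
proof -
  obtain k r a b where x: "x = (k, r, a, b)" by (cases x)
  have "single (fword k r \<alpha>) 1 \<in> pbw_filtration n (k + r)" for \<alpha>
  proof -
    have "fst ` set (letters (fword k r \<alpha>)) \<subseteq> {Osp_e, Osp_gp}" by (auto simp: fword_def)
    from word_pbw_filtration[OF this] show ?thesis by (simp add: fword_def del: pbw_filtration.simps)
  qed
  then have "fphi k r p \<in> pbw_filtration n (k + r)" for p
    unfolding fphi_def by (intro pm.linext_mem subspace_pbw_filtration)
  then show ?thesis by (simp add: x box_elem_def pbw_deg_def)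
qed

text \<open>The filtration is spanned, modulo the ideal, by box elements, which are weight vectors;
  so no commutators have to be computed.\<close>

lemma pbw_filtration_h: "v \<in> pbw_filtration n s \<Longrightarrow> cur Osp_h 0 * v \<in> pbw_filtration n s"
proof (rule pm_span_left_mult[OF pbw_filtration_span subspace_pbw_filtration], assumption, elim UnE imageE)
  fix v x assume "v = box_elem x" "x \<in> {x \<in> box_indices n. pbw_deg x \<le> s}"
  then have v: "v \<in> pbw_filtration n s"
    using pbw_filtration_mono[OF _ box_elem_pbw_filtration] by blast
  have "(cur Osp_h 0 * v - cscale (of_int (box_weight n x)) v) + cscale (of_int (box_weight n x)) v \<in> pbw_filtration n s"
    unfolding \<open>v = box_elem x\<close>
    by (rule pm.subspace_add[OF subspace_pbw_filtration weyl_ideal_pbw_filtration[OF box_elem_weight]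
          pm.subspace_scale[OF subspace_pbw_filtration v[unfolded \<open>v = box_elem x\<close>]]])
  then show "cur Osp_h 0 * v \<in> pbw_filtration n s" by simp
next
  fix v assume "v \<in> weyl_ideal n"
  then show "cur Osp_h 0 * v \<in> pbw_filtration n s"
    by (intro weyl_ideal_pbw_filtration weyl_ideal_mult)
qed

lemma pbw_below_span:
  "v \<in> pbw_below n s \<Longrightarrow> v \<in> pm.span (box_elem ` {x \<in> box_indices n. pbw_deg x < s} \<union> weyl_ideal n)"
proof (cases s)
  case 0
  assume "v \<in> pbw_below n s"
  then show ?thesis using 0 by (intro pm.span_base) (simp add: pbw_below_def)
next
  case (Suc t)
  assume "v \<in> pbw_below n s"
  then show ?thesis using Suc pbw_filtration_span[of v n t] by (simp add: pbw_below_def less_Suc_eq_le)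
qed

lemma subspace_pbw_below: "pm.subspace (pbw_below n s)"
  by (cases s) (simp_all add: pbw_below_def subspace_weyl_ideal subspace_pbw_filtration del: pbw_filtration.simps)

lemma weyl_ideal_pbw_below: "v \<in> weyl_ideal n \<Longrightarrow> v \<in> pbw_below n s"
  by (cases s) (simp_all add: pbw_below_def weyl_ideal_pbw_filtration del: pbw_filtration.simps)

lemma pbw_below_h: "v \<in> pbw_below n s \<Longrightarrow> cur Osp_h 0 * v \<in> pbw_below n s"
  by (cases s) (simp_all add: pbw_below_def weyl_ideal_mult pbw_filtration_h del: pbw_filtration.simps)

lemma box_elem_pbw_below: "pbw_deg x < s \<Longrightarrow> box_elem x \<in> pbw_below n s"
  using pbw_filtration_mono[OF _ box_elem_pbw_filtration]
  by (cases s) (auto simp: pbw_below_def simp del: pbw_filtration.simps)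

text \<open>The expansion given by the filtration is projected to t-degree \<open>m\<close>. Box
  elements are homogeneous, so the projection merely selects some of them, and both conditions can
  be imposed at once.\<close>

lemma pbw_component_span:
  assumes "p \<in> pbw_filtration n s" "p \<in> weyl_component n m"
  shows "p \<in> pm.span (box_elem ` {x \<in> box_indices n. pbw_deg x \<le> s \<and> box_tdeg x = m} \<union> weyl_ideal n)"
    (is "p \<in> pm.span (box_elem ` ?X \<union> _)")
proof -
  obtain h where h: "homog m h" "p - h \<in> weyl_ideal n" using assms(2) by (rule weyl_component_homog)
  let ?Y = "{x \<in> box_indices n. pbw_deg x \<le> s}"
  have fin: "finite ?Y" by simp
  obtain c where c: "p - (\<Sum>x\<in>?Y. cscale (c x) (box_elem x)) \<in> weyl_ideal n"
    by (rule pm.span_image_Un_coeffs[OF fin subspace_weyl_ideal pbw_filtration_span[OF assms(1)]])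
  from pm.subspace_diff[OF subspace_weyl_ideal c h(2)]
  have "h - (\<Sum>x\<in>?Y. cscale (c x) (box_elem x)) \<in> weyl_ideal n" by simp
  then have "hpart m (h - (\<Sum>x\<in>?Y. cscale (c x) (box_elem x))) \<in> weyl_ideal n" by (rule hpart_weyl_ideal)
  moreover have "hpart m (\<Sum>x\<in>?Y. cscale (c x) (box_elem x))
      = (\<Sum>x\<in>?Y. if box_tdeg x = m then cscale (c x) (box_elem x) else 0)"
    unfolding hpart_simps by (intro sum.cong refl) (simp add: hpart_homog[OF homog_box_elem])
  moreover have "(\<Sum>x\<in>?Y. if box_tdeg x = m then cscale (c x) (box_elem x) else 0)
      = (\<Sum>x\<in>{x \<in> ?Y. box_tdeg x = m}. cscale (c x) (box_elem x))"
    by (rule sum.inter_filter[symmetric]) simp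
  moreover have "{x \<in> ?Y. box_tdeg x = m} = ?X" by blast
  ultimately have d: "h - (\<Sum>x\<in>?X. cscale (c x) (box_elem x)) \<in> weyl_ideal n"
    by (simp only: hpart_simps(2) hpart_homog[OF h(1)] if_True simp_thms)
  have "(p - h) + (h - (\<Sum>x\<in>?X. cscale (c x) (box_elem x))) + (\<Sum>x\<in>?X. cscale (c x) (box_elem x))
      \<in> pm.span (box_elem ` ?X \<union> weyl_ideal n)"
    using h(2) d by (intro pm.span_add pm.span_sum pm.span_scale) (auto intro: pm.span_base)
  then show ?thesis by simp
qed

lemma gr_weyl_char_eq_trisum:
  "gr_weyl_char n x p u = trisum (\<lambda>M r k. u ^ (k + r) * p ^ triangle r) p x n"
proof -
  have wt: "weight_trace (pbw_filtration n s \<inter> weyl_component n m) (pbw_below n s \<inter> weyl_component n m) x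
      = (\<Sum>y\<in>{y \<in> box_indices n. (pbw_deg y, box_tdeg y) = (s, m)}. x powi box_weight n y)" for s m
  proof (rule weight_trace_box)
    let ?X = "{y \<in> box_indices n. (pbw_deg y, box_tdeg y) = (s, m)}"
    let ?B = "pbw_below n s \<inter> weyl_component n m"
    show "?X \<subseteq> box_indices n" by blast
    show "pm.subspace ?B" by (intro pm.subspace_inter subspace_pbw_below subspace_weyl_component)
    show "weyl_ideal n \<subseteq> ?B" using weyl_ideal_pbw_below weyl_ideal_component by blast
    show "cur Osp_h 0 * b \<in> ?B" if "b \<in> ?B" for b
      using that pbw_below_h weyl_component_h by blast
    show "box_elem ` ?X \<subseteq> pbw_filtration n s \<inter> weyl_component n m"
      using box_elem_pbw_filtration[of _ n] homog_box_elem
      by (auto intro: homog_component simp del: pbw_filtration.simps)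
    show "pbw_filtration n s \<inter> weyl_component n m \<subseteq> pm.span (box_elem ` ?X \<union> ?B)"
    proof
      fix p assume "p \<in> pbw_filtration n s \<inter> weyl_component n m"
      then have "p \<in> pm.span (box_elem ` {x \<in> box_indices n. pbw_deg x \<le> s \<and> box_tdeg x = m} \<union> weyl_ideal n)"
        using pbw_component_span by blast
      also have "\<dots> \<subseteq> pm.span (box_elem ` ?X \<union> ?B)"
      proof (rule pm.span_minimal[OF subsetI pm.subspace_span], rule pm.span_base)
        fix v assume "v \<in> box_elem ` {x \<in> box_indices n. pbw_deg x \<le> s \<and> box_tdeg x = m} \<union> weyl_ideal n"
        then show "v \<in> box_elem ` ?X \<union> ?B"
        proof
          assume "v \<in> box_elem ` {x \<in> box_indices n. pbw_deg x \<le> s \<and> box_tdeg x = m}"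
          then obtain y where y: "v = box_elem y" "y \<in> box_indices n" "pbw_deg y \<le> s" "box_tdeg y = m" by blast
          show ?thesis
          proof (cases "pbw_deg y = s")
            case True then show ?thesis using y by blast
          next
            case False
            then show ?thesis using y box_elem_pbw_below homog_component[OF homog_box_elem[of y]] by auto
          qed
        qed (use weyl_ideal_pbw_below weyl_ideal_component in blast)
      qed
      finally show "p \<in> pm.span (box_elem ` ?X \<union> ?B)" .
    qed
    fix c y assume c: "(\<Sum>y\<in>?X. cscale (c y) (box_elem y)) \<in> ?B" and y: "y \<in> ?X"
    let ?Z = "{y \<in> box_indices n. pbw_deg y < s}"
    have fin: "finite ?Z" by simp
    have "(\<Sum>y\<in>?X. cscale (c y) (box_elem y)) \<in> pbw_below n s" using c by blast
    then obtain c' where c': "(\<Sum>y\<in>?X. cscale (c y) (box_elem y)) - (\<Sum>y\<in>?Z. cscale (c' y) (box_elem y)) \<in> weyl_ideal n"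
      by (rule pm.span_image_Un_coeffs[OF fin subspace_weyl_ideal pbw_below_span])
    \<comment> \<open>The index sets of \<open>c\<close> and \<open>c'\<close> are disjoint, with
      PBW degree equal to \<open>s\<close> and below \<open>s\<close>, so the two families combine
      into one relation.\<close>
    define d where "d y = (if (pbw_deg y, box_tdeg y) = (s, m) then c y else if pbw_deg y < s then - c' y else 0)" for y
    have "(\<Sum>y\<in>box_indices n. cscale (d y) (box_elem y))
       = (\<Sum>y\<in>box_indices n. (if (pbw_deg y, box_tdeg y) = (s, m) then cscale (c y) (box_elem y) else 0)
          - (if pbw_deg y < s then cscale (c' y) (box_elem y) else 0))"
      by (intro sum.cong refl) (auto simp: d_def)
    also have "\<dots> = (\<Sum>y\<in>?X. cscale (c y) (box_elem y)) - (\<Sum>y\<in>?Z. cscale (c' y) (box_elem y))"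
      unfolding sum_subtractf sum.inter_filter[OF finite_box_indices] ..
    finally have "(\<Sum>y\<in>box_indices n. cscale (d y) (box_elem y)) \<in> weyl_ideal n" using c' by simp
    from box_elem_independent[OF this, of y] show "c y = 0" using y by (simp add: d_def)
  qed
  have "gr_weyl_char n x p u
      = (\<Sum>\<^sub>\<infinity>\<kappa>. (case \<kappa> of (s, m) \<Rightarrow> u ^ s * p ^ m) * (\<Sum>y\<in>{y \<in> box_indices n. (pbw_deg y, box_tdeg y) = \<kappa>}. x powi box_weight n y))"
    unfolding gr_weyl_char_def wt by (intro infsum_cong) auto
  also have "\<dots> = (\<Sum>y\<in>box_indices n. u ^ pbw_deg y * p ^ box_tdeg y * x powi box_weight n y)"
    by (subst infsum_fibers[OF finite_box_indices]) simp
  finally show ?thesis by (simp only: sum_box_trisum)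
qed

theorem theorem0p2:
  fixes n :: nat and x q :: complex
  assumes "x \<noteq> 0" and "q \<noteq> 0"
  shows "(macdonald_E (- int n) x q \<longlongrightarrow> weyl_char n x (q ^ 2)) (at 0) \<and>
         (macdonald_E (- int n) x (inverse q) \<longlongrightarrow> gr_weyl_char n x (q ^ 2) (q ^ 2)) at_infinity"
proof
  show "(macdonald_E (- int n) x q \<longlongrightarrow> weyl_char n x (q ^ 2)) (at 0)"
    unfolding weyl_char_eq_trisum by (rule macdonald_E_tendsto_0[OF assms(1)])
  \<comment> \<open>At \<open>u = p = q ^ 2\<close> the PBW factor \<open>u ^ (k + r)\<close> merges
    with the power from the staircase.\<close>
  have "gr_weyl_char n x (q ^ 2) (q ^ 2) = trisum (\<lambda>M r k. (q ^ 2) ^ (triangle r + r + k)) (q ^ 2) x n"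
    unfolding gr_weyl_char_eq_trisum by (rule trisum_cong) (simp add: power_add mult_ac)
  then show "(macdonald_E (- int n) x (inverse q) \<longlongrightarrow> gr_weyl_char n x (q ^ 2) (q ^ 2)) at_infinity"
    using macdonald_E_tendsto_infinity[OF assms, of n] by simp
qed

end
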